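(* Fix $p\in(0,4)$ and let $(u_k)$ be a sequence of radial normal solutions of $$\Delta^2u_k=(1-|x|^p)e^{4u_k}\quad\text{in }\mathbb{R}^4,\qquad \Lambda_k=\int_{\mathbb{R}^4}(1-|x|^p)e^{4u_k}\,dx,$$ with $\Lambda_k\uparrow\Lambda_{\mathrm{sph}}$ as $k\to\infty$. Then $$(1-|x|^p)e^{4u_k}\rightharpoonup\Lambda_{\mathrm{sph}}\,\delta_0\quad\text{as }k\to\infty$$ weakly in the sense of measures, where $\delta_0$ is the Dirac mass at the origin, and setting $$\eta_k(x):=u_k(r_kx)-u_k(0)+\log2,\qquad r_k:=96^{1/4}e^{-u_k(0)},$$ we have $$\eta_k(x)\to\log\left(\frac{2}{1+|x|^2}\right)\quad\text{locally uniformly in }\mathbb{R}^4.$$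
   Context: Constant: $\Lambda_{\mathrm{sph}}:=16\pi^2$. Normal solution: given $K\in L^\infty_{loc}(\mathbb{R}^4)$, a function $u$ is a normal solution of $\Delta^2u=Ke^{4u}$ in $\mathbb{R}^4$ if $Ke^{4u}\in L^1(\mathbb{R}^4)$ and $u$ solves the integral equation $$u(x)=\frac{1}{8\pi^2}\int_{\mathbb{R}^4}\log\left(\frac{|y|}{|x-y|}\right)K(y)e^{4u(y)}\,dy+c$$ for some constant $c\in\mathbb{R}$. Here $K(x)=1-|x|^p$. *)

theory Defs
  imports "HOL-Probability.Probability"
begin

definition Lambda_sph :: real where
  "Lambda_sph = 16 * pi\<^sup>2"

definition L_infinity_loc :: "(real^4 \<Rightarrow> real) \<Rightarrow> bool" where
  "L_infinity_loc K \<longleftrightarrow> K \<in> borel_measurable lebesgue \<and>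
     (\<forall>S. compact S \<longrightarrow> (\<exists>C. AE x in lebesgue. x \<in> S \<longrightarrow> \<bar>K x\<bar> \<le> C))"

(* The Bochner integral of a non-integrable function is 0, so the existence of the
   integral on the right-hand side is required separately, for every x. *)
definition normal_solution :: "(real^4 \<Rightarrow> real) \<Rightarrow> (real^4 \<Rightarrow> real) \<Rightarrow> bool" where
  "normal_solution K u \<longleftrightarrow>
     L_infinity_loc K \<and>
     integrable lebesgue (\<lambda>y. K y * exp (4 * u y)) \<and>
     (\<exists>c. \<forall>x.
        integrable lebesgue (\<lambda>y. ln (norm y / norm (x - y)) * K y * exp (4 * u y)) \<and>
        u x = 1 / (8 * pi\<^sup>2) *
              (LINT y|lebesgue. ln (norm y / norm (x - y)) * K y * exp (4 * u y)) + c)"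

definition radial :: "(real^4 \<Rightarrow> real) \<Rightarrow> bool" where
  "radial u \<longleftrightarrow> (\<forall>x y. norm x = norm y \<longrightarrow> u x = u y)"

(* The signed measures f_k dx converge weakly to the (positive) measure M. A signed
   measure with integrable density is represented by its density. The test functions
   are the bounded continuous ones, so that in particular no mass is lost at infinity. *)
definition densities_converge_weakly :: "(nat \<Rightarrow> real^4 \<Rightarrow> real) \<Rightarrow> (real^4) measure \<Rightarrow> bool" where
  "densities_converge_weakly f M \<longleftrightarrow>
     (\<forall>\<phi> :: real^4 \<Rightarrow> real. continuous_on UNIV \<phi> \<longrightarrow> bounded (range \<phi>) \<longrightarrow>
        (\<lambda>k. LINT x|lebesgue. \<phi> x * f k x) \<longlonglongrightarrow> (LINT x|M. \<phi> x))"

abbreviation dirac :: "real^4 \<Rightarrow> (real^4) measure" where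
  "dirac a \<equiv> return borel a"

definition locally_uniform_limit ::
  "(nat \<Rightarrow> real^4 \<Rightarrow> real) \<Rightarrow> (real^4 \<Rightarrow> real) \<Rightarrow> bool" where
  "locally_uniform_limit f g \<longleftrightarrow> (\<forall>S. compact S \<longrightarrow> uniform_limit S f g sequentially)"

end

theory Submission
  imports Defs
begin

text \<open>
  Averaging the logarithmic potential over spheres turns the equation for a radial normal solution
  into a one-dimensional integral equation. Differentiating it gives Pohozaev's identity
  \<open>p / 4 * \<integral> |x|\<^sup>p e\<^sup>4\<^sup>u = \<Lambda> (1 - \<Lambda> / (16 \<pi>\<^sup>2))\<close>, so that \<open>|x|\<^sup>p e\<^sup>4\<^sup>u\<close> tends to 0 in \<open>L\<^sup>1\<close> when
  \<open>\<Lambda>\<close> tends to \<open>16 \<pi>\<^sup>2\<close>: all of the mass concentrates at the origin, and \<open>r\<^sub>k\<close> tends to 0.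

  The rescaled profile satisfies \<open>v(t) = ln 2 - b t\<^sup>2 + (3/2) \<integral>\<^sub>0\<^sup>t k(t,s) (1 - q s\<^sup>p) e\<^sup>4\<^sup>v\<^sup>(\<^sup>s\<^sup>) ds\<close> with
  a nonnegative kernel \<open>k\<close>, where \<open>q\<close> tends to 0 and \<open>b\<close> is itself an integral of \<open>(1 - q s\<^sup>p) e\<^sup>4\<^sup>v\<close>. The
  spherical solution solves the equation with \<open>q = 0\<close> and \<open>b = 1\<close>. As the kernel is nonnegative, a larger
  \<open>b\<close> makes \<open>v\<close> smaller, but this would make the integral defining \<open>b\<close> smaller as well. Quantified
  by Gronwall's inequality, this forces \<open>b\<close> to tend to 1 and \<open>v\<close> to converge, without any compactness
  argument or classification of entire solutions.
\<close>

section \<open>Lebesgue measure on four-space in terms of the norm and one coordinate\<close>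

text \<open>The averaged kernel depends on \<open>s / r\<close> alone, and \<open>- r\<close> times
  its \<open>r\<close>-derivative is a weight with
  \<open>kernel_weight t + kernel_weight (1 / t) = 1\<close>. This symmetry turns the interaction
  term of Pohozaev's identity into half of a square. The right-hand side of the identity vanishes
  exactly for the masses 0 and \<open>Lambda_sph\<close>.

  The obstacle in the rescaled equation is that \<open>v t\<close> depends on \<open>v\<close> over
  the whole half-line, so Gronwall's inequality does not apply directly. Adding
  \<open>t\<^sup>2 / (4 * s\<^sup>2)\<close> to the kernel makes it vanish for
  \<open>s \<ge> t\<close>; all nonlocal information is then collected in the single number
  \<open>b\<close>.

  Constants: the unit three-sphere has area \<open>2 * pi\<^sup>2\<close>, so the factor
  \<open>1 / (8 * pi\<^sup>2)\<close> becomes 1/4 in radial form. The shift by \<open>ln 2\<close>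
  gives a factor 16 and the choice of \<open>r k\<close> a factor 96; since 96 / 16 = 6, the radial
  factor 1/4 becomes 3/2. The limit equation has right-hand side \<open>6 * exp (4 * \<eta>)\<close>
  and is solved by the round four-sphere, of volume \<open>8 * pi\<^sup>2 / 3\<close> and hence of
  mass \<open>Lambda_sph\<close>.\<close>

definition four_space :: "real \<times> real \<times> real \<times> real \<Rightarrow> real^4" where
  "four_space = (\<lambda>(a, b, c, d). a *\<^sub>R axis 1 1 + b *\<^sub>R axis 2 1 + c *\<^sub>R axis 3 1 + d *\<^sub>R axis 4 1)"

lemma four_space_nth [simp]:
  "four_space (a, b, c, d) $ 1 = a" "four_space (a, b, c, d) $ 2 = b"
  "four_space (a, b, c, d) $ 3 = c" "four_space (a, b, c, d) $ 4 = d"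
  by (simp_all add: four_space_def axis_def)

lemma four_space_nth_1 [simp]: "four_space (a, z) $ 1 = a"
  by (cases z) simp

lemma norm_four_space: "norm (four_space (a, z)) = sqrt (a\<^sup>2 + (norm z)\<^sup>2)"
  by (cases z) (simp add: norm_vec_def L2_set_def sum_4 norm_prod_def add.assoc)

lemma measurable_four_space [measurable]: "four_space \<in> borel_measurable borel"
  unfolding four_space_def case_prod_unfold
  by (intro borel_measurable_continuous_onI continuous_intros)

lemma prod_Basis_vec4: "(\<Prod>b\<in>Basis. f (b::real^4)) = f (axis 1 1) * f (axis 2 1) * f (axis 3 1) * f (axis 4 1)"
proof -
  have B: "(Basis :: (real^4) set) = {axis 1 1, axis 2 1, axis 3 1, axis 4 1}"
    unfolding Basis_vec_def UNIV_4 by auto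
  show ?thesis
    unfolding B by (simp add: axis_eq_axis ac_simps)
qed

text \<open>Lebesgue measure is determined by its values on boxes, and the preimage of a box is a
  product of four intervals. The identification lets Fubini split off the first coordinate and
  leaves Euclidean balls in three dimensions.\<close>

lemma lborel_four_space: "lborel = distr lborel borel four_space"
proof (rule lborel_eqI)
  fix l u :: "real^4"
  assume le: "\<And>b. b \<in> Basis \<Longrightarrow> l \<bullet> b \<le> u \<bullet> b"
  have le': "l $ i \<le> u $ i" for i
    using le[of "axis i 1"] by (simp add: inner_axis)
  let ?I = "\<lambda>i::4. {l $ i<..<u $ i}"
  have "emeasure (distr lborel borel four_space) (box l u) = emeasure lborel (four_space -` box l u)"
    by (subst emeasure_distr) auto
  also have "four_space -` box l u = ?I 1 \<times> ?I 2 \<times> ?I 3 \<times> ?I 4"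
    by (auto simp: mem_box_cart forall_4)
  also have "emeasure lborel \<dots> = emeasure lborel (?I 1) * (emeasure lborel (?I 2) *
      (emeasure lborel (?I 3) * emeasure lborel (?I 4)))"
    unfolding lborel_prod[symmetric]
    by (simp add: lborel.emeasure_pair_measure_Times sigma_finite_measure.emeasure_pair_measure_Times
          sigma_finite_pair_measure lborel.sigma_finite_measure_axioms)
  also have "\<dots> = (\<Prod>b\<in>Basis. (u - l) \<bullet> b)"
    using le' unfolding prod_Basis_vec4
    by (simp add: inner_axis ennreal_mult'[symmetric] ac_simps)
  finally show "emeasure (distr lborel borel four_space) (box l u) = (\<Prod>b\<in>Basis. (u - l) \<bullet> b)" .
qed simp

lemma nn_integral_four_space:
  assumes [measurable]: "f \<in> borel_measurable borel"
  shows "(\<integral>\<^sup>+y. f y \<partial>(lborel :: (real^4) measure)) = (\<integral>\<^sup>+a. \<integral>\<^sup>+z. f (four_space (a, z)) \<partial>lborel \<partial>lborel)"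
proof -
  have "(\<integral>\<^sup>+y. f y \<partial>(lborel :: (real^4) measure)) = (\<integral>\<^sup>+x. f (four_space x) \<partial>lborel)"
    by (subst lborel_four_space) (simp add: nn_integral_distr)
  also have "\<dots> = (\<integral>\<^sup>+x. f (four_space x) \<partial>(lborel \<Otimes>\<^sub>M lborel))"
    by (simp add: lborel_prod)
  also have "\<dots> = (\<integral>\<^sup>+a. \<integral>\<^sup>+z. f (four_space (a, z)) \<partial>lborel \<partial>lborel)"
    by (rule lborel.nn_integral_fst[symmetric]) (simp add: lborel_prod)
  finally show ?thesis .
qed

text \<open>The antiderivative is the volume of the three-ball of radius
  \<open>sqrt (x\<^sup>2 - a\<^sup>2)\<close>, the slice at height \<open>a\<close> of the four-ball
  of radius \<open>x\<close>.\<close>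

lemma has_integral_sqrt_diff_squares:
  fixes a x :: real
  assumes "\<bar>a\<bar> \<le> x"
  shows "((\<lambda>s. 4 * pi * s * sqrt (s\<^sup>2 - a\<^sup>2)) has_integral 4 / 3 * pi * sqrt (x\<^sup>2 - a\<^sup>2) ^ 3) {\<bar>a\<bar>..x}"
proof -
  let ?F = "\<lambda>s. 4 / 3 * pi * sqrt (s\<^sup>2 - a\<^sup>2) ^ 3"
  \<comment> \<open>The chain rule for the square root breaks down at the left endpoint, where the
    radicand is 0; only continuity is used there.\<close>
  have "((\<lambda>s. 4 * pi * s * sqrt (s\<^sup>2 - a\<^sup>2)) has_integral ?F x - ?F \<bar>a\<bar>) {\<bar>a\<bar>..x}"
  proof (rule fundamental_theorem_of_calculus_interior[OF assms])
    show "continuous_on {\<bar>a\<bar>..x} ?F"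
      by (intro continuous_intros)
    fix s assume s: "s \<in> {\<bar>a\<bar><..<x}"
    then have pos: "0 < s\<^sup>2 - a\<^sup>2"
      using power_strict_mono[of "\<bar>a\<bar>" s 2] by simp
    have eq: "4 / 3 * pi * (3 * (2 * s * (inverse (sqrt (s\<^sup>2 - a\<^sup>2)) / 2)) * (sqrt (s\<^sup>2 - a\<^sup>2))\<^sup>2) = 4 * pi * s * sqrt (s\<^sup>2 - a\<^sup>2)"
      using pos by (simp add: field_simps power2_eq_square)
    have "(?F has_real_derivative 4 / 3 * pi * (3 * (2 * s * (inverse (sqrt (s\<^sup>2 - a\<^sup>2)) / 2)) * (sqrt (s\<^sup>2 - a\<^sup>2))\<^sup>2)) (at s)"
      using pos by (auto intro!: derivative_eq_intros)
    then show "(?F has_vector_derivative 4 * pi * s * sqrt (s\<^sup>2 - a\<^sup>2)) (at s)"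
      unfolding eq by (simp add: has_real_derivative_iff_has_vector_derivative)
  qed
  then show ?thesis by simp
qed

text \<open>Sublevel sets of the map are balls, so both measures can be evaluated on the half-lines
  \<open>{..x}\<close>. These form an intersection-stable generator on which the measures are
  finite.\<close>

lemma distr_sqrt_norm3:
  fixes a :: real
  assumes "DIM('a::euclidean_space) = 3"
  shows "distr (lborel :: 'a measure) borel (\<lambda>z. sqrt (a\<^sup>2 + (norm z)\<^sup>2)) =
    density lborel (\<lambda>s. ennreal (indicator {\<bar>a\<bar><..} s * (4 * pi * s * sqrt (s\<^sup>2 - a\<^sup>2))))"
    (is "?L = ?R")
proof (rule measure_eqI_generator_eq[where \<Omega>=UNIV and E="range atMost" and A="\<lambda>n. {..real n}"])
  show "Int_stable (range (atMost :: real \<Rightarrow> _))"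
    by (auto simp: Int_stable_def)
  show "sets ?L = sigma_sets UNIV (range (atMost :: real \<Rightarrow> _))" "sets ?R = sigma_sets UNIV (range (atMost :: real \<Rightarrow> _))"
    by (simp_all add: borel_eq_atMost)
  have L: "emeasure ?L {..x} = ennreal (if \<bar>a\<bar> \<le> x then 4 / 3 * pi * sqrt (x\<^sup>2 - a\<^sup>2) ^ 3 else 0)" for x
  proof -
    have "emeasure ?L {..x} = emeasure (lborel :: 'a measure) ((\<lambda>z. sqrt (a\<^sup>2 + (norm z)\<^sup>2)) -` {..x})"
      by (subst emeasure_distr) auto
    also have "(\<lambda>z :: 'a. sqrt (a\<^sup>2 + (norm z)\<^sup>2)) -` {..x} = (if \<bar>a\<bar> \<le> x then cball 0 (sqrt (x\<^sup>2 - a\<^sup>2)) else {})"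
    proof (cases "\<bar>a\<bar> \<le> x")
      case True
      then have "0 \<le> x" by simp
      have "sqrt (a\<^sup>2 + (norm z)\<^sup>2) \<le> x \<longleftrightarrow> norm z \<le> sqrt (x\<^sup>2 - a\<^sup>2)" for z :: 'a
        using \<open>0 \<le> x\<close> by (metis abs_norm_cancel abs_of_nonneg add.commute le_diff_eq real_sqrt_abs real_sqrt_le_iff)
      then show ?thesis using True by auto
    next
      case False
      have "\<bar>a\<bar> \<le> sqrt (a\<^sup>2 + (norm z)\<^sup>2)" for z :: 'a
        by (rule real_le_rsqrt) simp
      then have "\<not> sqrt (a\<^sup>2 + (norm z)\<^sup>2) \<le> x" for z :: 'a
        using False order_trans by blast
      then show ?thesis using False by auto
    qed
    also have "emeasure (lborel :: 'a measure) \<dots> = ennreal (if \<bar>a\<bar> \<le> x then 4 / 3 * pi * sqrt (x\<^sup>2 - a\<^sup>2) ^ 3 else 0)"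
      using abs_le_square_iff[of a x] by (auto simp: emeasure_cball assms unit_ball_vol_3)
    finally show ?thesis .
  qed
  have R: "emeasure ?R {..x} = ennreal (if \<bar>a\<bar> \<le> x then 4 / 3 * pi * sqrt (x\<^sup>2 - a\<^sup>2) ^ 3 else 0)" for x
  proof -
    have "emeasure ?R {..x} = (\<integral>\<^sup>+s. ennreal (indicator {\<bar>a\<bar><..} s * (4 * pi * s * sqrt (s\<^sup>2 - a\<^sup>2))) * indicator {..x} s \<partial>lborel)"
      by (subst emeasure_density) auto
    also have "\<dots> = (\<integral>\<^sup>+s. ennreal (indicator {\<bar>a\<bar>..x} s * (4 * pi * s * sqrt (s\<^sup>2 - a\<^sup>2))) \<partial>lborel)"
      by (rule nn_integral_cong) (auto split: split_indicator)
    also have "\<dots> = ennreal (if \<bar>a\<bar> \<le> x then 4 / 3 * pi * sqrt (x\<^sup>2 - a\<^sup>2) ^ 3 else 0)"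
    proof (cases "\<bar>a\<bar> \<le> x")
      case True
      have "0 \<le> 4 * pi * s * sqrt (s\<^sup>2 - a\<^sup>2)" if "s \<in> {\<bar>a\<bar>..x}" for s
        using that abs_le_square_iff[of a s] by auto
      from nn_integral_has_integral_lebesgue[OF this has_integral_sqrt_diff_squares[OF True]] True
      show ?thesis by simp
    qed auto
    finally show ?thesis .
  qed
  show "emeasure ?L X = emeasure ?R X" if "X \<in> range atMost" for X
    using that L R by auto
  show "emeasure ?L {..real i} \<noteq> \<infinity>" for i
    using L by auto
qed (auto simp: real_arch_simple)

text \<open>The joint density of \<open>norm y\<close> and \<open>y $ 1\<close> on four-space: the
  points with given \<open>s\<close> and \<open>a\<close> form a two-sphere of radius
  \<open>sqrt (s\<^sup>2 - a\<^sup>2)\<close>, and passing from this radius to \<open>s\<close>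
  multiplies its area by \<open>s / sqrt (s\<^sup>2 - a\<^sup>2)\<close>.\<close>

definition slice_density :: "real \<Rightarrow> real \<Rightarrow> real" where
  "slice_density s a = indicator {\<bar>a\<bar><..} s * (4 * pi * s * sqrt (s\<^sup>2 - a\<^sup>2))"

lemma slice_density_nonneg: "0 \<le> slice_density s a"
  using abs_le_square_iff[of a s] by (auto simp: slice_density_def split: split_indicator)

lemma slice_density_eq_0: "s \<le> 0 \<Longrightarrow> slice_density s a = 0"
  by (auto simp: slice_density_def split: split_indicator)

lemma borel_measurable_slice_density [measurable]:
  "(\<lambda>x. slice_density (fst x) (snd x)) \<in> borel_measurable (borel \<Otimes>\<^sub>M borel)"
  "slice_density s \<in> borel_measurable borel"
  unfolding slice_density_def indicator_def greaterThan_iff by measurable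

text \<open>For \<open>x\<close> on the first axis, \<open>norm (x - y)\<close> is a function of
  \<open>norm y\<close> and \<open>y $ 1\<close>. Their joint law therefore replaces polar
  coordinates in the whole averaging argument.\<close>

lemma distr_norm_fst:
  "distr (lborel :: (real^4) measure) (lborel \<Otimes>\<^sub>M lborel) (\<lambda>y. (norm y, y $ 1)) =
   density (lborel \<Otimes>\<^sub>M lborel) (\<lambda>x. ennreal (slice_density (fst x) (snd x)))"
  (is "?L = density ?P ?d")
proof (rule measure_eqI)
  fix X assume "X \<in> sets ?L"
  then have [measurable]: "X \<in> sets ?P" by simp
  have [measurable]: "(\<lambda>y :: real^4. (norm y, y $ 1)) \<in> lborel \<rightarrow>\<^sub>M ?P"
    by (intro measurable_Pair) (auto intro!: borel_measurable_continuous_onI continuous_intros)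
  have "emeasure ?L X = (\<integral>\<^sup>+x. indicator X x \<partial>?L)"
    using \<open>X \<in> sets ?L\<close> by (rule nn_integral_indicator[symmetric])
  also have "\<dots> = (\<integral>\<^sup>+y. indicator X (norm y, y $ 1) \<partial>(lborel :: (real^4) measure))"
    by (rule nn_integral_distr) measurable
  also have "\<dots> = (\<integral>\<^sup>+a. \<integral>\<^sup>+z. indicator X (norm (four_space (a, z)), four_space (a, z) $ 1) \<partial>lborel \<partial>lborel)"
    by (rule nn_integral_four_space) measurable
  also have "\<dots> = (\<integral>\<^sup>+a. \<integral>\<^sup>+z. indicator X (sqrt (a\<^sup>2 + (norm z)\<^sup>2), a) \<partial>(lborel :: (real \<times> real \<times> real) measure) \<partial>lborel)"
    by (simp add: norm_four_space)
  also have "\<dots> = (\<integral>\<^sup>+a. \<integral>\<^sup>+s. ennreal (slice_density s a) * indicator X (s, a) \<partial>lborel \<partial>lborel)"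
  proof (rule nn_integral_cong)
    fix a :: real
    have "(\<integral>\<^sup>+z. indicator X (sqrt (a\<^sup>2 + (norm z)\<^sup>2), a) \<partial>(lborel :: (real \<times> real \<times> real) measure)) =
        (\<integral>\<^sup>+s. indicator X (s, a) \<partial>distr (lborel :: (real \<times> real \<times> real) measure) borel (\<lambda>z. sqrt (a\<^sup>2 + (norm z)\<^sup>2)))"
      by (subst nn_integral_distr) auto
    also have "\<dots> = (\<integral>\<^sup>+s. ennreal (slice_density s a) * indicator X (s, a) \<partial>lborel)"
      by (subst distr_sqrt_norm3) (auto simp: nn_integral_density slice_density_def)
    finally show "(\<integral>\<^sup>+z. indicator X (sqrt (a\<^sup>2 + (norm z)\<^sup>2), a) \<partial>(lborel :: (real \<times> real \<times> real) measure)) = (\<integral>\<^sup>+s. ennreal (slice_density s a) * indicator X (s, a) \<partial>lborel)" .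
  qed
  also have "\<dots> = (\<integral>\<^sup>+x. ?d x * indicator X x \<partial>?P)"
    by (subst lborel_pair.nn_integral_snd[symmetric]) auto
  also have "\<dots> = emeasure (density ?P ?d) X"
    by (rule emeasure_density[symmetric]) measurable
  finally show "emeasure ?L X = emeasure (density ?P ?d) X" .
qed simp

section \<open>Spherical means of the logarithm\<close>

text \<open>The mean of \<open>ln (norm y / norm (x - y))\<close> over the sphere \<open>norm y = s\<close> in four-space, where
  \<open>norm x = r\<close>.\<close>

definition radial_kernel :: "real \<Rightarrow> real \<Rightarrow> real" where
  "radial_kernel r s = (if s < r then ln (s / r) - s\<^sup>2 / (4 * r\<^sup>2) else - r\<^sup>2 / (4 * s\<^sup>2))"

text \<open>Since \<open>(sin \<theta>)\<^sup>2 = (1 - cos (2 * \<theta>)) / 2\<close>, only the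
  frequencies 0 and 2 survive. The squared sine is the angular density of the three-sphere, so this
  orthogonality will leave a single term of the logarithmic series.\<close>

lemma integral_sin_squared_cos:
  fixes n :: nat
  shows "((\<lambda>\<theta>. (sin \<theta>)\<^sup>2 * cos (real n * \<theta>)) has_integral
    (if n = 0 then pi / 2 else if n = 2 then - pi / 4 else 0)) {0..pi}"
proof -
  have D: "(sin \<theta>)\<^sup>2 * cos (real n * \<theta>) = cos (real n * \<theta>) / 2 - cos ((real n + 2) * \<theta>) / 4 - cos ((real n - 2) * \<theta>) / 4" for \<theta>
  proof -
    have "cos ((real n + 2) * \<theta>) + cos ((real n - 2) * \<theta>) = 2 * cos (real n * \<theta>) * cos (2 * \<theta>)"
      unfolding ring_distribs cos_add cos_diff by simp
    moreover have "cos (2 * \<theta>) = 1 - 2 * (sin \<theta>)\<^sup>2"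
      by (rule cos_double_sin)
    moreover have "a + b = 2 * c * d \<Longrightarrow> d = 1 - 2 * e \<Longrightarrow> e * c = c / 2 - a / 4 - b / 4" for a b c d e :: real
      by (simp add: field_simps)
    ultimately show ?thesis by blast
  qed
  have int: "((\<lambda>\<theta>. cos (c * \<theta>)) has_integral (if c = 0 then pi else sin (c * pi) / c)) {0..pi}" for c
  proof (cases "c = 0")
    case True
    then show ?thesis using has_integral_const_real[of "1::real" 0 pi] by simp
  next
    case False
    have "((\<lambda>\<theta>. cos (c * \<theta>)) has_integral (sin (c * pi) / c - sin (c * 0) / c)) {0..pi}"
      using False by (intro fundamental_theorem_of_calculus)
        (auto intro!: derivative_eq_intros simp flip: has_real_derivative_iff_has_vector_derivative)
    then show ?thesis using False by simp
  qed
  have s: "sin ((real n + 2) * pi) = 0" "sin ((real n - 2) * pi) = 0"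
    by (simp_all add: ring_distribs sin_add sin_diff)
  have "((\<lambda>\<theta>. cos (real n * \<theta>) / 2 - cos ((real n + 2) * \<theta>) / 4 - cos ((real n - 2) * \<theta>) / 4) has_integral
    ((if real n = 0 then pi else sin (real n * pi) / real n) / 2 - (if real n + 2 = 0 then pi else sin ((real n + 2) * pi) / (real n + 2)) / 4
     - (if real n - 2 = 0 then pi else sin ((real n - 2) * pi) / (real n - 2)) / 4)) {0..pi}"
    by (intro has_integral_diff has_integral_divide int)
  moreover have "real n + 2 \<noteq> 0" "real n - 2 = 0 \<longleftrightarrow> n = 2"
    by auto
  ultimately show ?thesis
    unfolding D by (auto simp: s split: if_splits)
qed

text \<open>Real part of the power series of \<open>ln (1 + z)\<close> at
  \<open>z = \<rho> *\<^sub>R cis \<theta>\<close>. The term \<open>n = 0\<close> is 0 by division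
  by zero.\<close>

lemma ln_cos_sums:
  fixes \<rho> \<theta> :: real
  assumes "\<bar>\<rho>\<bar> < 1"
  shows "(\<lambda>n. - ((- \<rho>) ^ n * cos (real n * \<theta>)) / real n) sums (ln (1 + 2 * \<rho> * cos \<theta> + \<rho>\<^sup>2) / 2)"
proof -
  define z where "z = \<rho> *\<^sub>R cis \<theta>"
  have z: "cmod z < 1" using assms by (simp add: z_def)
  then have nz: "1 + z \<noteq> 0"
    by (metis add.inverse_inverse add_eq_0_iff norm_minus_cancel norm_one order_less_irrefl)
  have "(\<lambda>n. Re (- ((-z)^n) / of_nat n)) sums Re (ln (1 + z))"
    using Ln_series'[OF z] by (rule sums_Re)
  moreover have "Re (- ((-z)^n) / of_nat n) = - ((- \<rho>) ^ n * cos (real n * \<theta>)) / real n" for n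
  proof -
    have "-z = (-\<rho>) *\<^sub>R cis \<theta>" by (simp add: z_def)
    then have "(-z)^n = (-\<rho>)^n *\<^sub>R cis (real n * \<theta>)"
      by (simp only: scaleR_power Complex.DeMoivre)
    then show ?thesis by (simp add: Re_divide_of_nat)
  qed
  moreover have "Re (ln (1 + z)) = ln (1 + 2 * \<rho> * cos \<theta> + \<rho>\<^sup>2) / 2"
  proof -
    have "Re (1 + z) = 1 + \<rho> * cos \<theta>" "Im (1 + z) = \<rho> * sin \<theta>"
      by (simp_all add: z_def)
    then have "(cmod (1 + z))\<^sup>2 = (1 + \<rho> * cos \<theta>)\<^sup>2 + (\<rho> * sin \<theta>)\<^sup>2"
      by (simp only: cmod_power2)
    also have "\<dots> = 1 + 2 * \<rho> * cos \<theta> + \<rho>\<^sup>2"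
      using sin_cos_squared_add[of \<theta>] by algebra
    finally have "(cmod (1 + z))\<^sup>2 = 1 + 2 * \<rho> * cos \<theta> + \<rho>\<^sup>2" .
    then have "ln ((cmod (1 + z))\<^sup>2) = ln (1 + 2 * \<rho> * cos \<theta> + \<rho>\<^sup>2)" by simp
    moreover have "ln ((cmod (1 + z))\<^sup>2) = 2 * ln (cmod (1 + z))"
      using nz by (subst ln_realpow) auto
    ultimately show ?thesis using nz by simp
  qed
  ultimately show ?thesis by (simp only:)
qed

text \<open>Integrate the series term by term, dominated by \<open>\<rho> ^ n\<close>. Only
  \<open>n = 2\<close> contributes, with value
  \<open>(- \<rho>\<^sup>2 / 2) * (- pi / 4)\<close>.\<close>

lemma integral_sin_squared_ln:
  fixes \<rho> :: real
  assumes "0 \<le> \<rho>" "\<rho> < 1"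
  shows "integral {0..pi} (\<lambda>\<theta>. (sin \<theta>)\<^sup>2 * (ln (1 + 2 * \<rho> * cos \<theta> + \<rho>\<^sup>2) / 2)) = pi * \<rho>\<^sup>2 / 8"
proof -
  define f where "f n \<theta> = indicator {0..pi} \<theta> * ((sin \<theta>)\<^sup>2 * (- ((- \<rho>) ^ n * cos (real n * \<theta>)) / real n))" for n \<theta>
  have cont: "continuous_on {0..pi} (\<lambda>\<theta>. (sin \<theta>)\<^sup>2 * (- ((- \<rho>) ^ n * cos (real n * \<theta>)) / real n))" for n
    by (cases "n = 0") (auto intro!: continuous_intros)
  have int: "set_integrable lborel {0..pi} (\<lambda>\<theta>. (sin \<theta>)\<^sup>2 * (- ((- \<rho>) ^ n * cos (real n * \<theta>)) / real n))" for n
    by (rule borel_integrable_atLeastAtMost'[OF cont])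
  then have f_int: "integrable lborel (f n)" for n
  proof -
    have "f n = (\<lambda>\<theta>. indicator {0..pi} \<theta> *\<^sub>R ((sin \<theta>)\<^sup>2 * (- ((- \<rho>) ^ n * cos (real n * \<theta>)) / real n)))"
      by (simp add: f_def fun_eq_iff)
    then show ?thesis using int[of n] unfolding set_integrable_def by simp
  qed
  have val: "integral\<^sup>L lborel (f n) = (if n = 2 then pi * \<rho>\<^sup>2 / 8 else 0)" for n
  proof -
    have "integral\<^sup>L lborel (f n) = integral {0..pi} (\<lambda>\<theta>. (sin \<theta>)\<^sup>2 * (- ((- \<rho>) ^ n * cos (real n * \<theta>)) / real n))"
      unfolding set_borel_integral_eq_integral(2)[OF int[of n], symmetric] set_lebesgue_integral_def
      by (rule Bochner_Integration.integral_cong) (auto simp: f_def)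
    also have "\<dots> = integral {0..pi} (\<lambda>\<theta>. (- ((- \<rho>) ^ n) / real n) * ((sin \<theta>)\<^sup>2 * cos (real n * \<theta>)))"
      by (simp add: mult_ac)
    also have "\<dots> = (- ((- \<rho>) ^ n) / real n) * (if n = 0 then pi / 2 else if n = 2 then - pi / 4 else 0)"
      using has_integral_mult_right[OF integral_sin_squared_cos[of n]] by (rule integral_unique)
    finally show ?thesis by auto
  qed
  have bound: "\<bar>f n \<theta>\<bar> \<le> \<rho> ^ n * indicator {0..pi} \<theta>" for n \<theta>
  proof -
    have "\<bar>(sin \<theta>)\<^sup>2 * ((\<rho> ^ n * \<bar>cos (real n * \<theta>)\<bar>) / real n)\<bar> \<le> 1 * (\<rho> ^ n)"
      unfolding abs_mult
    proof (rule mult_mono)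
      show "\<bar>(sin \<theta>)\<^sup>2\<bar> \<le> 1" by (simp add: power_le_one_iff abs_square_le_1)
      have "\<rho> ^ n * \<bar>cos (real n * \<theta>)\<bar> / real n \<le> \<rho> ^ n"
      proof (cases "n = 0")
        case False
        have "\<rho> ^ n * \<bar>cos (real n * \<theta>)\<bar> \<le> \<rho> ^ n * real n"
          using False assms by (intro mult_left_mono) (auto intro: order_trans[OF abs_cos_le_one])
        then show ?thesis using False by (simp add: field_simps)
      qed auto
      then show "\<bar>\<rho> ^ n * \<bar>cos (real n * \<theta>)\<bar> / real n\<bar> \<le> \<rho> ^ n"
        using assms by simp
    qed (use assms in auto)
    then show ?thesis
      using assms by (auto simp: f_def abs_mult power_abs split: split_indicator)
  qed
  have summ: "summable (\<lambda>n. norm (f n \<theta>))" for \<theta>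
  proof (rule summable_comparison_test'[where g="\<lambda>n. \<rho> ^ n" and N=0])
    show "summable (\<lambda>n. \<rho> ^ n)" using assms by (intro summable_geometric) auto
    show "norm (norm (f n \<theta>)) \<le> \<rho> ^ n" for n
      using bound[of n \<theta>] assms by (cases "\<theta> \<in> {0..pi}") (auto intro: order_trans)
  qed
  have "(\<lambda>n. integral\<^sup>L lborel (f n)) sums (\<integral>\<theta>. (\<Sum>n. f n \<theta>) \<partial>lborel)"
  proof (rule sums_integral[OF f_int])
    show "AE \<theta> in lborel. summable (\<lambda>n. norm (f n \<theta>))" using summ by simp
    show "summable (\<lambda>n. \<integral>\<theta>. norm (f n \<theta>) \<partial>lborel)"
    proof (rule summable_comparison_test'[where g="\<lambda>n. pi * \<rho> ^ n" and N=0])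
      show "summable (\<lambda>n. pi * \<rho> ^ n)" using assms by (intro summable_mult summable_geometric) auto
      fix n
      have "(\<integral>\<theta>. norm (f n \<theta>) \<partial>lborel) \<le> (\<integral>\<theta>. \<rho> ^ n * indicator {0..pi} \<theta> \<partial>lborel)"
        using bound f_int by (intro integral_mono) auto
      then show "norm (\<integral>\<theta>. norm (f n \<theta>) \<partial>lborel) \<le> pi * \<rho> ^ n"
        by (simp add: mult_ac)
    qed
  qed
  moreover have "(\<lambda>n. integral\<^sup>L lborel (f n)) sums (pi * \<rho>\<^sup>2 / 8)"
    unfolding val using sums_single[of 2 "\<lambda>_. pi * \<rho>\<^sup>2 / 8"] by simp
  ultimately have "(\<integral>\<theta>. (\<Sum>n. f n \<theta>) \<partial>lborel) = pi * \<rho>\<^sup>2 / 8"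
    by (rule sums_unique2)
  moreover have "(\<Sum>n. f n \<theta>) = indicator {0..pi} \<theta> *\<^sub>R ((sin \<theta>)\<^sup>2 * (ln (1 + 2 * \<rho> * cos \<theta> + \<rho>\<^sup>2) / 2))" for \<theta>
    unfolding f_def real_scaleR_def using assms
    by (intro sums_unique[symmetric] sums_mult ln_cos_sums) auto
  ultimately have "(LINT \<theta>:{0..pi}|lborel. (sin \<theta>)\<^sup>2 * (ln (1 + 2 * \<rho> * cos \<theta> + \<rho>\<^sup>2) / 2)) = pi * \<rho>\<^sup>2 / 8"
    unfolding set_lebesgue_integral_def by simp
  moreover have "set_integrable lborel {0..pi} (\<lambda>\<theta>. (sin \<theta>)\<^sup>2 * (ln (1 + 2 * \<rho> * cos \<theta> + \<rho>\<^sup>2) / 2))"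
  proof (rule borel_integrable_atLeastAtMost', intro continuous_intros)
    show "\<forall>\<theta>\<in>{0..pi}. 1 + 2 * \<rho> * cos \<theta> + \<rho>\<^sup>2 \<noteq> 0"
    proof
      fix \<theta> :: real
      have "\<rho> * cos \<theta> \<ge> \<rho> * (-1)" using assms by (intro mult_left_mono) auto
      moreover have "0 < (1 - \<rho>)\<^sup>2" using assms by simp
      ultimately show "1 + 2 * \<rho> * cos \<theta> + \<rho>\<^sup>2 \<noteq> 0" by (simp add: power2_eq_square algebra_simps)
    qed
  qed auto
  ultimately show ?thesis
    by (simp add: set_borel_integral_eq_integral(2))
qed

text \<open>Substitute \<open>a = - s * cos \<theta>\<close>, which increases from
  \<open>- s\<close> to \<open>s\<close>. The square root and the differential each contribute a
  factor \<open>s * sin \<theta>\<close>.\<close>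

lemma integral_semicircle:
  fixes g :: "real \<Rightarrow> real"
  assumes "0 < s" and g: "continuous_on {-s..s} g"
  shows "(LINT a:{-s..s}|lborel. sqrt (s\<^sup>2 - a\<^sup>2) * g a) = s\<^sup>2 * integral {0..pi} (\<lambda>\<theta>. (sin \<theta>)\<^sup>2 * g (- s * cos \<theta>))"
proof -
  define f where "f a = sqrt (s\<^sup>2 - a\<^sup>2) * g a" for a
  have cont: "continuous_on {-s..s} f"
    unfolding f_def by (intro continuous_intros g)
  have "((\<lambda>\<theta>. (s * sin \<theta>) *\<^sub>R f (- s * cos \<theta>)) has_integral integral {- s * cos 0..- s * cos pi} f) {0..pi}"
  proof (rule has_integral_substitution[OF _ _ _ cont])
    show "(\<lambda>\<theta>. - s * cos \<theta>) ` {0..pi} \<subseteq> {- s..s}"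
    proof safe
      fix \<theta> :: real
      show "- s * cos \<theta> \<in> {-s..s}"
        using assms mult_left_mono[of "cos \<theta>" 1 s] mult_left_mono[of "-1" "cos \<theta>" s] by simp
    qed
  qed (use assms in \<open>auto intro!: derivative_eq_intros\<close>)
  then have "integral {-s..s} f = integral {0..pi} (\<lambda>\<theta>. (s * sin \<theta>) * f (- s * cos \<theta>))"
    by (simp add: integral_unique)
  also have "\<dots> = integral {0..pi} (\<lambda>\<theta>. s\<^sup>2 * ((sin \<theta>)\<^sup>2 * g (- s * cos \<theta>)))"
  proof (rule integral_cong)
    fix \<theta> :: real assume \<theta>: "\<theta> \<in> {0..pi}"
    have "s\<^sup>2 - (- s * cos \<theta>)\<^sup>2 = (s * sin \<theta>)\<^sup>2"
      by (simp add: sin_squared_eq power_mult_distrib algebra_simps)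
    then have "sqrt (s\<^sup>2 - (- s * cos \<theta>)\<^sup>2) = s * sin \<theta>"
      using \<theta> assms sin_ge_zero by simp
    then show "(s * sin \<theta>) * f (- s * cos \<theta>) = s\<^sup>2 * ((sin \<theta>)\<^sup>2 * g (- s * cos \<theta>))"
      unfolding f_def by (simp add: power2_eq_square)
  qed
  finally show ?thesis
    using set_borel_integral_eq_integral(2)[OF borel_integrable_atLeastAtMost'[OF cont]] unfolding f_def by simp
qed

lemma integral_sqrt_semicircle:
  assumes "0 < s"
  shows "(LINT a:{-s..s}|lborel. sqrt (s\<^sup>2 - a\<^sup>2)) = pi * s\<^sup>2 / 2"
  using integral_semicircle[OF assms continuous_on_const[of _ 1]]
    integral_unique[OF integral_sin_squared_cos[of 0]] by simp

text \<open>The factor \<open>pi * s\<^sup>2 / 2\<close> is the integral of the weight alone, so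
  \<open>radial_kernel r s\<close> is indeed the mean. For \<open>r = s\<close> the sphere passes
  through the singularity; that single radius is a null set.\<close>

lemma angular_integral:
  fixes r s :: real
  assumes "0 < r" "0 < s" "r \<noteq> s"
  shows "(LINT a:{-s..s}|lborel. sqrt (s\<^sup>2 - a\<^sup>2) * (ln s - ln (r\<^sup>2 + s\<^sup>2 - 2 * r * a) / 2)) = pi * s\<^sup>2 / 2 * radial_kernel r s"
proof -
  define f where "f a = ln s - ln (r\<^sup>2 + s\<^sup>2 - 2 * r * a) / 2" for a
  have pos: "0 < r\<^sup>2 + s\<^sup>2 - 2 * r * a" if "a \<in> {-s..s}" for a
  proof -
    have "r * a \<le> r * s" using that assms by (intro mult_left_mono) auto
    moreover have "0 < (r - s)\<^sup>2" using assms by simp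
    ultimately show ?thesis by (simp add: power2_eq_square algebra_simps)
  qed
  have cont: "continuous_on {-s..s} f"
    unfolding f_def using pos by (intro continuous_intros) (auto simp: less_imp_neq[symmetric])
  \<comment> \<open>With the larger radius factored out, both orders of \<open>r\<close> and
    \<open>s\<close> lead to the same series with ratio \<open>\<rho> < 1\<close>. The order
    survives only in \<open>ln s - ln m\<close>, which is 0 for \<open>r < s\<close>.\<close>
  define m where "m = max r s"
  define \<rho> where "\<rho> = min r s / m"
  have \<rho>: "0 \<le> \<rho>" "\<rho> < 1" and m: "0 < m" and rs: "r\<^sup>2 + s\<^sup>2 = m\<^sup>2 * (1 + \<rho>\<^sup>2)" "r * s = m\<^sup>2 * \<rho>"
    using assms by (auto simp: \<rho>_def m_def min_def max_def field_simps power2_eq_square)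
  have "integral {0..pi} (\<lambda>\<theta>. (sin \<theta>)\<^sup>2 * f (- s * cos \<theta>)) =
    integral {0..pi} (\<lambda>\<theta>. (ln s - ln m) * ((sin \<theta>)\<^sup>2 * cos (real 0 * \<theta>)) - (sin \<theta>)\<^sup>2 * (ln (1 + 2 * \<rho> * cos \<theta> + \<rho>\<^sup>2) / 2))"
  proof (rule integral_cong)
    fix \<theta> :: real
    have "\<rho> * cos \<theta> \<ge> \<rho> * (-1)" using \<rho> by (intro mult_left_mono) auto
    moreover have "0 < (1 - \<rho>)\<^sup>2" using \<rho> by simp
    ultimately have p: "0 < 1 + 2 * \<rho> * cos \<theta> + \<rho>\<^sup>2" by (simp add: power2_eq_square algebra_simps)
    have "r\<^sup>2 + s\<^sup>2 - 2 * r * (- s * cos \<theta>) = m\<^sup>2 * (1 + \<rho>\<^sup>2) + 2 * (r * s) * cos \<theta>"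
      by (simp add: rs(1))
    also have "\<dots> = m\<^sup>2 * (1 + 2 * \<rho> * cos \<theta> + \<rho>\<^sup>2)"
      unfolding rs(2) by (simp add: algebra_simps)
    also have "ln \<dots> = 2 * ln m + ln (1 + 2 * \<rho> * cos \<theta> + \<rho>\<^sup>2)"
      using m p by (simp add: ln_mult ln_realpow)
    finally have 2: "ln (r\<^sup>2 + s\<^sup>2 - 2 * r * (- s * cos \<theta>)) = 2 * ln m + ln (1 + 2 * \<rho> * cos \<theta> + \<rho>\<^sup>2)" .
    show "(sin \<theta>)\<^sup>2 * f (- s * cos \<theta>) = (ln s - ln m) * ((sin \<theta>)\<^sup>2 * cos (real 0 * \<theta>)) - (sin \<theta>)\<^sup>2 * (ln (1 + 2 * \<rho> * cos \<theta> + \<rho>\<^sup>2) / 2)"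
      unfolding f_def 2 by (simp add: power2_eq_square algebra_simps)
  qed
  also have "\<dots> = (ln s - ln m) * (pi / 2) - pi * \<rho>\<^sup>2 / 8"
  proof (intro integral_unique has_integral_mult_right has_integral_diff)
    show "((\<lambda>\<theta>. (sin \<theta>)\<^sup>2 * cos (real 0 * \<theta>)) has_integral (pi / 2)) {0..pi}"
      using integral_sin_squared_cos[of 0] by simp
    have "(\<lambda>\<theta>. (sin \<theta>)\<^sup>2 * (ln (1 + 2 * \<rho> * cos \<theta> + \<rho>\<^sup>2) / 2)) integrable_on {0..pi}"
    proof (intro integrable_continuous_real continuous_intros)
      show "\<forall>\<theta>\<in>{0..pi}. 1 + 2 * \<rho> * cos \<theta> + \<rho>\<^sup>2 \<noteq> 0"
      proof
        fix \<theta> :: real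
        have "\<rho> * cos \<theta> \<ge> \<rho> * (-1)" using \<rho> by (intro mult_left_mono) auto
        moreover have "0 < (1 - \<rho>)\<^sup>2" using \<rho> by simp
        ultimately show "1 + 2 * \<rho> * cos \<theta> + \<rho>\<^sup>2 \<noteq> 0" by (simp add: power2_eq_square algebra_simps)
      qed
    qed auto
    then show "((\<lambda>\<theta>. (sin \<theta>)\<^sup>2 * (ln (1 + 2 * \<rho> * cos \<theta> + \<rho>\<^sup>2) / 2)) has_integral (pi * \<rho>\<^sup>2 / 8)) {0..pi}"
      using integral_sin_squared_ln[OF \<rho>] by (simp add: has_integral_iff)
  qed
  finally have "s\<^sup>2 * integral {0..pi} (\<lambda>\<theta>. (sin \<theta>)\<^sup>2 * f (- s * cos \<theta>)) = pi * s\<^sup>2 / 2 * radial_kernel r s"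
    using assms by (auto simp: radial_kernel_def m_def \<rho>_def min_def max_def field_simps power2_eq_square ln_div)
  then show ?thesis
    using integral_semicircle[OF \<open>0 < s\<close> cont] unfolding f_def by simp
qed

section \<open>The radial integral equation\<close>

text \<open>Polar measure without the area \<open>2 * pi\<^sup>2\<close> of the unit three-sphere;
  \<open>Lambda_sph\<close> corresponds to radial mass 8.\<close>

definition radial_measure :: "real measure" where
  "radial_measure = density lborel (\<lambda>s. ennreal (indicator {0<..} s * s ^ 3))"

lemma space_radial_measure [simp]: "space radial_measure = UNIV"
  and sets_radial_measure [simp, measurable_cong]: "sets radial_measure = sets borel"
  by (simp_all add: radial_measure_def)

lemma borel_measurable_radial_kernel [measurable]: "(\<lambda>x. radial_kernel (f x) (g x)) \<in> borel_measurable M"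
  if [measurable]: "f \<in> borel_measurable M" "g \<in> borel_measurable M"
  unfolding radial_kernel_def by measurable

lemma integrable_radial_measure_iff:
  fixes g :: "real \<Rightarrow> real"
  assumes [measurable]: "g \<in> borel_measurable borel"
  shows "integrable radial_measure g \<longleftrightarrow> integrable lborel (\<lambda>s. indicator {0<..} s * s ^ 3 * g s)"
  unfolding radial_measure_def
  by (subst integrable_real_density) (auto split: split_indicator)

lemma integral_radial_measure:
  fixes g :: "real \<Rightarrow> real"
  assumes [measurable]: "g \<in> borel_measurable borel"
  shows "integral\<^sup>L radial_measure g = (\<integral>s. indicator {0<..} s * s ^ 3 * g s \<partial>lborel)"
  unfolding radial_measure_def
  by (subst integral_real_density) (auto split: split_indicator)

lemma AE_radial_measure:
  assumes "AE s in lborel. 0 < s \<longrightarrow> P s"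
  shows "AE s in radial_measure. P s"
  using assms unfolding radial_measure_def
  by (subst AE_density) (auto elim!: eventually_mono split: split_indicator)

lemma slice_density_eq:
  assumes "0 < s"
  shows "slice_density s a = 4 * pi * s * (indicator {-s..s} a * sqrt (s\<^sup>2 - a\<^sup>2))"
proof (cases "\<bar>a\<bar> = s")
  case True
  then have "a\<^sup>2 = s\<^sup>2" by auto
  then show ?thesis by (simp add: slice_density_def)
next
  case False
  then show ?thesis using assms by (auto simp: slice_density_def split: split_indicator)
qed

lemma integral_slice_density:
  fixes f :: "real \<Rightarrow> real"
  assumes "0 < s"
  shows "(\<integral>a. slice_density s a * f a \<partial>lborel) =
    4 * pi * s * (LINT a:{-s..s}|lborel. sqrt (s\<^sup>2 - a\<^sup>2) * f a)"
  by (simp add: slice_density_eq[OF assms] set_lebesgue_integral_def mult.assoc)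

text \<open>Integrating the joint density over the first coordinate gives \<open>4 * pi * s\<close>
  times the half-disc area \<open>pi * s\<^sup>2 / 2\<close>.\<close>

lemma distr_norm:
  "distr (lborel :: (real^4) measure) borel norm = scale_measure (ennreal (2 * pi\<^sup>2)) radial_measure"
proof (rule measure_eqI)
  fix A assume "A \<in> sets (distr (lborel :: (real^4) measure) borel norm)"
  then have A [measurable]: "A \<in> sets borel" by simp
  have [measurable]: "(\<lambda>y :: real^4. (norm y, y $ 1)) \<in> lborel \<rightarrow>\<^sub>M lborel \<Otimes>\<^sub>M lborel"
    by (intro measurable_Pair) (auto intro!: borel_measurable_continuous_onI continuous_intros)
  have "emeasure (distr (lborel :: (real^4) measure) borel norm) A = (\<integral>\<^sup>+y. indicator A (norm y) \<partial>(lborel :: (real^4) measure))"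
  proof -
    have "emeasure (distr (lborel :: (real^4) measure) borel norm) A = (\<integral>\<^sup>+x. indicator A x \<partial>distr (lborel :: (real^4) measure) borel norm)"
      by (rule nn_integral_indicator[symmetric]) simp
    then show ?thesis by (simp only:) (rule nn_integral_distr, auto)
  qed
  also have "\<dots> = (\<integral>\<^sup>+x. indicator A (fst x) \<partial>distr (lborel :: (real^4) measure) (lborel \<Otimes>\<^sub>M lborel) (\<lambda>y. (norm y, y $ 1)))"
    by (subst nn_integral_distr) auto
  also have "\<dots> = (\<integral>\<^sup>+x. ennreal (slice_density (fst x) (snd x)) * indicator A (fst x) \<partial>(lborel \<Otimes>\<^sub>M lborel))"
    unfolding distr_norm_fst by (subst nn_integral_density) auto
  also have "\<dots> = (\<integral>\<^sup>+s. \<integral>\<^sup>+a. ennreal (slice_density s a) * indicator A s \<partial>lborel \<partial>lborel)"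
    by (subst lborel.nn_integral_fst[symmetric]) auto
  also have "\<dots> = (\<integral>\<^sup>+s. ennreal (2 * pi\<^sup>2) * (ennreal (indicator {0<..} s * s ^ 3) * indicator A s) \<partial>lborel)"
  proof (rule nn_integral_cong)
    fix s :: real
    have "(\<integral>\<^sup>+a. ennreal (slice_density s a) * indicator A s \<partial>lborel) = (\<integral>\<^sup>+a. ennreal (slice_density s a) \<partial>lborel) * indicator A s"
      by (rule nn_integral_multc) measurable
    also have "(\<integral>\<^sup>+a. ennreal (slice_density s a) \<partial>lborel) = ennreal (2 * pi\<^sup>2 * (indicator {0<..} s * s ^ 3))"
    proof (cases "0 < s")
      case True
      have "set_integrable lborel {-s..s} (\<lambda>a. sqrt (s\<^sup>2 - a\<^sup>2))"
        by (intro borel_integrable_atLeastAtMost' continuous_intros)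
      then have "integrable lborel (slice_density s)"
        unfolding set_integrable_def slice_density_eq[OF True, abs_def] by simp
      then have "(\<integral>\<^sup>+a. ennreal (slice_density s a) \<partial>lborel) = ennreal (\<integral>a. slice_density s a \<partial>lborel)"
        by (intro nn_integral_eq_integral) (auto simp: slice_density_nonneg)
      also have "(\<integral>a. slice_density s a \<partial>lborel) = 2 * pi\<^sup>2 * s ^ 3"
        using integral_slice_density[OF True, of "\<lambda>_. 1"] integral_sqrt_semicircle[OF True]
        by (simp add: power2_eq_square power3_eq_cube)
      finally show ?thesis using True by simp
    qed (auto simp: slice_density_eq_0)
    finally show "(\<integral>\<^sup>+a. ennreal (slice_density s a) * indicator A s \<partial>lborel) =
        ennreal (2 * pi\<^sup>2) * (ennreal (indicator {0<..} s * s ^ 3) * indicator A s)"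
      by (auto simp: ennreal_mult' split: split_indicator)
  qed
  also have "\<dots> = emeasure (scale_measure (ennreal (2 * pi\<^sup>2)) radial_measure) A"
    unfolding radial_measure_def by (simp add: emeasure_density nn_integral_cmult)
  finally show "emeasure (distr (lborel :: (real^4) measure) borel norm) A = \<dots>" .
qed simp

lemma
  fixes g :: "real \<Rightarrow> real"
  assumes [measurable]: "g \<in> borel_measurable borel"
  shows integrable_norm_iff: "integrable (lborel :: (real^4) measure) (\<lambda>y. g (norm y)) \<longleftrightarrow> integrable radial_measure g"
    and integral_norm: "(\<integral>y. g (norm y) \<partial>(lborel :: (real^4) measure)) = 2 * pi\<^sup>2 * (\<integral>s. g s \<partial>radial_measure)"
proof -
  have eq: "scale_measure (ennreal (2 * pi\<^sup>2)) radial_measure = density radial_measure (\<lambda>_. ennreal (2 * pi\<^sup>2))"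
    by (intro measure_eqI) (auto simp: emeasure_density nn_integral_cmult)
  have "integrable (lborel :: (real^4) measure) (\<lambda>y. g (norm y)) \<longleftrightarrow> integrable (distr (lborel :: (real^4) measure) borel norm) g"
    by (subst integrable_distr_eq) auto
  also have "\<dots> \<longleftrightarrow> integrable radial_measure g"
    unfolding distr_norm eq by (subst integrable_real_density) auto
  finally show "integrable (lborel :: (real^4) measure) (\<lambda>y. g (norm y)) \<longleftrightarrow> integrable radial_measure g" .
  have "(\<integral>y. g (norm y) \<partial>(lborel :: (real^4) measure)) = integral\<^sup>L (distr (lborel :: (real^4) measure) borel norm) g"
    by (subst integral_distr) auto
  also have "\<dots> = 2 * pi\<^sup>2 * (\<integral>s. g s \<partial>radial_measure)"
    unfolding distr_norm eq by (subst integral_real_density) auto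
  finally show "(\<integral>y. g (norm y) \<partial>(lborel :: (real^4) measure)) = 2 * pi\<^sup>2 * (\<integral>s. g s \<partial>radial_measure)" .
qed

text \<open>Push the integrand forward to the pair of norm and first coordinate and apply Fubini;
  the inner integral is \<open>angular_integral\<close>. Integrability on the half-line is inherited
  from four-space by the same route.\<close>

lemma log_potential_radial:
  fixes F :: "real \<Rightarrow> real"
  assumes [measurable]: "F \<in> borel_measurable borel" and "0 < r"
    and int: "integrable lborel (\<lambda>y :: real^4. ln (norm y / norm (r *\<^sub>R axis 1 1 - y)) * F (norm y))"
  shows "integrable radial_measure (\<lambda>s. radial_kernel r s * F s)"
    and "(\<integral>y. ln (norm y / norm (r *\<^sub>R axis 1 1 - y)) * F (norm y) \<partial>(lborel :: (real^4) measure)) =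
      2 * pi\<^sup>2 * (\<integral>s. radial_kernel r s * F s \<partial>radial_measure)"
proof -
  let ?P = "lborel \<Otimes>\<^sub>M lborel :: (real \<times> real) measure"
  \<comment> \<open>Squaring the distance makes the integrand explicit in \<open>s\<close> and
    \<open>a\<close>. \<open>\<Psi>\<close> differs from it only at \<open>0\<close> and at
    \<open>x\<close>, where the logarithm of the quotient does not split.\<close>
  define \<Psi> where "\<Psi> s a = (ln s - ln (r\<^sup>2 + s\<^sup>2 - 2 * r * a) / 2) * F s" for s a
  have [measurable]: "(\<lambda>y :: real^4. (norm y, y $ 1)) \<in> lborel \<rightarrow>\<^sub>M ?P"
    by (intro measurable_Pair) (auto intro!: borel_measurable_continuous_onI continuous_intros)
  have [measurable]: "(\<lambda>x. \<Psi> (fst x) (snd x)) \<in> borel_measurable ?P"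
    unfolding \<Psi>_def by measurable
  have [measurable]: "(\<lambda>y :: real^4. \<Psi> (norm y) (y $ 1)) \<in> borel_measurable lborel"
    using measurable_compose[OF \<open>(\<lambda>y :: real^4. (norm y, y $ 1)) \<in> lborel \<rightarrow>\<^sub>M ?P\<close> \<open>(\<lambda>x. \<Psi> (fst x) (snd x)) \<in> borel_measurable ?P\<close>] by simp
  let ?e = "r *\<^sub>R axis 1 1 :: real^4"
  have ae: "AE y in lborel. ln (norm y / norm (?e - y)) * F (norm y) = \<Psi> (norm y) (y $ 1)"
    using AE_lborel_singleton[of "0 :: real^4"] AE_lborel_singleton[of ?e]
  proof eventually_elim
    case (elim y)
    have "(norm (?e - y))\<^sup>2 = r\<^sup>2 + (norm y)\<^sup>2 - 2 * r * y $ 1"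
    proof -
      have "(axis 1 1 :: real^4) $ 1 = 1" by (simp add: axis_def)
      then show ?thesis
        unfolding power2_norm_eq_inner
        by (simp add: inner_diff_left inner_diff_right inner_axis inner_axis' power2_eq_square algebra_simps)
    qed
    moreover have "ln ((norm (?e - y))\<^sup>2) = 2 * ln (norm (?e - y))"
      using elim by (subst ln_realpow) auto
    ultimately show ?case
      using elim by (simp add: \<Psi>_def ln_div)
  qed
  have "integrable lborel (\<lambda>y :: real^4. \<Psi> (norm y) (y $ 1))"
    using int ae by (subst (asm) integrable_cong_AE) auto
  then have "integrable (distr (lborel :: (real^4) measure) ?P (\<lambda>y. (norm y, y $ 1))) (\<lambda>x. \<Psi> (fst x) (snd x))"
    by (subst integrable_distr_eq) auto
  then have int2: "integrable ?P (\<lambda>x. slice_density (fst x) (snd x) * \<Psi> (fst x) (snd x))"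
    unfolding distr_norm_fst by (subst (asm) integrable_real_density) (auto simp: slice_density_nonneg)
  have inner: "AE s in lborel. (\<integral>a. slice_density s a * \<Psi> s a \<partial>lborel) = 2 * pi\<^sup>2 * (indicator {0<..} s * s ^ 3 * (radial_kernel r s * F s))"
    using AE_lborel_singleton[of r]
  proof eventually_elim
    case (elim s)
    show ?case
    proof (cases "0 < s")
      case True
      have "(\<integral>a. slice_density s a * \<Psi> s a \<partial>lborel) = (\<integral>a. slice_density s a * (ln s - ln (r\<^sup>2 + s\<^sup>2 - 2 * r * a) / 2) * F s \<partial>lborel)"
        unfolding \<Psi>_def by (simp add: mult_ac)
      also have "\<dots> = 4 * pi * s * (pi * s\<^sup>2 / 2 * radial_kernel r s) * F s"
        using elim True \<open>0 < r\<close> integral_slice_density[OF True, of "\<lambda>a. ln s - ln (r\<^sup>2 + s\<^sup>2 - 2 * r * a) / 2"]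
        by (simp add: angular_integral)
      also have "\<dots> = 2 * pi\<^sup>2 * (indicator {0<..} s * s ^ 3 * (radial_kernel r s * F s))"
        using True by (simp add: power2_eq_square power3_eq_cube)
      finally show ?thesis .
    qed (auto simp: slice_density_eq_0)
  qed
  have i1: "integrable lborel (\<lambda>s. \<integral>a. slice_density s a * \<Psi> s a \<partial>lborel)"
    using lborel_pair.integrable_fst'[OF int2] by simp
  then have "integrable lborel (\<lambda>s. 2 * pi\<^sup>2 * (indicator {0<..} s * s ^ 3 * (radial_kernel r s * F s)))"
    by (rule integrable_cong_AE_imp[OF _ _ inner]) measurable
  then show "integrable radial_measure (\<lambda>s. radial_kernel r s * F s)"
    by (subst integrable_radial_measure_iff) auto
  have "(\<integral>y. ln (norm y / norm (?e - y)) * F (norm y) \<partial>lborel) = (\<integral>y. \<Psi> (norm y) (y $ 1) \<partial>(lborel :: (real^4) measure))"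
    using ae by (intro Bochner_Integration.integral_cong_AE) auto
  also have "\<dots> = integral\<^sup>L (distr (lborel :: (real^4) measure) ?P (\<lambda>y. (norm y, y $ 1))) (\<lambda>x. \<Psi> (fst x) (snd x))"
    by (subst integral_distr) auto
  also have "\<dots> = integral\<^sup>L ?P (\<lambda>x. slice_density (fst x) (snd x) * \<Psi> (fst x) (snd x))"
    unfolding distr_norm_fst by (subst integral_real_density) (auto simp: slice_density_nonneg)
  also have "\<dots> = (\<integral>s. \<integral>a. slice_density s a * \<Psi> s a \<partial>lborel \<partial>lborel)"
    using lborel_pair.integral_fst'[OF int2] by simp
  also have "\<dots> = (\<integral>s. 2 * pi\<^sup>2 * (indicator {0<..} s * s ^ 3 * (radial_kernel r s * F s)) \<partial>lborel)"
    using inner borel_measurable_integrable[OF i1] by (intro Bochner_Integration.integral_cong_AE) auto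
  also have "\<dots> = 2 * pi\<^sup>2 * (\<integral>s. radial_kernel r s * F s \<partial>radial_measure)"
    by (subst integral_radial_measure) auto
  finally show "(\<integral>y. ln (norm y / norm (?e - y)) * F (norm y) \<partial>lborel) = 2 * pi\<^sup>2 * (\<integral>s. radial_kernel r s * F s \<partial>radial_measure)" .
qed

section \<open>From normal solutions to radial profiles\<close>

text \<open>Replacing \<open>f\<close> by a Borel function equal to it almost everywhere leaves the
  potential unchanged at every \<open>x\<close>. A normal solution is not assumed measurable; it
  becomes Borel by its own integral equation.\<close>

lemma borel_measurable_log_potential:
  fixes f :: "real^4 \<Rightarrow> real"
  assumes f: "f \<in> borel_measurable lebesgue"
    and int: "\<And>x. integrable lebesgue (\<lambda>y. ln (norm y / norm (x - y)) * f y)"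
  shows "(\<lambda>x. LINT y|lebesgue. ln (norm y / norm (x - y)) * f y) \<in> borel_measurable borel"
proof -
  obtain g where g [measurable]: "g \<in> borel_measurable lborel" and ae: "AE y in lborel. f y = g y"
    using completion_ex_borel_measurable_real[OF f] by auto
  have "(LINT y|lebesgue. ln (norm y / norm (x - y)) * f y) = (LINT y|lborel. ln (norm y / norm (x - y)) * g y)" for x
  proof -
    have [measurable]: "(\<lambda>y. ln (norm y / norm (x - y)) * g y) \<in> borel_measurable lborel"
      by measurable
    have "(LINT y|lebesgue. ln (norm y / norm (x - y)) * f y) = (LINT y|lebesgue. ln (norm y / norm (x - y)) * g y)"
    proof (rule Bochner_Integration.integral_cong_AE)
      show "(\<lambda>y. ln (norm y / norm (x - y)) * f y) \<in> borel_measurable lebesgue"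
        using int[of x] by (rule borel_measurable_integrable)
      show "(\<lambda>y. ln (norm y / norm (x - y)) * g y) \<in> borel_measurable lebesgue"
        by (rule measurable_completion) measurable
      have "AE y in lebesgue. f y = g y"
        using ae by (rule AE_completion)
      then show "AE y in lebesgue. ln (norm y / norm (x - y)) * f y = ln (norm y / norm (x - y)) * g y"
        by eventually_elim simp
    qed
    also have "\<dots> = (LINT y|lborel. ln (norm y / norm (x - y)) * g y)"
      by (rule integral_completion) measurable
    finally show ?thesis .
  qed
  moreover have "(\<lambda>x. LINT y|lborel. ln (norm y / norm (x - y)) * g y) \<in> borel_measurable borel"
    by (rule lborel.borel_measurable_lebesgue_integral) measurable
  ultimately show ?thesis by simp
qed

lemma normal_solution_profile:
  fixes u :: "real^4 \<Rightarrow> real" and p :: real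
  assumes "normal_solution (\<lambda>x. 1 - norm x powr p) u" and "radial u"
  defines "w \<equiv> \<lambda>s. u (s *\<^sub>R axis 1 1)"
  defines "f \<equiv> \<lambda>s. (1 - s powr p) * exp (4 * w s)"
  shows "w \<in> borel_measurable borel" "\<And>x. u x = w (norm x)"
    and "integrable radial_measure f"
    and "\<And>r. 0 < r \<Longrightarrow> integrable radial_measure (\<lambda>s. radial_kernel r s * f s)"
    and "\<And>r. 0 < r \<Longrightarrow> w r = w 0 + 1 / 4 * (\<integral>s. radial_kernel r s * f s \<partial>radial_measure)"
proof -
  let ?f = "\<lambda>y. (1 - norm y powr p) * exp (4 * u y)"
  have f_int: "integrable lebesgue ?f"
    using assms(1) by (simp add: normal_solution_def)
  obtain c where *: "\<And>x. integrable lebesgue (\<lambda>y. ln (norm y / norm (x - y)) * (1 - norm y powr p) * exp (4 * u y)) \<and>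
      u x = 1 / (8 * pi\<^sup>2) * (LINT y|lebesgue. ln (norm y / norm (x - y)) * (1 - norm y powr p) * exp (4 * u y)) + c"
    using assms(1) unfolding normal_solution_def by blast
  have int: "integrable lebesgue (\<lambda>y. ln (norm y / norm (x - y)) * ?f y)"
    and u: "u x = 1 / (8 * pi\<^sup>2) * (LINT y|lebesgue. ln (norm y / norm (x - y)) * ?f y) + c" for x
    using *[of x] by (simp_all only: mult.assoc)
  show uw: "u x = w (norm x)" for x
    unfolding w_def by (rule \<open>radial u\<close>[unfolded radial_def, rule_format]) (simp add: norm_axis_1)
  have u_eq: "u = (\<lambda>x. 1 / (8 * pi\<^sup>2) * (LINT y|lebesgue. ln (norm y / norm (x - y)) * ?f y) + c)"
    by (rule ext, rule u)
  have u_borel [measurable]: "u \<in> borel_measurable borel"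
    by (rule ssubst[OF u_eq, of "\<lambda>v. v \<in> borel_measurable borel"]) (intro borel_measurable_add borel_measurable_times borel_measurable_const
      borel_measurable_log_potential borel_measurable_integrable[OF f_int] int)
  show w_borel [measurable]: "w \<in> borel_measurable borel"
    unfolding w_def by measurable
  have [measurable]: "f \<in> borel_measurable borel"
    unfolding f_def by measurable
  have ff: "?f = (\<lambda>y. f (norm y))"
    by (simp add: f_def uw)
  have "integrable lborel (\<lambda>y :: real^4. f (norm y))"
    using f_int unfolding ff by (subst (asm) integrable_completion) auto
  then show "integrable radial_measure f"
    by (simp add: integrable_norm_iff)
  \<comment> \<open>At \<open>x = 0\<close> the kernel is \<open>ln 1 = 0\<close>; at
    \<open>y = 0\<close> the quotient \<open>0 / 0\<close> and the logarithm of 0 are both 0. This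
    identifies \<open>c\<close> with \<open>u 0\<close>.\<close>
  have "u 0 = 1 / (8 * pi\<^sup>2) * (LINT y|lebesgue. 0 * ?f y) + c"
    unfolding u[of 0]
    by (intro arg_cong2[where f="(+)"] arg_cong2[where f="(*)"] refl Bochner_Integration.integral_cong) (auto simp: ln_div)
  then have c: "c = w 0" by (simp add: w_def)
  fix r :: real assume "0 < r"
  have int': "integrable lborel (\<lambda>y :: real^4. ln (norm y / norm (r *\<^sub>R axis 1 1 - y)) * f (norm y))"
    using int[of "r *\<^sub>R axis 1 1"] unfolding ff[THEN fun_cong] by (subst (asm) integrable_completion) auto
  show "integrable radial_measure (\<lambda>s. radial_kernel r s * f s)"
    by (rule log_potential_radial(1)[OF _ \<open>0 < r\<close> int']) measurable
  have "w r = 1 / (8 * pi\<^sup>2) * (LINT y|lebesgue. ln (norm y / norm (r *\<^sub>R axis 1 1 - (y :: real^4))) * f (norm y)) + c"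
    unfolding w_def by (subst u) (simp add: f_def uw)
  also have "(LINT y|lebesgue. ln (norm y / norm (r *\<^sub>R axis 1 1 - (y :: real^4))) * f (norm y)) =
      (LINT y|lborel. ln (norm y / norm (r *\<^sub>R axis 1 1 - (y :: real^4))) * f (norm y))"
    by (rule integral_completion) measurable
  also have "\<dots> = 2 * pi\<^sup>2 * (\<integral>s. radial_kernel r s * f s \<partial>radial_measure)"
    by (rule log_potential_radial(2)[OF _ \<open>0 < r\<close> int']) measurable
  finally show "w r = w 0 + 1 / 4 * (\<integral>s. radial_kernel r s * f s \<partial>radial_measure)"
    by (simp add: c)
qed

section \<open>Pohozaev's identity\<close>

definition kernel_shape :: "real \<Rightarrow> real" where
  "kernel_shape t = (if t < 1 then ln t - t\<^sup>2 / 4 else - 1 / (4 * t\<^sup>2))"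

text \<open>\<open>kernel_weight (s / r)\<close> is \<open>- r\<close> times the derivative of \<open>radial_kernel r s\<close> in \<open>r\<close>. The form
  with \<open>min\<close> and \<open>max\<close> makes its continuity across \<open>s = r\<close> evident.\<close>

definition kernel_weight :: "real \<Rightarrow> real" where
  "kernel_weight t = 1 / 2 + 1 / (2 * (max t 1)\<^sup>2) - (max 0 (min t 1))\<^sup>2 / 2"

lemma radial_kernel_eq_kernel_shape: "0 < r \<Longrightarrow> radial_kernel r s = kernel_shape (s / r)"
  by (auto simp: radial_kernel_def kernel_shape_def field_simps power2_eq_square)

lemma kernel_weight_bounds: "0 \<le> kernel_weight t" "kernel_weight t \<le> 1"
proof -
  have "0 \<le> 1 / (2 * (max t 1)\<^sup>2)" by simp
  moreover have "(max 0 (min t 1))\<^sup>2 \<le> 1" by (intro power_le_one) auto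
  moreover have "1 / (2 * (max t 1)\<^sup>2) \<le> 1 / 2"
    by (simp add: field_simps one_le_power)
  moreover have "0 \<le> (max 0 (min t 1))\<^sup>2" by simp
  ultimately show "0 \<le> kernel_weight t" "kernel_weight t \<le> 1" unfolding kernel_weight_def by linarith+
qed

text \<open>The symmetrisation behind Pohozaev's identity.\<close>

lemma kernel_weight_inverse:
  assumes "0 < t"
  shows "kernel_weight t + kernel_weight (1 / t) = 1"
  using assms by (cases "t \<le> 1") (auto simp: kernel_weight_def max_def min_def field_simps power2_eq_square)

text \<open>The two branches meet at \<open>t = 1\<close> with common value \<open>- 1 / 4\<close>
  and common slope \<open>1 / 2\<close>, so the glued function is differentiable there as
  well.\<close>

lemma DERIV_kernel_shape:
  assumes "0 < t"
  shows "(kernel_shape has_real_derivative kernel_weight t / t) (at t)"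
proof -
  have "((\<lambda>t. if t \<in> {..<1} then ln t - t\<^sup>2 / 4 else - 1 / (4 * t\<^sup>2)) has_vector_derivative
      (if t \<in> {..<1} then 1 / t - t / 2 else 1 / (2 * t ^ 3))) (at t within {..<1} \<union> {1..})"
    using assms
    by (intro has_vector_derivative_If_within_closures)
      (auto intro!: derivative_eq_intros simp: field_simps power2_eq_square power3_eq_cube
        simp flip: has_real_derivative_iff_has_vector_derivative)
  moreover have "{..<1} \<union> {1..} = (UNIV :: real set)" by auto
  moreover have "(\<lambda>t. if t \<in> {..<1} then ln t - t\<^sup>2 / 4 else - 1 / (4 * t\<^sup>2)) = kernel_shape"
    by (auto simp: kernel_shape_def fun_eq_iff)
  moreover have "(if t \<in> {..<1} then 1 / t - t / 2 else 1 / (2 * t ^ 3)) = kernel_weight t / t"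
    using assms by (auto simp: kernel_weight_def field_simps power2_eq_square power3_eq_cube)
  ultimately show ?thesis
    by (simp only: has_real_derivative_iff_has_vector_derivative)
qed

lemma kernel_shape_mono:
  assumes "0 < s" "s \<le> t"
  shows "kernel_shape s \<le> kernel_shape t"
proof (rule DERIV_nonneg_imp_nondecreasing[OF assms(2)])
  fix x assume "s \<le> x" "x \<le> t"
  then show "\<exists>y. (kernel_shape has_real_derivative y) (at x) \<and> 0 \<le> y"
    using DERIV_kernel_shape[of x] kernel_weight_bounds(1)[of x] assms by (intro exI[of _ "kernel_weight x / x"]) auto
qed

lemma kernel_shape_nonpos: "0 < t \<Longrightarrow> kernel_shape t \<le> 0"
  by (auto simp: kernel_shape_def) (smt (verit) divide_nonneg_nonneg ln_le_zero_iff zero_le_power2)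

lemma DERIV_radial_kernel:
  assumes "0 < r" "0 < s"
  shows "((\<lambda>r. radial_kernel r s) has_real_derivative - kernel_weight (s / r) / r) (at r)"
proof -
  have D: "((\<lambda>r. kernel_shape (s / r)) has_real_derivative (kernel_weight (s / r) / (s / r)) * (- s / r\<^sup>2)) (at r)"
    using assms by (intro DERIV_chain2[OF DERIV_kernel_shape]) (auto intro!: derivative_eq_intros simp: field_simps power2_eq_square)
  have val: "(kernel_weight (s / r) / (s / r)) * (- s / r\<^sup>2) = - kernel_weight (s / r) / r"
    using assms by (simp add: field_simps power2_eq_square)
  have ev: "\<forall>\<^sub>F x in nhds r. kernel_shape (s / x) = radial_kernel x s"
    using eventually_nhds_in_open[of "{0<..}" r] assms(1) by (auto simp: radial_kernel_eq_kernel_shape elim!: eventually_mono)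
  show ?thesis
    using DERIV_cong_ev[OF refl ev val] D by blast
qed

text \<open>A Lipschitz bound with integrable constant dominates the difference quotients, so the
  derivative at the single point \<open>r\<close> may be taken almost everywhere in
  \<open>s\<close>.\<close>

lemma DERIV_integral_dominated:
  fixes F :: "real \<Rightarrow> 'a \<Rightarrow> real"
  assumes int: "\<And>x. x \<in> ball r d \<Longrightarrow> integrable M (F x)" and "0 < d"
    and deriv: "AE s in M. ((\<lambda>x. F x s) has_real_derivative D s) (at r)"
    and D [measurable]: "D \<in> borel_measurable M"
    and lip: "AE s in M. \<forall>x\<in>ball r d. \<bar>F x s - F r s\<bar> \<le> g s * \<bar>x - r\<bar>"
    and g: "integrable M g"
  shows "((\<lambda>x. \<integral>s. F x s \<partial>M) has_real_derivative (\<integral>s. D s \<partial>M)) (at r)"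
  unfolding has_field_derivative_iff tendsto_at_iff_sequentially
proof (intro allI impI)
  fix X :: "nat \<Rightarrow> real" assume X: "\<forall>i. X i \<in> UNIV - {r}" and lim: "X \<longlonglongrightarrow> r"
  then have "\<forall>\<^sub>F i in sequentially. X i \<in> ball r d"
    using \<open>0 < d\<close> by (intro topological_tendstoD) auto
  then obtain N where N: "\<And>i. i \<ge> N \<Longrightarrow> X i \<in> ball r d"
    by (auto simp: eventually_sequentially)
  \<comment> \<open>Dominated convergence asks for every term of the sequence, hence the shift into
    the ball.\<close>
  define Y where "Y i = X (i + N)" for i
  have Y: "Y i \<in> ball r d" "Y i \<noteq> r" for i
    using N X by (auto simp: Y_def)
  have Ylim: "Y \<longlonglongrightarrow> r"
    unfolding Y_def by (rule LIMSEQ_ignore_initial_segment[OF lim])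
  have r: "integrable M (F r)" using int \<open>0 < d\<close> by simp
  have "(\<lambda>i. \<integral>s. (F (Y i) s - F r s) / (Y i - r) \<partial>M) \<longlonglongrightarrow> (\<integral>s. D s \<partial>M)"
  proof (rule integral_dominated_convergence)
    show "AE s in M. (\<lambda>i. (F (Y i) s - F r s) / (Y i - r)) \<longlonglongrightarrow> D s"
      using deriv
    proof eventually_elim
      case (elim s)
      then show ?case
        using Y Ylim unfolding has_field_derivative_iff tendsto_at_iff_sequentially by (auto simp: comp_def)
    qed
    show "AE s in M. norm ((F (Y i) s - F r s) / (Y i - r)) \<le> g s" for i
      using lip
    proof eventually_elim
      case (elim s)
      then show ?case using Y[of i] by (simp add: abs_divide divide_le_eq)
    qed
    show "(\<lambda>s. (F (Y i) s - F r s) / (Y i - r)) \<in> borel_measurable M" for i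
      using borel_measurable_integrable[OF int[OF Y(1)[of i]]] borel_measurable_integrable[OF r] by measurable
  qed (use g D in auto)
  also have "(\<lambda>i. \<integral>s. (F (Y i) s - F r s) / (Y i - r) \<partial>M) =
      (\<lambda>i. ((\<integral>s. F (X (i + N)) s \<partial>M) - (\<integral>s. F r s \<partial>M)) / (X (i + N) - r))"
  proof
    fix i show "(\<integral>s. (F (Y i) s - F r s) / (Y i - r) \<partial>M) = ((\<integral>s. F (X (i + N)) s \<partial>M) - (\<integral>s. F r s \<partial>M)) / (X (i + N) - r)"
      using int[OF Y(1)[of i]] r by (simp add: Y_def)
  qed
  finally show "((\<lambda>y. ((\<integral>s. F y s \<partial>M) - (\<integral>s. F r s \<partial>M)) / (y - r)) \<circ> X) \<longlonglongrightarrow> (\<integral>s. D s \<partial>M)"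
    unfolding comp_def by (rule LIMSEQ_offset)
qed

lemma AE_radial_measure_pos: "AE s in radial_measure. 0 < s"
  by (rule AE_radial_measure) simp

lemma integrable_radial_measure_indicator: "integrable radial_measure (indicator {0..S} :: real \<Rightarrow> real)"
proof (subst integrable_radial_measure_iff)
  have "integrable lborel (\<lambda>s. indicator {0..S} s *\<^sub>R (s ^ 3))"
    using borel_integrable_atLeastAtMost'[of 0 S "\<lambda>s. s ^ 3"] unfolding set_integrable_def
    by (simp add: continuous_intros)
  then show "integrable lborel (\<lambda>s. indicator {0<..} s * s ^ 3 * (indicator {0..S} s :: real))"
    by (rule Bochner_Integration.integrable_bound) (auto split: split_indicator)
qed simp

text \<open>The reduction of one normal solution to the half-line. \<open>mass_nonneg\<close> enters
  through the maximum principle \<open>w_le\<close>, since \<open>f\<close> is negative beyond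
  \<open>s = 1\<close>.\<close>

locale profile =
  fixes p :: real and w f :: "real \<Rightarrow> real"
  assumes p_pos: "0 < p"
    and w_borel [measurable]: "w \<in> borel_measurable borel"
    and f_eq: "\<And>s. f s = (1 - s powr p) * exp (4 * w s)"
    and f_int: "integrable radial_measure f"
    and Gf_int: "\<And>r. 0 < r \<Longrightarrow> integrable radial_measure (\<lambda>s. radial_kernel r s * f s)"
    and w_eq: "\<And>r. 0 < r \<Longrightarrow> w r = w 0 + 1 / 4 * (\<integral>s. radial_kernel r s * f s \<partial>radial_measure)"
    and mass_nonneg: "0 \<le> integral\<^sup>L radial_measure f"
begin

lemma f_borel [measurable]: "f \<in> borel_measurable borel"
  unfolding f_eq[abs_def] by measurable

text \<open>Compare the kernel with its value at \<open>s = 1\<close>, where \<open>f\<close> changes sign.\<close>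

lemma w_le:
  assumes "0 \<le> r"
  shows "w r \<le> w 0"
proof (cases "r = 0")
  case False
  then have r: "0 < r" using assms by simp
  have "(\<integral>s. radial_kernel r s * f s \<partial>radial_measure) \<le> (\<integral>s. radial_kernel r 1 * f s \<partial>radial_measure)"
  proof (rule integral_mono_AE[OF Gf_int[OF r]])
    show "AE s in radial_measure. radial_kernel r s * f s \<le> radial_kernel r 1 * f s"
      using AE_radial_measure_pos
    proof eventually_elim
      case (elim s)
      show ?case
      proof (cases "s \<le> 1")
        case True
        then have "0 \<le> f s" using elim p_pos by (simp add: f_eq powr_le_one_le powr_le1)
        moreover have "radial_kernel r s \<le> radial_kernel r 1"
          using True elim r by (auto simp: radial_kernel_eq_kernel_shape divide_right_mono intro!: kernel_shape_mono)
        ultimately show ?thesis by (intro mult_right_mono)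
      next
        case False
        then have "f s \<le> 0" using p_pos ge_one_powr_ge_zero[of s p] by (simp add: f_eq mult_nonpos_nonneg)
        moreover have "radial_kernel r 1 \<le> radial_kernel r s"
          using False elim r by (auto simp: radial_kernel_eq_kernel_shape divide_right_mono intro!: kernel_shape_mono)
        ultimately show ?thesis by (intro mult_right_mono_neg)
      qed
    qed
  qed (use f_int in simp)
  also have "\<dots> = radial_kernel r 1 * integral\<^sup>L radial_measure f" by simp
  also have "\<dots> \<le> 0"
    using mass_nonneg kernel_shape_nonpos[of "1 / r"] r by (simp add: radial_kernel_eq_kernel_shape mult_nonpos_nonneg)
  finally show ?thesis using w_eq[OF r] by simp
qed simp

text \<open>Integrability of \<open>f\<close> alone does not separate its two terms, which cancel
  near \<open>s = 1\<close>. Far out the positive one is at most half of the other, and on bounded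
  sets \<open>w_le\<close> gives a bound.\<close>

lemma powr_exp_int: "integrable radial_measure (\<lambda>s. s powr p * exp (4 * w s))"
proof -
  \<comment> \<open>Beyond this \<open>S\<close> one has \<open>s powr p \<ge> 2\<close>, hence
    \<open>s powr p \<le> 2 * (s powr p - 1)\<close>.\<close>
  define S where "S = (2 :: real) powr (1 / p)"
  have S: "0 < S" "S powr p = 2" using p_pos by (simp_all add: S_def powr_powr)
  have "integrable radial_measure (\<lambda>s. 2 * \<bar>f s\<bar> + 2 * exp (4 * w 0) * indicator {0..S} s)"
    by (intro Bochner_Integration.integrable_add integrable_mult_right integrable_abs f_int integrable_radial_measure_indicator)
  then show ?thesis
  proof (rule Bochner_Integration.integrable_bound)
    show "AE s in radial_measure. norm (s powr p * exp (4 * w s)) \<le> norm (2 * \<bar>f s\<bar> + 2 * exp (4 * w 0) * indicator {0..S} s)"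
      using AE_radial_measure_pos
    proof eventually_elim
      case (elim s)
      show ?case
      proof (cases "s \<le> S")
        case True
        then have "s powr p \<le> 2" using elim p_pos S powr_mono2[of p s S] by simp
        then have "s powr p * exp (4 * w s) \<le> 2 * exp (4 * w 0)"
          using w_le[of s] elim by (intro mult_mono) auto
        then show ?thesis using True elim by simp
      next
        case False
        then have "2 \<le> s powr p" using elim p_pos S powr_mono2[of p S s] by simp
        then have "s powr p * exp (4 * w s) \<le> 2 * ((s powr p - 1) * exp (4 * w s))"
          using mult_right_mono[of "s powr p" "2 * (s powr p - 1)" "exp (4 * w s)"] by (simp only: mult.assoc) simp
        also have "\<dots> = 2 * \<bar>f s\<bar>"
          using \<open>2 \<le> s powr p\<close> by (simp add: f_eq abs_mult)
        also have "\<dots> \<le> \<bar>2 * \<bar>f s\<bar> + 2 * exp (4 * w 0) * indicator {0..S} s\<bar>"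
          by (intro order_trans[OF _ abs_ge_self]) simp
        finally show ?thesis by simp
      qed
    qed
  qed measurable
qed

lemma exp_int: "integrable radial_measure (\<lambda>s. exp (4 * w s))"
  using Bochner_Integration.integrable_add[OF f_int powr_exp_int]
  by (simp add: f_eq algebra_simps)

definition N :: "real \<Rightarrow> real" where
  "N r = 1 / 4 * (\<integral>s. kernel_weight (s / r) * f s \<partial>radial_measure)"

lemma borel_measurable_kernel_weight [measurable]: "kernel_weight \<in> borel_measurable borel"
  unfolding kernel_weight_def by measurable

text \<open>Differentiation under the integral: for \<open>z > r / 2\<close> the kernel has
  \<open>z\<close>-derivative at most \<open>2 / r\<close> in absolute value, because the weight
  lies between 0 and 1. So \<open>N\<close> is the flux \<open>- r * w' r\<close>.\<close>

lemma DERIV_w: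
  assumes "0 < r"
  shows "(w has_real_derivative - N r / r) (at r)"
proof -
  have "((\<lambda>r. \<integral>s. radial_kernel r s * f s \<partial>radial_measure) has_real_derivative (\<integral>s. (- kernel_weight (s / r) / r) * f s \<partial>radial_measure)) (at r)"
  proof (rule DERIV_integral_dominated[where d="r / 2" and g="\<lambda>s. 2 / r * \<bar>f s\<bar>"])
    show "integrable radial_measure (\<lambda>s. radial_kernel x s * f s)" if "x \<in> ball r (r / 2)" for x
      using that assms by (intro Gf_int) (auto simp: dist_real_def abs_if split: if_splits)
    show "AE s in radial_measure. ((\<lambda>x. radial_kernel x s * f s) has_real_derivative (- kernel_weight (s / r) / r) * f s) (at r)"
      using AE_radial_measure_pos by eventually_elim (intro DERIV_cmult_right DERIV_radial_kernel assms)
    show "AE s in radial_measure. \<forall>x\<in>ball r (r / 2). \<bar>radial_kernel x s * f s - radial_kernel r s * f s\<bar> \<le> 2 / r * \<bar>f s\<bar> * \<bar>x - r\<bar>"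
      using AE_radial_measure_pos
    proof eventually_elim
      case (elim s)
      show ?case
      proof
        fix x assume x: "x \<in> ball r (r / 2)"
        have "norm (radial_kernel x s - radial_kernel r s) \<le> 2 / r * norm (x - r)"
        proof (rule field_differentiable_bound[OF convex_ball[of r "r / 2"] _ _ x])
          fix z assume "z \<in> ball r (r / 2)"
          then have z: "r / 2 < z" by (auto simp: dist_real_def abs_if split: if_splits)
          then have "0 < z" using assms by simp
          then show "((\<lambda>z. radial_kernel z s) has_field_derivative - kernel_weight (s / z) / z) (at z within ball r (r / 2))"
            using DERIV_radial_kernel[of z s] elim by (simp add: has_field_derivative_at_within)
          have "\<bar>kernel_weight (s / z)\<bar> \<le> 1" using kernel_weight_bounds[of "s / z"] elim \<open>0 < z\<close> by simp
          then have "\<bar>kernel_weight (s / z)\<bar> / z \<le> 1 / (r / 2)"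
            using z assms \<open>0 < z\<close> by (intro frac_le) auto
          then show "norm (- kernel_weight (s / z) / z) \<le> 2 / r"
            using \<open>0 < z\<close> by simp
        qed (use assms in auto)
        then have "\<bar>radial_kernel x s - radial_kernel r s\<bar> * \<bar>f s\<bar> \<le> 2 / r * \<bar>x - r\<bar> * \<bar>f s\<bar>"
          by (intro mult_right_mono) auto
        moreover have "radial_kernel x s * f s - radial_kernel r s * f s = (radial_kernel x s - radial_kernel r s) * f s"
          by (simp add: left_diff_distrib)
        ultimately show "\<bar>radial_kernel x s * f s - radial_kernel r s * f s\<bar> \<le> 2 / r * \<bar>f s\<bar> * \<bar>x - r\<bar>"
          by (simp add: abs_mult mult_ac)
      qed
    qed
  qed (use assms f_int in auto)
  then have D: "((\<lambda>r. w 0 + 1 / 4 * (\<integral>s. radial_kernel r s * f s \<partial>radial_measure)) has_real_derivative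
      1 / 4 * (\<integral>s. (- kernel_weight (s / r) / r) * f s \<partial>radial_measure)) (at r)"
    by (auto intro!: derivative_eq_intros)
  have val: "1 / 4 * (\<integral>s. (- kernel_weight (s / r) / r) * f s \<partial>radial_measure) = - N r / r"
    by (simp add: N_def)
  have ev: "\<forall>\<^sub>F x in nhds r. w 0 + 1 / 4 * (\<integral>s. radial_kernel x s * f s \<partial>radial_measure) = w x"
    using eventually_nhds_in_open[of "{0<..}" r] assms by (auto simp: w_eq elim!: eventually_mono)
  show ?thesis
    using DERIV_cong_ev[OF refl ev val] D by blast
qed

text \<open>The weight is continuous and bounded by 1, so \<open>\<bar>f s\<bar>\<close> dominates.
  Continuity serves the fundamental theorem of calculus in
  \<open>integral_integrand\<close>.\<close>

lemma isCont_N: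
  assumes "0 < r"
  shows "isCont N r"
  unfolding continuous_at_sequentially
proof (intro allI impI)
  fix X :: "nat \<Rightarrow> real" assume lim: "X \<longlonglongrightarrow> r"
  then have "\<forall>\<^sub>F i in sequentially. 0 < X i"
    using assms by (rule order_tendstoD)
  then obtain n where n: "\<And>i. i \<ge> n \<Longrightarrow> 0 < X i"
    by (auto simp: eventually_sequentially)
  have lim': "(\<lambda>i. X (i + n)) \<longlonglongrightarrow> r"
    by (rule LIMSEQ_ignore_initial_segment[OF lim])
  have "(\<lambda>i. \<integral>s. kernel_weight (s / X (i + n)) * f s \<partial>radial_measure) \<longlonglongrightarrow> (\<integral>s. kernel_weight (s / r) * f s \<partial>radial_measure)"
  proof (rule integral_dominated_convergence[where w="\<lambda>s. \<bar>f s\<bar>"])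
    show "AE s in radial_measure. (\<lambda>i. kernel_weight (s / X (i + n)) * f s) \<longlonglongrightarrow> kernel_weight (s / r) * f s"
      unfolding kernel_weight_def using lim' assms by (intro AE_I2 tendsto_intros) (auto simp: max_def)
    show "AE s in radial_measure. norm (kernel_weight (s / X (i + n)) * f s) \<le> \<bar>f s\<bar>" for i
      using AE_radial_measure_pos
    proof eventually_elim
      case (elim s)
      then show ?case
        using kernel_weight_bounds[of "s / X (i + n)"] n[of "i + n"] by (simp add: abs_mult mult_left_le_one_le)
    qed
  qed (use f_int in auto)
  then have "(\<lambda>i. N (X (i + n))) \<longlonglongrightarrow> N r"
    unfolding N_def by (intro tendsto_intros)
  then show "(N \<circ> X) \<longlonglongrightarrow> N r"
    unfolding comp_def by (rule LIMSEQ_offset)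
qed

text \<open>Exchanging \<open>r\<close> and \<open>s\<close> in the double integral and adding the
  two versions replaces the weight by \<open>kernel_weight t + kernel_weight (1 / t) = 1\<close>.
  Twice the double integral is thus the squared mass, and the factor 1/4 in \<open>N\<close> gives
  1/8.\<close>

lemma integral_N_f:
  "integrable radial_measure (\<lambda>r. N r * f r)"
  "(\<integral>r. N r * f r \<partial>radial_measure) = (integral\<^sup>L radial_measure f)\<^sup>2 / 8"
proof -
  interpret R: sigma_finite_measure radial_measure
    unfolding radial_measure_def
    by (subst sigma_finite_measure.sigma_finite_iff_density_finite[OF sigma_finite_lborel]) auto
  interpret P: pair_sigma_finite radial_measure radial_measure ..
  let ?P = "radial_measure \<Otimes>\<^sub>M radial_measure"
  have prod: "integrable ?P (\<lambda>x. f (fst x) * f (snd x))"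
  proof (rule P.Fubini_integrable)
    show "integrable radial_measure (\<lambda>r. \<integral>s. norm (f (fst (r, s)) * f (snd (r, s))) \<partial>radial_measure)"
      using f_int by (simp add: abs_mult)
    show "AE r in radial_measure. integrable radial_measure (\<lambda>s. f (fst (r, s)) * f (snd (r, s)))"
      using f_int by simp
  qed measurable
  have int: "integrable ?P (\<lambda>(r, s). kernel_weight (s / r) * f s * f r)"
  proof (rule Bochner_Integration.integrable_bound[OF prod])
    have "\<bar>kernel_weight (s / r) * f s * f r\<bar> \<le> \<bar>f r * f s\<bar>" for r s
      using kernel_weight_bounds[of "s / r"] mult_left_le[of "kernel_weight (s / r)" "\<bar>f r\<bar> * \<bar>f s\<bar>"]
      by (simp add: abs_mult mult_ac)
    then show "AE x in ?P. norm (case x of (r, s) \<Rightarrow> kernel_weight (s / r) * f s * f r) \<le> norm (f (fst x) * f (snd x))"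
      by (intro AE_I2) (auto split: prod.splits)
  qed measurable
  have N_eq: "N r * f r = 1 / 4 * (\<integral>s. kernel_weight (s / r) * f s * f r \<partial>radial_measure)" for r
    by (simp add: N_def)
  show "integrable radial_measure (\<lambda>r. N r * f r)"
    unfolding N_eq using P.integrable_fst[OF int] by simp
  define I where "I = (\<integral>r. \<integral>s. kernel_weight (s / r) * f s * f r \<partial>radial_measure \<partial>radial_measure)"
  have I2: "I = (\<integral>r. \<integral>s. kernel_weight (r / s) * f r * f s \<partial>radial_measure \<partial>radial_measure)"
    unfolding I_def using P.Fubini_integral[OF int] by simp
  have "I + I = (\<integral>r. \<integral>s. kernel_weight (s / r) * f s * f r \<partial>radial_measure \<partial>radial_measure) +
      (\<integral>r. \<integral>s. kernel_weight (r / s) * f r * f s \<partial>radial_measure \<partial>radial_measure)"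
    by (simp only: I_def[symmetric] I2[symmetric])
  also have "\<dots> = (\<integral>r. (\<integral>s. kernel_weight (s / r) * f s * f r \<partial>radial_measure) + (\<integral>s. kernel_weight (r / s) * f r * f s \<partial>radial_measure) \<partial>radial_measure)"
    by (rule Bochner_Integration.integral_add[OF P.integrable_fst[OF int] P.integrable_snd[OF int], symmetric])
  also have "\<dots> = (\<integral>r. (\<integral>s. f s * f r \<partial>radial_measure) \<partial>radial_measure)"
  proof (rule Bochner_Integration.integral_cong_AE)
    show "AE r in radial_measure. (\<integral>s. kernel_weight (s / r) * f s * f r \<partial>radial_measure) + (\<integral>s. kernel_weight (r / s) * f r * f s \<partial>radial_measure) = (\<integral>s. f s * f r \<partial>radial_measure)"
      using AE_radial_measure_pos P.AE_integrable_fst[OF int] P.AE_integrable_snd[OF int]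
    proof eventually_elim
      case (elim r)
      have "(\<integral>s. kernel_weight (s / r) * f s * f r \<partial>radial_measure) + (\<integral>s. kernel_weight (r / s) * f r * f s \<partial>radial_measure) =
          (\<integral>s. kernel_weight (s / r) * f s * f r + kernel_weight (r / s) * f r * f s \<partial>radial_measure)"
        using elim by (subst Bochner_Integration.integral_add) auto
      also have "\<dots> = (\<integral>s. f s * f r \<partial>radial_measure)"
      proof (rule Bochner_Integration.integral_cong_AE)
        show "AE s in radial_measure. kernel_weight (s / r) * f s * f r + kernel_weight (r / s) * f r * f s = f s * f r"
          using AE_radial_measure_pos
        proof eventually_elim
          case (elim s)
          then have "kernel_weight (s / r) + kernel_weight (r / s) = 1"
            using kernel_weight_inverse[of "s / r"] \<open>0 < r\<close> by simp
          then have "(kernel_weight (s / r) + kernel_weight (r / s)) * (f s * f r) = f s * f r" by simp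
          then show ?case by (simp add: algebra_simps)
        qed
      qed measurable
      finally show ?case .
    qed
  qed (use borel_measurable_integrable[OF P.integrable_fst[OF int]] borel_measurable_integrable[OF P.integrable_snd[OF int]] in \<open>auto intro!: borel_measurable_add\<close>)
  also have "\<dots> = (integral\<^sup>L radial_measure f)\<^sup>2"
    by (simp add: power2_eq_square)
  finally show "(\<integral>r. N r * f r \<partial>radial_measure) = (integral\<^sup>L radial_measure f)\<^sup>2 / 8"
    unfolding N_eq by (simp add: I_def)
qed

section \<open>Boundary terms and the integrated identity\<close>

text \<open>The product \<open>r ^ 4 * f r / 4\<close>, written with a single real power so that it
  can be differentiated directly.\<close>

definition boundary :: "real \<Rightarrow> real" where
  "boundary r = (r ^ 4 - r powr (4 + p)) / 4 * exp (4 * w r)"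

lemma boundary_eq: "0 < r \<Longrightarrow> boundary r = r ^ 4 * f r / 4"
  by (simp add: boundary_def f_eq powr_add algebra_simps flip: powr_numeral)

text \<open>The derivative of \<open>boundary\<close> divided by \<open>r ^ 3\<close>.\<close>

definition integrand :: "real \<Rightarrow> real" where
  "integrand r = f r - p / 4 * (r powr p * exp (4 * w r)) - N r * f r"

lemma isCont_w: "0 < r \<Longrightarrow> isCont w r"
  using DERIV_w DERIV_isCont by blast

lemma integral_integrand:
  assumes "0 < a" "a \<le> b"
  shows "(\<integral>s. indicator {a..b} s * (s ^ 3 * integrand s) \<partial>lborel) = boundary b - boundary a"
proof -
  have "(\<integral>s. indicator {a..b} s *\<^sub>R (s ^ 3 * integrand s) \<partial>lborel) = boundary b - boundary a"
  proof (rule integral_FTC_atLeastAtMost[OF \<open>a \<le> b\<close>])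
    fix r assume "a \<le> r" "r \<le> b"
    then have r: "0 < r" using assms by simp
    have "(boundary has_real_derivative ((4 * r ^ 3 - (4 + p) * r powr (4 + p - 1)) / 4 * exp (4 * w r)
        + (r ^ 4 - r powr (4 + p)) / 4 * (exp (4 * w r) * (4 * (- N r / r))))) (at r)"
      unfolding boundary_def using r
      by (auto intro!: derivative_eq_intros DERIV_w)
    also have "((4 * r ^ 3 - (4 + p) * r powr (4 + p - 1)) / 4 * exp (4 * w r)
        + (r ^ 4 - r powr (4 + p)) / 4 * (exp (4 * w r) * (4 * (- N r / r)))) = r ^ 3 * integrand r"
    proof -
      have 1: "r powr (4 + p - 1) = r ^ 3 * r powr p"
        using r powr_add[of r 3 p] by (simp add: add.commute)
      have 2: "r powr (4 + p) = r ^ 4 * r powr p"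
        using r powr_add[of r 4 p] by simp
      show ?thesis
        unfolding 1 2 integrand_def f_eq using r
        by (simp add: field_simps power3_eq_cube power4_eq_xxxx)
    qed
    finally show "(boundary has_vector_derivative r ^ 3 * integrand r) (at r within {a..b})"
      by (simp add: has_real_derivative_iff_has_vector_derivative has_vector_derivative_at_within)
  next
    have "isCont (\<lambda>s. s ^ 3 * integrand s) r" if "r \<in> {a..b}" for r
    proof -
      have r: "0 < r" using that assms by simp
      have "isCont (\<lambda>s. s powr p) r"
        by (rule DERIV_isCont[OF has_real_derivative_powr[OF r]])
      moreover from this have "isCont f r"
        unfolding f_eq[abs_def] using isCont_w[OF r]
        by (intro isCont_mult isCont_diff continuous_const isCont_exp') auto
      ultimately show ?thesis
        unfolding integrand_def using isCont_N[OF r] isCont_w[OF r]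
        by (intro isCont_mult isCont_diff isCont_power continuous_const continuous_ident isCont_exp') auto
    qed
    then show "continuous_on {a..b} (\<lambda>s. s ^ 3 * integrand s)"
      by (intro continuous_at_imp_continuous_on) auto
  qed
  then show ?thesis by simp
qed

text \<open>If \<open>boundary\<close> stayed above \<open>c\<close> in absolute value, then
  \<open>s ^ 3 * \<bar>f s\<bar> \<ge> 4 * c / s\<close> near infinity, whose integral diverges
  logarithmically. Smallness at arbitrarily large points replaces pointwise decay.\<close>

lemma boundary_small:
  assumes "0 < a" "0 < c"
  shows "\<exists>b\<ge>a. \<bar>boundary b\<bar> \<le> c"
proof (rule ccontr)
  assume "\<not> (\<exists>b\<ge>a. \<bar>boundary b\<bar> \<le> c)"
  then have big: "c < \<bar>boundary b\<bar>" if "a \<le> b" for b using that by force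
  define I where "I = (\<integral>s. \<bar>f s\<bar> \<partial>radial_measure)"
  have f': "integrable lborel (\<lambda>s. indicator {0<..} s * s ^ 3 * \<bar>f s\<bar>)"
    using f_int by (subst integrable_radial_measure_iff[symmetric]) auto
  have bound: "4 * c * (ln M - ln a) \<le> I" if "a \<le> M" for M
  proof -
    have cont: "continuous_on {a..M} (\<lambda>s. 4 * c / s)"
      using assms by (intro continuous_intros) auto
    have "4 * c * ln M - 4 * c * ln a = (\<integral>s. indicator {a..M} s *\<^sub>R (4 * c / s) \<partial>lborel)"
      using assms that
      by (intro integral_FTC_atLeastAtMost[symmetric] cont)
        (auto intro!: derivative_eq_intros simp flip: has_real_derivative_iff_has_vector_derivative)
    also have "\<dots> \<le> (\<integral>s. indicator {0<..} s * s ^ 3 * \<bar>f s\<bar> \<partial>lborel)"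
    proof (rule integral_mono[OF _ f'])
      show "integrable lborel (\<lambda>s. indicator {a..M} s *\<^sub>R (4 * c / s))"
        using borel_integrable_atLeastAtMost'[OF cont] by (simp add: set_integrable_def)
      fix s
      show "indicator {a..M} s *\<^sub>R (4 * c / s) \<le> indicator {0<..} s * s ^ 3 * \<bar>f s\<bar>"
      proof (cases "s \<in> {a..M}")
        case True
        then have s: "0 < s" using assms by simp
        have "c < s ^ 4 * \<bar>f s\<bar> / 4" using big[of s] True s by (simp add: boundary_eq abs_mult)
        then have "4 * c / s \<le> s ^ 3 * \<bar>f s\<bar>"
          using s by (simp add: field_simps power3_eq_cube power4_eq_xxxx)
        then show ?thesis using True s by simp
      qed (auto split: split_indicator)
    qed
    also have "\<dots> = I"
      unfolding I_def by (subst integral_radial_measure) auto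
    finally show ?thesis by (simp add: algebra_simps)
  qed
  have "0 \<le> I" unfolding I_def by simp
  \<comment> \<open>Chosen so that \<open>4 * c * (ln M - ln a) = I + 4 * c\<close>, which exceeds
    \<open>I\<close>.\<close>
  define M where "M = a * exp (I / (4 * c) + 1)"
  have "a \<le> M" using assms \<open>0 \<le> I\<close> by (simp add: M_def)
  moreover have "ln M - ln a = I / (4 * c) + 1"
    using assms by (simp add: M_def ln_mult)
  ultimately show False
    using bound[of M] assms by (simp add: field_simps)
qed

text \<open>Integrate the derivative of \<open>boundary\<close> over intervals exhausting the
  half-line. The right ends come from \<open>boundary_small\<close>; at the left ends the factor
  \<open>r ^ 4\<close> and \<open>w_le\<close> make \<open>boundary\<close> vanish. Hence
  \<open>integrand\<close> has integral 0, and \<open>integral_N_f\<close> evaluates its last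
  term.\<close>

lemma pohozaev:
  "p / 4 * (\<integral>s. s powr p * exp (4 * w s) \<partial>radial_measure) =
    integral\<^sup>L radial_measure f - (integral\<^sup>L radial_measure f)\<^sup>2 / 8"
proof -
  have [measurable]: "integrand \<in> borel_measurable borel"
  proof -
    have "(\<lambda>r. N r * f r) \<in> borel_measurable borel"
      using borel_measurable_integrable[OF integral_N_f(1)] by simp
    then show ?thesis unfolding integrand_def[abs_def] by measurable
  qed
  have int: "integrable radial_measure integrand"
    unfolding integrand_def[abs_def] using f_int powr_exp_int integral_N_f(1) by simp
  define k where "k s = indicator {0<..} s * s ^ 3 * integrand s" for s
  have k_int: "integrable lborel k"
    unfolding k_def[abs_def] using int by (subst integrable_radial_measure_iff[symmetric]) auto
  define a where "a n = 1 / (real n + 1)" for n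
  have "\<exists>b. \<forall>n. real n + 1 \<le> b n \<and> \<bar>boundary (b n)\<bar> \<le> a n"
    using boundary_small by (intro choice allI) (auto simp: a_def)
  then obtain b where b: "real n + 1 \<le> b n" "\<bar>boundary (b n)\<bar> \<le> a n" for n
    by blast
  have a: "0 < a n" "a n \<le> 1" for n by (auto simp: a_def)
  have ab: "a n \<le> b n" for n using a[of n] b[of n] by linarith
  have a0: "a \<longlonglongrightarrow> 0"
    unfolding a_def using LIMSEQ_inverse_real_of_nat by (simp add: inverse_eq_divide add.commute)
  have "(\<lambda>n. \<integral>s. indicator {a n..b n} s * k s \<partial>lborel) \<longlonglongrightarrow> integral\<^sup>L lborel k"
  proof (rule integral_dominated_convergence[where w="\<lambda>s. \<bar>k s\<bar>"])
    show "AE s in lborel. (\<lambda>n. indicator {a n..b n} s * k s) \<longlonglongrightarrow> k s"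
    proof (intro AE_I2 tendsto_eventually)
      fix s
      show "\<forall>\<^sub>F n in sequentially. indicator {a n..b n} s * k s = k s"
      proof (cases "0 < s")
        case True
        have "\<forall>\<^sub>F n in sequentially. a n < s"
          using a0 True by (rule order_tendstoD)
        moreover have "\<forall>\<^sub>F n in sequentially. s \<le> real n"
          by (metis eventually_sequentiallyI le_nat_iff nat_ceiling_le_eq real_nat_ceiling_ge)
        ultimately show ?thesis
        proof eventually_elim
          case (elim n)
          then show ?case using b(1)[of n] by simp
        qed
      qed (simp add: k_def)
    qed
    show "integrable lborel (\<lambda>s. \<bar>k s\<bar>)" using k_int by simp
    show "k \<in> borel_measurable lborel" by (rule borel_measurable_integrable[OF k_int])
    then show "(\<lambda>s. indicator {a n..b n} s * k s) \<in> borel_measurable lborel" for n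
      by measurable
  qed (auto simp: k_def split: split_indicator)
  moreover have "(\<integral>s. indicator {a n..b n} s * k s \<partial>lborel) = boundary (b n) - boundary (a n)" for n
  proof -
    have "indicator {a n..b n} s * k s = indicator {a n..b n} s * (s ^ 3 * integrand s)" for s
      using a(1)[of n] by (auto simp: k_def split: split_indicator)
    then show ?thesis by (simp only: integral_integrand[OF a(1) ab])
  qed
  ultimately have 1: "(\<lambda>n. boundary (b n) - boundary (a n)) \<longlonglongrightarrow> integral\<^sup>L lborel k"
    by simp
  have "(\<lambda>n. boundary (b n)) \<longlonglongrightarrow> 0"
    by (rule Lim_null_comparison[OF _ a0]) (use b in simp)
  moreover have "(\<lambda>n. boundary (a n)) \<longlonglongrightarrow> 0"
  proof (rule Lim_null_comparison)
    show "\<forall>\<^sub>F n in sequentially. norm (boundary (a n)) \<le> a n * exp (4 * w 0)"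
    proof (intro always_eventually allI)
      fix n
      have "a n powr p \<le> 1" using a[of n] p_pos by (simp add: powr_le1)
      then have "\<bar>1 - a n powr p\<bar> \<le> 1" using powr_ge_zero[of "a n" p] by linarith
      then have "\<bar>1 - a n powr p\<bar> * exp (4 * w (a n)) \<le> 1 * exp (4 * w 0)"
        using w_le[of "a n"] a[of n] by (intro mult_mono) auto
      then have fa: "\<bar>f (a n)\<bar> \<le> exp (4 * w 0)" by (simp add: f_eq abs_mult)
      have "a n ^ 4 \<le> a n" using a[of n] power_decreasing[of 1 4 "a n"] by simp
      then have "a n ^ 4 * \<bar>f (a n)\<bar> \<le> a n * exp (4 * w 0)"
        using fa a[of n] by (intro mult_mono) auto
      moreover have "0 \<le> a n * exp (4 * w 0)" using a[of n] by simp
      moreover have "norm (boundary (a n)) = a n ^ 4 * \<bar>f (a n)\<bar> / 4"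
        using a[of n] by (simp add: boundary_eq abs_mult)
      ultimately show "norm (boundary (a n)) \<le> a n * exp (4 * w 0)"
        by linarith
    qed
    show "(\<lambda>n. a n * exp (4 * w 0)) \<longlonglongrightarrow> 0"
      using tendsto_mult_left_zero[OF a0] .
  qed
  ultimately have "(\<lambda>n. boundary (b n) - boundary (a n)) \<longlonglongrightarrow> 0"
    using tendsto_diff by fastforce
  with 1 have "integral\<^sup>L lborel k = 0" by (rule LIMSEQ_unique)
  then have "integral\<^sup>L radial_measure integrand = 0"
    by (subst integral_radial_measure) (auto simp: k_def[abs_def])
  then show ?thesis
    unfolding integrand_def[abs_def] using f_int powr_exp_int integral_N_f by simp
qed

end

section \<open>The Volterra equation of the spherical solution\<close>

text \<open>Subtracting the term \<open>- t\<^sup>2 / (4 * s\<^sup>2)\<close>, which produces the quadratic part of a solution, makes the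
  kernel vanish for \<open>s \<ge> t\<close>. The factor \<open>s ^ 3\<close> is the density of \<open>radial_measure\<close>.\<close>

definition volterra_kernel :: "real \<Rightarrow> real \<Rightarrow> real" where
  "volterra_kernel t s = s ^ 3 * (radial_kernel t s + t\<^sup>2 / (4 * s\<^sup>2))"

lemma borel_measurable_volterra_kernel [measurable]: "volterra_kernel t \<in> borel_measurable borel"
  unfolding volterra_kernel_def[abs_def] by measurable

lemma volterra_kernel_eq_0: "0 < t \<Longrightarrow> t \<le> s \<Longrightarrow> volterra_kernel t s = 0"
  by (auto simp: volterra_kernel_def radial_kernel_def)

text \<open>In terms of \<open>x = t / s\<close> the kernel is \<open>s ^ 3\<close> times a function
  that is 0 at \<open>x = 1\<close> and has derivative
  \<open>(x\<^sup>2 - 1)\<^sup>2 / (2 * x ^ 3)\<close>. Its sign is the source of the comparison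
  principle. The upper bound keeps only the term \<open>x\<^sup>2 / 4\<close>.\<close>

lemma volterra_kernel_bounds:
  assumes "0 \<le> s" "s \<le> t"
  shows "0 \<le> volterra_kernel t s" "volterra_kernel t s \<le> t ^ 3 / 4"
proof -
  have "0 \<le> volterra_kernel t s \<and> volterra_kernel t s \<le> t ^ 3 / 4"
  proof (cases "s = 0 \<or> s = t")
    case True
    then show ?thesis using assms by (auto simp: volterra_kernel_def radial_kernel_def)
  next
    case False
    then have s: "0 < s" "s < t" using assms by auto
    define x where "x = t / s"
    have x: "1 < x" using s by (simp add: x_def)
    let ?h = "\<lambda>x. - ln x - 1 / (4 * x\<^sup>2) + x\<^sup>2 / 4"
    have "?h 1 \<le> ?h x"
    proof (rule DERIV_nonneg_imp_nondecreasing[where f="?h"])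
      show "1 \<le> x" using x by simp
      fix y :: real assume "1 \<le> y" "y \<le> x"
      then have "(?h has_real_derivative (y\<^sup>2 - 1)\<^sup>2 / (2 * y ^ 3)) (at y)"
        by (auto intro!: derivative_eq_intros simp: field_simps power2_eq_square power3_eq_cube)
      then show "\<exists>d. (?h has_real_derivative d) (at y) \<and> 0 \<le> d"
        using \<open>1 \<le> y\<close> by (intro exI[of _ "(y\<^sup>2 - 1)\<^sup>2 / (2 * y ^ 3)"]) auto
    qed
    moreover have eq: "volterra_kernel t s = s ^ 3 * ?h x"
      using s by (simp add: volterra_kernel_def radial_kernel_def x_def ln_div field_simps power2_eq_square)
    ultimately have 1: "0 \<le> volterra_kernel t s" using s by simp
    have "?h x \<le> x\<^sup>2 / 4" using x by (simp add: field_simps)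
    then have "volterra_kernel t s \<le> s ^ 3 * (x\<^sup>2 / 4)" unfolding eq using s by (intro mult_left_mono) auto
    also have "\<dots> = t\<^sup>2 * s / 4" using s by (simp add: x_def field_simps power2_eq_square power3_eq_cube)
    also have "\<dots> \<le> t\<^sup>2 * t / 4" using s by (intro divide_right_mono mult_left_mono) auto
    also have "\<dots> = t ^ 3 / 4" by (simp add: power2_eq_square power3_eq_cube)
    finally show ?thesis using 1 by simp
  qed
  then show "0 \<le> volterra_kernel t s" "volterra_kernel t s \<le> t ^ 3 / 4" by auto
qed

section \<open>Gronwall's inequality and one-sided comparison\<close>

lemma set_integrable_bounded:
  fixes f :: "real \<Rightarrow> real"
  assumes [measurable]: "f \<in> borel_measurable borel" and bound: "\<And>s. s \<in> {a..b} \<Longrightarrow> \<bar>f s\<bar> \<le> B"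
  shows "set_integrable lborel {a..b} f"
  unfolding set_integrable_def
proof (rule Bochner_Integration.integrable_bound)
  show "integrable lborel (\<lambda>s. B * indicator {a..b} s)"
    by (intro integrable_mult_right integrable_real_indicator) (auto simp: emeasure_lborel_Icc_eq)
  show "AE s in lborel. norm (indicator {a..b} s *\<^sub>R f s) \<le> norm (B * indicator {a..b} s)"
    using bound by (intro AE_I2) (force split: split_indicator)
qed measurable

text \<open>In the supremum weighted by \<open>exp (- 2 * C * t)\<close> the integral term has norm
  at most 1/2 and is absorbed. This works for functions that are merely measurable and bounded, at
  the price of a factor 2 and a doubled exponent.\<close>

lemma gronwall:
  fixes D :: "real \<Rightarrow> real"
  assumes [measurable]: "D \<in> borel_measurable borel"
    and D: "\<And>t. t \<in> {0..T} \<Longrightarrow> 0 \<le> D t" "\<And>t. t \<in> {0..T} \<Longrightarrow> D t \<le> M"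
    and "0 < C" "0 \<le> \<epsilon>"
    and ineq: "\<And>t. t \<in> {0..T} \<Longrightarrow> D t \<le> \<epsilon> + C * (LINT s:{0..t}|lborel. D s)"
    and t: "t \<in> {0..T}"
  shows "D t \<le> 2 * \<epsilon> * exp (2 * C * T)"
proof -
  define S where "S = (SUP t\<in>{0..T}. exp (- 2 * C * t) * D t)"
  have bdd: "bdd_above ((\<lambda>t. exp (- 2 * C * t) * D t) ` {0..T})"
  proof (intro bdd_aboveI2)
    fix t assume t: "t \<in> {0..T}"
    then have "exp (- 2 * C * t) * D t \<le> 1 * D t" using D \<open>0 < C\<close> by (intro mult_right_mono) auto
    then show "exp (- 2 * C * t) * D t \<le> M" using D(2)[OF t] by simp
  qed
  have le_S: "exp (- 2 * C * t) * D t \<le> S" if "t \<in> {0..T}" for t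
    unfolding S_def by (rule cSUP_upper[OF that bdd])
  have D_le: "D s \<le> S * exp (2 * C * s)" if "s \<in> {0..T}" for s
  proof -
    have "D s = exp (2 * C * s) * (exp (- 2 * C * s) * D s)"
      by (simp add: mult.assoc[symmetric] exp_add[symmetric])
    also have "\<dots> \<le> exp (2 * C * s) * S" by (intro mult_left_mono le_S that) simp
    finally show ?thesis by (simp add: mult.commute)
  qed
  have "0 \<le> exp (- 2 * C * t) * D t" using D(1)[OF t] by simp
  then have "0 \<le> S" using le_S[OF t] by linarith
  have "S \<le> \<epsilon> + S / 2"
    unfolding S_def
  proof (rule cSUP_least)
    fix t assume t: "t \<in> {0..T}"
    have cont: "continuous_on {0..t} (\<lambda>s. S * exp (2 * C * s))" by (intro continuous_intros)
    have "(LINT s:{0..t}|lborel. D s) \<le> (LINT s:{0..t}|lborel. S * exp (2 * C * s))"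
    proof (rule set_integral_mono)
      show "set_integrable lborel {0..t} D"
        using t D by (intro set_integrable_bounded[where B=M]) (auto simp: abs_le_iff intro: order_trans)
      show "set_integrable lborel {0..t} (\<lambda>s. S * exp (2 * C * s))"
        by (rule borel_integrable_atLeastAtMost'[OF cont])
    qed (use t D_le in auto)
    also have "\<dots> = S * exp (2 * C * t) / (2 * C) - S * exp (2 * C * 0) / (2 * C)"
      unfolding set_lebesgue_integral_def
      using t \<open>0 < C\<close> by (intro integral_FTC_atLeastAtMost cont)
        (auto intro!: derivative_eq_intros simp flip: has_real_derivative_iff_has_vector_derivative)
    also have "\<dots> \<le> S * exp (2 * C * t) / (2 * C)"
      using \<open>0 \<le> S\<close> \<open>0 < C\<close> by simp
    finally have "C * (LINT s:{0..t}|lborel. D s) \<le> C * (S * exp (2 * C * t) / (2 * C))"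
      using \<open>0 < C\<close> by (intro mult_left_mono) auto
    then have "D t \<le> \<epsilon> + S * exp (2 * C * t) / 2"
      using ineq[OF t] \<open>0 < C\<close> by simp
    then have "exp (- 2 * C * t) * D t \<le> exp (- 2 * C * t) * (\<epsilon> + S * exp (2 * C * t) / 2)"
      by (intro mult_left_mono) auto
    also have "\<dots> = exp (- 2 * C * t) * \<epsilon> + (exp (- 2 * C * t) * exp (2 * C * t)) * S / 2"
      by (simp add: algebra_simps)
    also have "\<dots> \<le> 1 * \<epsilon> + S / 2"
      using t \<open>0 < C\<close> \<open>0 \<le> \<epsilon>\<close> by (intro add_mono mult_right_mono) (auto simp: exp_add[symmetric])
    finally show "exp (- 2 * C * t) * D t \<le> \<epsilon> + (SUP t\<in>{0..T}. exp (- 2 * C * t) * D t) / 2"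
      by (simp add: S_def)
  qed (use t in auto)
  then have "S \<le> 2 * \<epsilon>" by simp
  have "D t \<le> S * exp (2 * C * t)" by (rule D_le[OF t])
  also have "\<dots> \<le> 2 * \<epsilon> * exp (2 * C * T)"
    using \<open>S \<le> 2 * \<epsilon>\<close> \<open>0 \<le> S\<close> t \<open>0 < C\<close> by (intro mult_mono) auto
  finally show ?thesis .
qed

lemma exp_4_le: "exp (4 * a) \<le> 16" if "a \<le> ln 2" for a :: real
proof -
  have "exp (4 * a) \<le> exp (4 * ln 2)" using that by simp
  also have "\<dots> = (2 :: real) ^ 4" by (subst exp_of_nat_mult[of 4 "ln 2", simplified]) simp
  finally show ?thesis by simp
qed

text \<open>By convexity the difference is at most \<open>4 * (x - y) * exp (4 * x)\<close>, and the
  exponential is at most 16. Only the positive part appears, as befits a one-sided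
  comparison.\<close>

lemma exp_diff_le:
  fixes x y :: real
  assumes "x \<le> ln 2"
  shows "exp (4 * x) - exp (4 * y) \<le> 64 * max 0 (x - y)"
proof (cases "x \<le> y")
  case False
  have e: "exp (4 * x) \<le> 16" by (rule exp_4_le[OF assms])
  have "exp (4 * x) - exp (4 * y) = exp (4 * x) * (1 - exp (4 * y - 4 * x))"
    by (simp add: algebra_simps exp_add[symmetric])
  also have "\<dots> \<le> exp (4 * x) * (4 * (x - y))"
  proof (rule mult_left_mono)
    show "1 - exp (4 * y - 4 * x) \<le> 4 * (x - y)"
    proof -
      have "1 + (4 * y - 4 * x) \<le> E \<Longrightarrow> 1 - E \<le> 4 * (x - y)" for E :: real
        by (simp add: algebra_simps)
      then show ?thesis using exp_ge_add_one_self[of "4 * y - 4 * x"] by blast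
    qed
  qed simp
  also have "\<dots> \<le> 16 * (4 * (x - y))"
    using e False by (intro mult_right_mono) auto
  finally show ?thesis using False by simp
qed simp

text \<open>Apply \<open>gronwall\<close> to the positive part of \<open>x - y\<close>: the kernel
  is nonnegative, so negative parts of the difference may be discarded under the integral. The rate
  is \<open>3 / 2 * (T ^ 3 / 4) * 64 = 24 * T ^ 3\<close>. The bound \<open>B\<close> only ensures
  that the positive part is bounded and does not enter the estimate.\<close>

lemma volterra_comparison:
  fixes x y :: "real \<Rightarrow> real"
  assumes [measurable]: "x \<in> borel_measurable borel" "y \<in> borel_measurable borel"
    and x: "\<And>t. t \<in> {0..T} \<Longrightarrow> x t \<le> ln 2" and y: "\<And>t. t \<in> {0..T} \<Longrightarrow> y t \<le> ln 2"
    and low: "\<And>t. t \<in> {0..T} \<Longrightarrow> - B \<le> y t"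
    and "0 < T" "0 \<le> \<epsilon>"
    and ineq: "\<And>t. t \<in> {0..T} \<Longrightarrow>
      x t - y t \<le> \<epsilon> + 3 / 2 * (LINT s:{0..t}|lborel. volterra_kernel t s * (exp (4 * x s) - exp (4 * y s)))"
    and t: "t \<in> {0..T}"
  shows "x t - y t \<le> 2 * \<epsilon> * exp (48 * T ^ 4)"
proof -
  define D where "D t = max 0 (x t - y t)" for t
  have [measurable]: "D \<in> borel_measurable borel" unfolding D_def[abs_def] by measurable
  have D_le: "D t \<le> \<bar>ln 2 + B\<bar>" if "t \<in> {0..T}" for t
    using x[OF that] low[OF that] by (auto simp: D_def)
  have bound: "D t \<le> 2 * \<epsilon> * exp (2 * (24 * T ^ 3) * T)"
  proof (rule gronwall[OF _ _ D_le _ \<open>0 \<le> \<epsilon>\<close> _ t])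
    fix t assume t: "t \<in> {0..T}"
    have t3: "t ^ 3 \<le> T ^ 3" using t by (intro power_mono) auto
    have intD: "set_integrable lborel {0..t} (\<lambda>s. T ^ 3 / 4 * (64 * D s))"
      using t D_le by (intro set_integrable_mult_right set_integrable_bounded[where B="\<bar>ln 2 + B\<bar>"]) (auto simp: D_def)
    have "(LINT s:{0..t}|lborel. volterra_kernel t s * (exp (4 * x s) - exp (4 * y s))) \<le> (LINT s:{0..t}|lborel. T ^ 3 / 4 * (64 * D s))"
    proof (rule set_integral_mono[OF _ intD])
      show "set_integrable lborel {0..t} (\<lambda>s. volterra_kernel t s * (exp (4 * x s) - exp (4 * y s)))"
      proof (rule set_integrable_bounded[where B="T ^ 3 / 4 * 16"])
        fix s assume s: "s \<in> {0..t}"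
        then have "\<bar>volterra_kernel t s\<bar> \<le> T ^ 3 / 4" using volterra_kernel_bounds[of s t] t3 by auto
        moreover have "\<bar>exp (4 * x s) - exp (4 * y s)\<bar> \<le> 16"
          using exp_4_le[OF x, of s] exp_4_le[OF y, of s] s t by (smt (verit) atLeastAtMost_iff exp_gt_zero)
        ultimately show "\<bar>volterra_kernel t s * (exp (4 * x s) - exp (4 * y s))\<bar> \<le> T ^ 3 / 4 * 16"
          unfolding abs_mult using \<open>0 < T\<close> by (intro mult_mono) auto
      qed measurable
      fix s assume s: "s \<in> {0..t}"
      have "volterra_kernel t s * (exp (4 * x s) - exp (4 * y s)) \<le> volterra_kernel t s * (64 * D s)"
        unfolding D_def using s t x by (intro mult_left_mono exp_diff_le volterra_kernel_bounds) auto
      also have "\<dots> \<le> T ^ 3 / 4 * (64 * D s)"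
        using volterra_kernel_bounds[of s t] s t3 by (intro mult_right_mono) (auto simp: D_def)
      finally show "volterra_kernel t s * (exp (4 * x s) - exp (4 * y s)) \<le> T ^ 3 / 4 * (64 * D s)" .
    qed
    also have "\<dots> = 16 * T ^ 3 * (LINT s:{0..t}|lborel. D s)" by simp
    finally have "x t - y t \<le> \<epsilon> + 24 * T ^ 3 * (LINT s:{0..t}|lborel. D s)"
      using ineq[OF t] by linarith
    moreover have "0 \<le> (LINT s:{0..t}|lborel. D s)"
      unfolding set_lebesgue_integral_def by (intro Bochner_Integration.integral_nonneg) (auto simp: D_def)
    ultimately show "D t \<le> \<epsilon> + 24 * T ^ 3 * (LINT s:{0..t}|lborel. D s)"
      using \<open>0 \<le> \<epsilon>\<close> \<open>0 < T\<close> by (simp add: D_def)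
  qed (use \<open>0 < T\<close> in \<open>auto simp: D_def\<close>)
  have "2 * (24 * T ^ 3) * T = 48 * T ^ 4" by (simp add: power3_eq_cube power4_eq_xxxx)
  then show ?thesis using bound by (simp only: D_def max.bounded_iff)
qed

section \<open>The explicit solution of the limit equation\<close>

text \<open>Logarithm of the conformal factor of stereographic projection:
  \<open>exp (4 * spherical (norm x))\<close> is the volume density of the round
  four-sphere.\<close>

definition spherical :: "real \<Rightarrow> real" where
  "spherical t = ln (2 / (1 + t\<^sup>2))"

lemma borel_measurable_spherical [measurable]: "spherical \<in> borel_measurable borel"
  unfolding spherical_def[abs_def] by measurable

lemma spherical_eq: "spherical t = ln 2 - ln (1 + t\<^sup>2)"
proof -
  have "0 < 1 + t\<^sup>2" by (simp add: add_pos_nonneg)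
  then show ?thesis by (simp add: spherical_def ln_div)
qed

lemma spherical_le: "spherical t \<le> ln 2"
  by (simp add: spherical_eq)

lemma spherical_ge: "t \<in> {0..T} \<Longrightarrow> - ln (1 + T\<^sup>2) \<le> spherical t"
proof -
  assume "t \<in> {0..T}"
  then have "t\<^sup>2 \<le> T\<^sup>2" by (intro power_mono) auto
  then have "ln (1 + t\<^sup>2) \<le> ln (1 + T\<^sup>2)" by (intro ln_mono) (auto simp: add_pos_nonneg)
  moreover have "0 \<le> ln (2 :: real)" by simp
  ultimately show ?thesis unfolding spherical_eq by linarith
qed

lemma exp_spherical: "exp (4 * spherical t) = 16 * (1 / (1 + t\<^sup>2)) ^ 4"
proof -
  have "exp (4 * spherical t) = exp (spherical t) ^ 4"
    using exp_of_nat_mult[of 4 "spherical t"] by simp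
  also have "exp (spherical t) = 2 * (1 / (1 + t\<^sup>2))"
    unfolding spherical_def by (subst exp_ln) (auto simp: add_pos_nonneg)
  finally show ?thesis by (simp add: power_divide)
qed

lemma DERIV_inverse_one_plus_square:
  "((\<lambda>s::real. 1 / (1 + s\<^sup>2)) has_real_derivative - 2 * s * (1 / (1 + s\<^sup>2))\<^sup>2) (at s)"
proof -
  have "1 + s\<^sup>2 \<noteq> 0" by (smt (verit) zero_le_power2)
  then show ?thesis by (auto intro!: derivative_eq_intros simp: field_simps power2_eq_square)
qed

text \<open>The convention \<open>ln 0 = 0\<close> agrees with the limit of \<open>s * ln s\<close>
  at 0. This allows an antiderivative with a logarithm on the closed interval.\<close>

lemma continuous_x_ln: "continuous_on {0..} (\<lambda>s::real. s * ln s)"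
  unfolding continuous_on_eq_continuous_within
proof
  fix s :: real assume "s \<in> {0..}"
  show "continuous (at s within {0..}) (\<lambda>s. s * ln s)"
  proof (cases "s = 0")
    case True
    have "((\<lambda>s::real. s * ln s) \<longlongrightarrow> 0) (at_right 0)" by real_asymp
    then have "((\<lambda>s::real. s * ln s) \<longlongrightarrow> 0) (at 0 within {0..})"
      by (simp add: at_within_Ici_at_right)
    then show ?thesis using True by (simp add: continuous_within)
  next
    case False
    then have "isCont (\<lambda>s. s * ln s) s"
      by (intro isCont_mult isCont_ln continuous_ident)
    then show ?thesis by (rule continuous_at_imp_continuous_at_within)
  qed
qed

text \<open>An explicit antiderivative, found by integrating the logarithmic part of the kernel by
  parts. Everything else is rational in \<open>s\<close> and \<open>i s\<close>, and the relation
  \<open>i s * (1 + s\<^sup>2) = 1\<close> reduces each identity to polynomial algebra.\<close>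

lemma integral_volterra_kernel_spherical:
  assumes "0 < t"
  shows "(LINT s:{0..t}|lborel. volterra_kernel t s * exp (4 * spherical s)) = 2 / 3 * (t\<^sup>2 - ln (1 + t\<^sup>2))"
proof -
  define i where "i s = 1 / (1 + s\<^sup>2)" for s :: real
  have i: "i s * (1 + s\<^sup>2) = 1" for s
    unfolding i_def by (simp add: add_nonneg_eq_0_iff)
  have Di: "(i has_real_derivative - 2 * s * (i s)\<^sup>2) (at s)" for s
    unfolding i_def[abs_def] by (rule DERIV_inverse_one_plus_square)
  \<comment> \<open>\<open>P\<close>, \<open>R\<close> and \<open>U\<close> are antiderivatives of
    \<open>s ^ 3\<close>, \<open>s ^ 5\<close> and \<open>s\<close> times \<open>(i s) ^ 4\<close>,
    while \<open>Q\<close> is one of \<open>P s / s\<close>, which arises from the integration by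
    parts. The additive constants make all four vanish at 0.\<close>
  define P where "P s = 1 / 12 - (i s)\<^sup>2 / 4 + (i s) ^ 3 / 6" for s
  define P1 where "P1 s = s ^ 3 * (s\<^sup>2 + 3) * (i s) ^ 3 / 12" for s
  define Q where "Q s = (ln (1 + s\<^sup>2) - i s + (i s)\<^sup>2) / 24" for s
  define R where "R s = (- i s + (i s)\<^sup>2 - (i s) ^ 3 / 3) / 2 + 1 / 6" for s
  define U where "U s = (1 - (i s) ^ 3) / 6" for s
  have PP1: "P s = s * P1 s" for s
    unfolding P_def P1_def using i[of s] by algebra
  have DP: "(P has_real_derivative s ^ 3 * (i s) ^ 4) (at s)" for s
  proof -
    have "(P has_real_derivative s * (i s) ^ 3 - s * (i s) ^ 4) (at s)"
      unfolding P_def[abs_def]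
      by (auto intro!: derivative_eq_intros Di simp: field_simps power2_eq_square power3_eq_cube power4_eq_xxxx)
    moreover have "s * (i s) ^ 3 - s * (i s) ^ 4 = s ^ 3 * (i s) ^ 4"
      using i[of s] by algebra
    ultimately show ?thesis by simp
  qed
  have DQ: "(Q has_real_derivative P1 s) (at s)" for s
  proof -
    have "1 + s\<^sup>2 > 0" by (simp add: add_pos_nonneg)
    then have "(Q has_real_derivative (2 * s * i s + 2 * s * (i s)\<^sup>2 - 4 * s * (i s) ^ 3) / 24) (at s)"
      unfolding Q_def[abs_def]
      by (auto intro!: derivative_eq_intros Di simp: i_def[of s] inverse_eq_divide power2_eq_square power3_eq_cube)
    moreover have "(2 * s * i s + 2 * s * (i s)\<^sup>2 - 4 * s * (i s) ^ 3) / 24 = P1 s"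
      unfolding P1_def using i[of s] by algebra
    ultimately show ?thesis by simp
  qed
  have DR: "(R has_real_derivative s ^ 5 * (i s) ^ 4) (at s)" for s
  proof -
    have "(R has_real_derivative s * (i s)\<^sup>2 - 2 * s * (i s) ^ 3 + s * (i s) ^ 4) (at s)"
      unfolding R_def[abs_def]
      by (auto intro!: derivative_eq_intros Di simp: field_simps power2_eq_square power3_eq_cube power4_eq_xxxx)
    moreover have "s * (i s)\<^sup>2 - 2 * s * (i s) ^ 3 + s * (i s) ^ 4 = s ^ 5 * (i s) ^ 4"
      using i[of s] by algebra
    ultimately show ?thesis by simp
  qed
  have DU: "(U has_real_derivative s * (i s) ^ 4) (at s)" for s
    unfolding U_def[abs_def]
    by (auto intro!: derivative_eq_intros Di simp: field_simps power2_eq_square power3_eq_cube power4_eq_xxxx)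
  define c where "c = 1 / (4 * t\<^sup>2)"
  \<comment> \<open>The summand \<open>P s * ln s\<close> is written as
    \<open>P1 s * (s * ln s)\<close> to be continuous at 0.\<close>
  define F where "F s = P1 s * (s * ln s) - P s * ln t - Q s - c * R s + t\<^sup>2 * U s / 4" for s
  have contD: "continuous_on A g" if "\<And>s. (g has_real_derivative g' s) (at s)" for A and g g' :: "real \<Rightarrow> real"
    using that by (meson DERIV_isCont continuous_at_imp_continuous_on)
  have cont_i: "continuous_on A i" for A by (rule contD[OF Di])
  have "((\<lambda>s. volterra_kernel t s * (i s) ^ 4) has_integral F t - F 0) {0..t}"
  proof (rule fundamental_theorem_of_calculus_interior)
    show "0 \<le> t" using assms by simp
    show "continuous_on {0..t} F"
      unfolding F_def[abs_def] P1_def[abs_def] using assms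
      by (intro continuous_intros contD[OF DP] contD[OF DQ] contD[OF DR] contD[OF DU] cont_i
          continuous_on_subset[OF continuous_x_ln]) auto
    fix s assume "s \<in> {0<..<t}"
    then have s: "0 < s" "s < t" by auto
    have "((\<lambda>s. P s * (ln s - ln t) - Q s - c * R s + t\<^sup>2 * U s / 4) has_real_derivative
      (s ^ 3 * (i s) ^ 4 * (ln s - ln t) + P s / s - P1 s - c * (s ^ 5 * (i s) ^ 4) + t\<^sup>2 * (s * (i s) ^ 4) / 4)) (at s)"
      using s assms by (auto intro!: derivative_eq_intros DP DQ DR DU)
    moreover have "(\<lambda>s. P s * (ln s - ln t) - Q s - c * R s + t\<^sup>2 * U s / 4) = F"
      by (simp add: F_def[abs_def] PP1 algebra_simps)
    moreover have "s ^ 3 * (i s) ^ 4 * (ln s - ln t) + P s / s - P1 s - c * (s ^ 5 * (i s) ^ 4) + t\<^sup>2 * (s * (i s) ^ 4) / 4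
        = volterra_kernel t s * (i s) ^ 4"
    proof -
      have "P s / s = P1 s" using s by (simp add: PP1)
      have k: "volterra_kernel t s = s ^ 3 * (ln s - ln t) - c * s ^ 5 + t\<^sup>2 * s / 4"
        using s by (simp add: volterra_kernel_def radial_kernel_def c_def ln_div field_simps power2_eq_square power3_eq_cube eval_nat_numeral)
      show ?thesis unfolding k using \<open>P s / s = P1 s\<close> by (simp add: algebra_simps)
    qed
    ultimately show "(F has_vector_derivative volterra_kernel t s * (i s) ^ 4) (at s)"
      by (simp add: has_real_derivative_iff_has_vector_derivative)
  qed
  moreover have "F 0 = 0"
    by (simp add: F_def P_def P1_def Q_def R_def U_def i_def)
  moreover have "F t = (t\<^sup>2 - ln (1 + t\<^sup>2)) / 24"
  proof -
    have "F t = - Q t - R t / (4 * t\<^sup>2) + t\<^sup>2 * U t / 4"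
      by (simp add: F_def PP1 c_def)
    moreover have "R t = t ^ 6 * (i t) ^ 3 / 6"
      unfolding R_def using i[of t] by algebra
    moreover have "t ^ 6 * (i t) ^ 3 / 6 / (4 * t\<^sup>2) = t ^ 4 * (i t) ^ 3 / 24"
      using assms by (simp add: field_simps eval_nat_numeral)
    moreover have "- ((ln (1 + t\<^sup>2) - i t + (i t)\<^sup>2) / 24) - t ^ 4 * (i t) ^ 3 / 24 + t\<^sup>2 * ((1 - (i t) ^ 3) / 6) / 4 = (t\<^sup>2 - ln (1 + t\<^sup>2)) / 24"
    proof -
      have "a = j * (1 + x)\<^sup>2 \<Longrightarrow> a' = j * (1 + x) \<Longrightarrow>
          - ((L - a + a') / 24) - x\<^sup>2 * j / 24 + x * ((1 - j) / 6) / 4 = (x - L) / 24" for a a' j x L :: real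
        by (simp add: field_simps power2_eq_square)
      moreover have "i t = (i t) ^ 3 * (1 + t\<^sup>2)\<^sup>2" "(i t)\<^sup>2 = (i t) ^ 3 * (1 + t\<^sup>2)"
        using i[of t] by algebra+
      ultimately have "- ((ln (1 + t\<^sup>2) - i t + (i t)\<^sup>2) / 24) - (t\<^sup>2)\<^sup>2 * (i t) ^ 3 / 24 + t\<^sup>2 * ((1 - (i t) ^ 3) / 6) / 4 = (t\<^sup>2 - ln (1 + t\<^sup>2)) / 24"
        by blast
      then show ?thesis by (simp add: power2_eq_square power4_eq_xxxx mult.assoc)
    qed
    ultimately show ?thesis by (simp add: Q_def U_def)
  qed
  ultimately have "((\<lambda>s. 16 * (volterra_kernel t s * (i s) ^ 4)) has_integral 16 * ((t\<^sup>2 - ln (1 + t\<^sup>2)) / 24)) {0..t}"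
    by (intro has_integral_mult_right) simp
  then have I: "((\<lambda>s. volterra_kernel t s * exp (4 * spherical s)) has_integral 2 / 3 * (t\<^sup>2 - ln (1 + t\<^sup>2))) {0..t}"
  proof -
    have "volterra_kernel t s * exp (4 * spherical s) = 16 * (volterra_kernel t s * (i s) ^ 4)" for s
      by (simp add: exp_spherical i_def)
    moreover have "2 / 3 * (t\<^sup>2 - ln (1 + t\<^sup>2)) = 16 * ((t\<^sup>2 - ln (1 + t\<^sup>2)) / 24)"
      by simp
    ultimately show ?thesis
      using \<open>((\<lambda>s. 16 * (volterra_kernel t s * (i s) ^ 4)) has_integral 16 * ((t\<^sup>2 - ln (1 + t\<^sup>2)) / 24)) {0..t}\<close>
      by (simp only:)
  qed
  have "set_integrable lborel {0..t} (\<lambda>s. volterra_kernel t s * exp (4 * spherical s))"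
  proof (rule set_integrable_bounded[where B="t ^ 3 / 4 * 16"])
    fix s assume s: "s \<in> {0..t}"
    have "1 / (1 + s\<^sup>2) \<le> 1 / 1" by (intro frac_le) auto
    then have "(1 / (1 + s\<^sup>2)) ^ 4 \<le> 1" by (intro power_le_one) auto
    then show "\<bar>volterra_kernel t s * exp (4 * spherical s)\<bar> \<le> t ^ 3 / 4 * 16"
      unfolding abs_mult using volterra_kernel_bounds[of s t] s by (intro mult_mono) (auto simp: exp_spherical)
  qed measurable
  from set_borel_integral_eq_integral(2)[OF this] show ?thesis
    using integral_unique[OF I] by simp
qed

lemma spherical_volterra:
  assumes "0 \<le> t"
  shows "spherical t = ln 2 - t\<^sup>2 + 3 / 2 * (LINT s:{0..t}|lborel. volterra_kernel t s * exp (4 * spherical s))"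
proof (cases "t = 0")
  case False
  then show ?thesis using integral_volterra_kernel_spherical[of t] assms by (simp add: spherical_eq)
next
  case True
  have "(LINT s:{0..0}|lborel. volterra_kernel 0 s * exp (4 * spherical s)) = 0"
  proof -
    have "indicator {0..0} s *\<^sub>R (volterra_kernel 0 s * exp (4 * spherical s)) = 0" for s :: real
      by (auto simp: volterra_kernel_def split: split_indicator)
    then show ?thesis unfolding set_lebesgue_integral_def by (simp only: integral_zero)
  qed
  then show ?thesis using True by (simp add: spherical_eq)
qed

section \<open>Convergence of rescaled profiles\<close>

lemma set_integral_le_const:
  fixes f :: "real \<Rightarrow> real"
  assumes "set_integrable lborel {0..t} f" "0 \<le> t" and le: "\<And>s. s \<in> {0..t} \<Longrightarrow> f s \<le> c"
  shows "(LINT s:{0..t}|lborel. f s) \<le> c * t"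
proof -
  have "(LINT s:{0..t}|lborel. f s) \<le> (LINT s:{0..t}|lborel. c)"
    by (rule set_integral_mono[OF assms(1) borel_integrable_atLeastAtMost'[OF continuous_on_const] le])
  also have "\<dots> = c * t"
    using assms(2) by (simp add: set_lebesgue_integral_def)
  finally show ?thesis .
qed

lemma integral_volterra_kernel_0: "(LINT s:{0..0}|lborel. volterra_kernel 0 s * f s) = 0"
proof -
  have "indicator {0..0} s *\<^sub>R (volterra_kernel 0 s * f s) = 0" for s :: real
    by (auto simp: volterra_kernel_def split: split_indicator)
  then show ?thesis unfolding set_lebesgue_integral_def by (simp only: integral_zero)
qed

lemma set_integrable_volterra_kernel:
  assumes [measurable]: "g \<in> borel_measurable borel" and "\<And>s. s \<in> {0..t} \<Longrightarrow> \<bar>g s\<bar> \<le> B"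
  shows "set_integrable lborel {0..t} (\<lambda>s. volterra_kernel t s * g s)"
proof (rule set_integrable_bounded[where B="t ^ 3 / 4 * B"])
  fix s assume s: "s \<in> {0..t}"
  then show "\<bar>volterra_kernel t s * g s\<bar> \<le> t ^ 3 / 4 * B"
    unfolding abs_mult using volterra_kernel_bounds[of s t] assms(2)[OF s] by (intro mult_mono) auto
qed measurable

lemma
  assumes "0 \<le> T"
  shows integrable_radial_inverse_square: "integrable radial_measure (\<lambda>s. indicator {0..T} s / s\<^sup>2)"
    and integral_radial_inverse_square: "(\<integral>s. indicator {0..T} s / s\<^sup>2 \<partial>radial_measure) = T\<^sup>2 / 2"
proof -
  have eq: "indicator {0<..} s * s ^ 3 * (indicator {0..T} s / s\<^sup>2) = indicator {0..T} s *\<^sub>R s" for s :: real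
    by (auto simp: power2_eq_square power3_eq_cube split: split_indicator)
  show "integrable radial_measure (\<lambda>s. indicator {0..T} s / s\<^sup>2)"
    using borel_integrable_atLeastAtMost'[of 0 T "\<lambda>s. s"]
    by (subst integrable_radial_measure_iff) (auto simp only: eq set_integrable_def continuous_on_id, auto)
  have "(\<integral>s. indicator {0..T} s / s\<^sup>2 \<partial>radial_measure) = (\<integral>s. indicator {0..T} s *\<^sub>R s \<partial>lborel)"
    by (subst integral_radial_measure) (simp_all only: eq, measurable)
  also have "\<dots> = T\<^sup>2 / 2 - 0\<^sup>2 / 2"
    using assms by (intro integral_FTC_atLeastAtMost)
      (auto intro!: derivative_eq_intros continuous_intros simp flip: has_real_derivative_iff_has_vector_derivative)
  finally show "(\<integral>s. indicator {0..T} s / s\<^sup>2 \<partial>radial_measure) = T\<^sup>2 / 2" by simp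
qed

text \<open>The integrand of \<open>b\<close> for the spherical solution, with the density
  \<open>s ^ 3\<close> reduced by \<open>1 / s\<^sup>2\<close>. The antiderivative vanishes at 0 and
  tends to 8/3, which \<open>3 / 8\<close> normalises to 1.\<close>

lemma DERIV_spherical_mass:
  "((\<lambda>s. 8 / 3 * (1 - (1 / (1 + s\<^sup>2)) ^ 3)) has_real_derivative s * exp (4 * spherical s)) (at s)"
proof -
  have "((\<lambda>s. 8 / 3 * (1 - (1 / (1 + s\<^sup>2)) ^ 3)) has_real_derivative
      8 / 3 * (0 - 3 * (- 2 * s * (1 / (1 + s\<^sup>2))\<^sup>2 * (1 / (1 + s\<^sup>2)) ^ 2))) (at s)"
    by (rule derivative_eq_intros DERIV_inverse_one_plus_square refl | simp)+
  moreover have "8 / 3 * (0 - 3 * (- 2 * s * (i\<^sup>2 * i ^ 2))) = s * (16 * i ^ 4)" for i :: real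
    by (simp add: power2_eq_square power4_eq_xxxx)
  ultimately show ?thesis
    unfolding exp_spherical by (simp only: mult.assoc)
qed

lemma continuous_spherical: "continuous_on A (\<lambda>s. s * exp (4 * spherical s))"
proof -
  have "1 + s\<^sup>2 \<noteq> 0" for s :: real by (simp add: add_nonneg_eq_0_iff)
  then show ?thesis unfolding spherical_eq by (intro continuous_intros) auto
qed

lemma integral_radial_spherical_atMost:
  assumes "0 \<le> T"
  shows "(\<integral>s. indicator {0..T} s * (exp (4 * spherical s) / s\<^sup>2) \<partial>radial_measure) = 8 / 3 * (1 - (1 / (1 + T\<^sup>2)) ^ 3)"
proof -
  have eq: "indicator {0<..} s * s ^ 3 * (indicator {0..T} s * (exp (4 * spherical s) / s\<^sup>2)) = indicator {0..T} s *\<^sub>R (s * exp (4 * spherical s))" for s :: real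
    by (auto simp: power2_eq_square power3_eq_cube split: split_indicator)
  have "(\<integral>s. indicator {0..T} s * (exp (4 * spherical s) / s\<^sup>2) \<partial>radial_measure) = (\<integral>s. indicator {0..T} s *\<^sub>R (s * exp (4 * spherical s)) \<partial>lborel)"
    by (subst integral_radial_measure) (simp_all only: eq, measurable)
  also have "\<dots> = 8 / 3 * (1 - (1 / (1 + T\<^sup>2)) ^ 3) - 8 / 3 * (1 - (1 / (1 + 0\<^sup>2)) ^ 3)"
    using assms DERIV_spherical_mass continuous_spherical
    by (intro integral_FTC_atLeastAtMost) (auto simp: has_real_derivative_iff_has_vector_derivative has_vector_derivative_at_within)
  finally show ?thesis by simp
qed

lemma
  shows integrable_radial_spherical: "integrable radial_measure (\<lambda>s. exp (4 * spherical s) / s\<^sup>2)"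
    and integral_radial_spherical: "(\<integral>s. exp (4 * spherical s) / s\<^sup>2 \<partial>radial_measure) = 8 / 3"
proof -
  have eq: "indicator {0<..} s * s ^ 3 * (exp (4 * spherical s) / s\<^sup>2) = s * exp (4 * spherical s) * indicator {0..} s" for s :: real
    by (auto simp: power2_eq_square power3_eq_cube split: split_indicator)
  have "(\<integral>\<^sup>+s. ennreal (s * exp (4 * spherical s)) * indicator {0..} s \<partial>lborel) = ennreal (8 / 3 - 8 / 3 * (1 - (1 / (1 + 0\<^sup>2)) ^ 3))"
  proof (rule nn_integral_FTC_atLeast)
    show "((\<lambda>s::real. 8 / 3 * (1 - (1 / (1 + s\<^sup>2)) ^ 3)) \<longlongrightarrow> 8 / 3) at_top" by real_asymp
    show "((\<lambda>s. 8 / 3 * (1 - (1 / (1 + s\<^sup>2)) ^ 3)) has_real_derivative s * exp (4 * spherical s)) (at s)" for s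
      by (rule DERIV_spherical_mass)
  qed auto
  then have nn: "(\<integral>\<^sup>+s. ennreal (s * exp (4 * spherical s) * indicator {0..} s) \<partial>lborel) = ennreal (8 / 3)"
    by (simp add: ennreal_mult'' ennreal_indicator)
  have int: "integrable lborel (\<lambda>s. s * exp (4 * spherical s) * indicator {0..} s)"
    by (rule integrableI_nn_integral_finite[OF _ _ nn]) (auto split: split_indicator)
  then show "integrable radial_measure (\<lambda>s. exp (4 * spherical s) / s\<^sup>2)"
    by (subst integrable_radial_measure_iff) (simp_all only: eq, measurable)
  have "(\<integral>s. exp (4 * spherical s) / s\<^sup>2 \<partial>radial_measure) = (\<integral>s. s * exp (4 * spherical s) * indicator {0..} s \<partial>lborel)"
    by (subst integral_radial_measure) (simp_all only: eq, measurable)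
  also have "\<dots> = 8 / 3"
    by (subst integral_eq_nn_integral) (auto simp: nn split: split_indicator)
  finally show "(\<integral>s. exp (4 * spherical s) / s\<^sup>2 \<partial>radial_measure) = 8 / 3" .
qed

section \<open>Estimates for one rescaled profile\<close>

text \<open>The parameter \<open>q\<close> stands for the power \<open>R powr p\<close> of the
  scaling radius. All estimates below are explicit in \<open>q\<close>, in \<open>b\<close> and in
  the weighted mass \<open>\<integral> s powr p * exp (4 * v s)\<close>, so a limit can be taken
  without compactness.\<close>

locale rescaled_profile =
  fixes p q :: real and v K :: "real \<Rightarrow> real"
  assumes p_pos: "0 < p" and q_nonneg: "0 \<le> q"
    and v_borel [measurable]: "v \<in> borel_measurable borel"
    and v_0: "v 0 = ln 2"
    and v_le: "\<And>t. 0 \<le> t \<Longrightarrow> v t \<le> ln 2"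
    and K_eq: "\<And>s. K s = (1 - q * s powr p) * exp (4 * v s)"
    and exp_int: "integrable radial_measure (\<lambda>s. exp (4 * v s))"
    and powr_exp_int: "integrable radial_measure (\<lambda>s. s powr p * exp (4 * v s))"
    and GK_int: "\<And>t. 0 < t \<Longrightarrow> integrable radial_measure (\<lambda>s. radial_kernel t s * K s)"
    and v_eq: "\<And>t. 0 < t \<Longrightarrow> v t = ln 2 + 3 / 2 * (\<integral>s. radial_kernel t s * K s \<partial>radial_measure)"
begin

lemma K_borel [measurable]: "K \<in> borel_measurable borel"
  unfolding K_eq[abs_def] by measurable

lemma K_int: "integrable radial_measure K"
proof -
  have eq: "K = (\<lambda>s. exp (4 * v s) - q * (s powr p * exp (4 * v s)))"
    by (simp add: K_eq fun_eq_iff algebra_simps)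
  show ?thesis
    unfolding eq by (intro Bochner_Integration.integrable_diff integrable_mult_right exp_int powr_exp_int)
qed

lemma K_le: "0 \<le> s \<Longrightarrow> K s \<le> exp (4 * v s)"
  using q_nonneg by (simp add: K_eq mult_left_le_one_le algebra_simps)

lemma K_ge: "s \<in> {0..T} \<Longrightarrow> exp (4 * v s) - 16 * q * T powr p \<le> K s"
proof -
  assume s: "s \<in> {0..T}"
  have "(q * s powr p) * exp (4 * v s) \<le> (q * T powr p) * 16"
    using s q_nonneg p_pos exp_4_le[OF v_le, of s] by (intro mult_mono mult_left_mono powr_mono2) auto
  then show ?thesis by (simp add: K_eq algebra_simps)
qed

lemma K_bound: "s \<in> {0..T} \<Longrightarrow> \<bar>K s\<bar> \<le> 16 + 16 * q * T powr p"
proof -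
  assume s: "s \<in> {0..T}"
  have "K s \<le> 16" using K_le[of s] exp_4_le[OF v_le, of s] s by simp
  moreover have "- (16 * q * T powr p) \<le> K s"
    using K_ge[OF s] exp_gt_zero[of "4 * v s"] by linarith
  moreover have "0 \<le> 16 * q * T powr p" using q_nonneg by simp
  ultimately show ?thesis by linarith
qed

text \<open>Near 0 the function \<open>K\<close> is bounded and the density reduces to
  \<open>s\<close>; beyond 1 the quotient is dominated by \<open>\<bar>K s\<bar>\<close>.\<close>

lemma K_square_int: "integrable radial_measure (\<lambda>s. K s / s\<^sup>2)"
proof (rule Bochner_Integration.integrable_bound)
  show "integrable radial_measure (\<lambda>s. (16 + 16 * q) * (indicator {0..1} s / s\<^sup>2) + \<bar>K s\<bar>)"
    by (intro Bochner_Integration.integrable_add integrable_mult_right integrable_abs K_int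
        integrable_radial_inverse_square) simp
  show "AE s in radial_measure. norm (K s / s\<^sup>2) \<le> norm ((16 + 16 * q) * (indicator {0..1} s / s\<^sup>2) + \<bar>K s\<bar>)"
    using AE_radial_measure_pos
  proof eventually_elim
    case (elim s)
    show ?case
    proof (cases "s \<le> 1")
      case True
      then have "\<bar>K s\<bar> / s\<^sup>2 \<le> (16 + 16 * q) / s\<^sup>2"
        using K_bound[of s 1] elim by (intro divide_right_mono) auto
      then show ?thesis using True elim q_nonneg by simp
    next
      case False
      then have "1 \<le> s\<^sup>2" by (simp add: one_le_power)
      then have "\<bar>K s\<bar> / s\<^sup>2 \<le> \<bar>K s\<bar> / 1" by (intro frac_le) auto
      then show ?thesis using False by simp
    qed
  qed
qed measurable

definition b :: real where
  "b = 3 / 8 * (\<integral>s. K s / s\<^sup>2 \<partial>radial_measure)"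

text \<open>Adding and subtracting \<open>t\<^sup>2 / (4 * s\<^sup>2)\<close> in the kernel: the
  added part cuts the integral off at \<open>t\<close>, the subtracted part is
  \<open>- b * t\<^sup>2\<close> because \<open>3 / 2 * (1 / 4) = 3 / 8\<close>.\<close>

lemma volterra:
  assumes "0 \<le> t"
  shows "v t = ln 2 - b * t\<^sup>2 + 3 / 2 * (LINT s:{0..t}|lborel. volterra_kernel t s * K s)"
proof (cases "t = 0")
  case True
  then show ?thesis using v_0 integral_volterra_kernel_0[of K] by simp
next
  case False
  then have t: "0 < t" using assms by simp
  have "(\<integral>s. radial_kernel t s * K s + t\<^sup>2 / 4 * (K s / s\<^sup>2) \<partial>radial_measure) =
      (\<integral>s. indicator {0<..} s * s ^ 3 * (radial_kernel t s * K s + t\<^sup>2 / 4 * (K s / s\<^sup>2)) \<partial>lborel)"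
    by (rule integral_radial_measure) measurable
  also have "(\<lambda>s. indicator {0<..} s * s ^ 3 * (radial_kernel t s * K s + t\<^sup>2 / 4 * (K s / s\<^sup>2))) =
      (\<lambda>s. indicator {0..t} s *\<^sub>R (volterra_kernel t s * K s))"
  proof
    fix s :: real
    have "s ^ 3 * (radial_kernel t s * K s + t\<^sup>2 / 4 * (K s / s\<^sup>2)) = volterra_kernel t s * K s"
      by (simp add: volterra_kernel_def algebra_simps)
    moreover have "volterra_kernel t s = 0" if "s = 0 \<or> t \<le> s"
      using that volterra_kernel_eq_0[OF t] by (auto simp: volterra_kernel_def)
    ultimately show "indicator {0<..} s * s ^ 3 * (radial_kernel t s * K s + t\<^sup>2 / 4 * (K s / s\<^sup>2)) = indicator {0..t} s *\<^sub>R (volterra_kernel t s * K s)"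
      by (cases "0 < s"; cases "s \<le> t") (auto simp: mult.assoc not_less split: split_indicator)
  qed
  finally have "(\<integral>s. radial_kernel t s * K s \<partial>radial_measure) + t\<^sup>2 / 4 * (\<integral>s. K s / s\<^sup>2 \<partial>radial_measure) = (LINT s:{0..t}|lborel. volterra_kernel t s * K s)"
    by (simp only: Bochner_Integration.integral_add[OF GK_int[OF t] integrable_mult_right[OF K_square_int]]
        integral_mult_right_zero set_lebesgue_integral_def)
  then have "(\<integral>s. radial_kernel t s * K s \<partial>radial_measure) = (LINT s:{0..t}|lborel. volterra_kernel t s * K s) - 2 / 3 * b * t\<^sup>2"
    by (simp add: b_def algebra_simps)
  then show ?thesis using v_eq[OF t] by (simp add: algebra_simps)
qed

lemma volterra_kernel_K_int: "set_integrable lborel {0..t} (\<lambda>s. volterra_kernel t s * K s)"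
  by (rule set_integrable_volterra_kernel[OF K_borel K_bound])

lemma volterra_kernel_exp_int: "set_integrable lborel {0..t} (\<lambda>s. volterra_kernel t s * exp (4 * v s))"
  by (rule set_integrable_volterra_kernel[where B=16]) (use exp_4_le[OF v_le] in auto)

lemma volterra_kernel_spherical_int: "set_integrable lborel {0..t} (\<lambda>s. volterra_kernel t s * exp (4 * spherical s))"
  by (rule set_integrable_volterra_kernel[where B=16]) (use exp_4_le[OF spherical_le] in auto)

text \<open>A crude bound, merely to supply the constant \<open>B\<close> of
  \<open>volterra_comparison\<close> when \<open>v\<close> is the lower function.\<close>

lemma v_lower: "\<exists>B. \<forall>t\<in>{0..T}. - B \<le> v t"
proof (intro exI ballI)
  fix t assume t: "t \<in> {0..T}"
  define c where "c = T ^ 3 / 4 * (16 + 16 * q * T powr p)"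
  have "(LINT s:{0..t}|lborel. - (volterra_kernel t s * K s)) \<le> c * t"
  proof (rule set_integral_le_const)
    show "set_integrable lborel {0..t} (\<lambda>s. - (volterra_kernel t s * K s))"
      using volterra_kernel_K_int[of t] by (simp add: set_integrable_def)
    fix s assume s: "s \<in> {0..t}"
    have t3: "t ^ 3 \<le> T ^ 3" using t by (intro power_mono) auto
    have "\<bar>volterra_kernel t s\<bar> \<le> T ^ 3 / 4" using volterra_kernel_bounds[of s t] s t3 by simp
    then have "\<bar>volterra_kernel t s * K s\<bar> \<le> c"
      unfolding abs_mult c_def using s t K_bound[of s T] by (intro mult_mono) auto
    then show "- (volterra_kernel t s * K s) \<le> c" by linarith
  qed (use t in auto)
  also have "c * t \<le> c * T" using t q_nonneg by (intro mult_left_mono) (auto simp: c_def)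
  finally have "- (c * T) \<le> (LINT s:{0..t}|lborel. volterra_kernel t s * K s)"
    by (simp add: set_lebesgue_integral_def)
  moreover have "b * t\<^sup>2 \<le> \<bar>b\<bar> * T\<^sup>2" using t by (intro mult_mono power_mono) auto
  moreover have "0 \<le> ln (2 :: real)" by simp
  ultimately show "- (\<bar>b\<bar> * T\<^sup>2 + 3 / 2 * (c * T)) \<le> v t"
    using volterra[of t] t unfolding atLeastAtMost_iff by linarith
qed

text \<open>Discarding the term with \<open>q\<close> enlarges \<open>K\<close>, so the only error
  against the equation of \<open>spherical\<close> is \<open>(1 - b) * t\<^sup>2\<close>. The form
  with a free \<open>\<epsilon>\<close> covers \<open>b > 1\<close>, with
  \<open>\<epsilon> = 0\<close>, as well as \<open>b \<le> 1\<close>.\<close>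

lemma upper:
  assumes "0 < T" "0 \<le> \<epsilon>" and \<epsilon>: "(1 - b) * T\<^sup>2 \<le> \<epsilon>" and t: "t \<in> {0..T}"
  shows "v t - spherical t \<le> 2 * \<epsilon> * exp (48 * T ^ 4)"
proof (rule volterra_comparison[OF _ _ _ _ spherical_ge \<open>0 < T\<close> \<open>0 \<le> \<epsilon>\<close> _ t])
  fix t assume t: "t \<in> {0..T}"
  have "(LINT s:{0..t}|lborel. volterra_kernel t s * K s) - (LINT s:{0..t}|lborel. volterra_kernel t s * exp (4 * spherical s)) \<le>
      (LINT s:{0..t}|lborel. volterra_kernel t s * (exp (4 * v s) - exp (4 * spherical s)))"
  proof -
    have "(LINT s:{0..t}|lborel. volterra_kernel t s * K s) \<le> (LINT s:{0..t}|lborel. volterra_kernel t s * exp (4 * v s))"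
      using t by (intro set_integral_mono volterra_kernel_K_int volterra_kernel_exp_int mult_left_mono K_le volterra_kernel_bounds) auto
    then show ?thesis
      using volterra_kernel_exp_int[of t] volterra_kernel_spherical_int[of t] by (simp add: right_diff_distrib)
  qed
  moreover have "(1 - b) * t\<^sup>2 \<le> \<epsilon>"
  proof (cases "b \<le> 1")
    case True
    have "(1 - b) * t\<^sup>2 \<le> (1 - b) * T\<^sup>2" using t True by (intro mult_left_mono power_mono) auto
    then show ?thesis using \<epsilon> by simp
  next
    case False
    then have "(1 - b) * t\<^sup>2 \<le> 0" by (intro mult_nonpos_nonneg) auto
    then show ?thesis using \<open>0 \<le> \<epsilon>\<close> by simp
  qed
  ultimately show "v t - spherical t \<le> \<epsilon> + 3 / 2 * (LINT s:{0..t}|lborel. volterra_kernel t s * (exp (4 * v s) - exp (4 * spherical s)))"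
    using volterra[of t] spherical_volterra[of t] t by (simp add: algebra_simps)
qed (use v_le spherical_le in auto)

text \<open>If \<open>b > 1\<close>, the comparison principle gives \<open>v \<le> spherical\<close> everywhere, and then \<open>b\<close> is at most
  the corresponding coefficient of \<open>spherical\<close>, which is 1.\<close>

lemma b_le_1: "b \<le> 1"
proof (rule ccontr)
  assume "\<not> b \<le> 1"
  have le: "v t \<le> spherical t" if "0 \<le> t" for t
  proof -
    \<comment> \<open>The horizon \<open>t + 1\<close> is positive even for \<open>t = 0\<close>,
      and with \<open>b > 1\<close> the error term may be taken to be 0.\<close>
    have "v t - spherical t \<le> 2 * 0 * exp (48 * (t + 1) ^ 4)"
      using that \<open>\<not> b \<le> 1\<close> by (intro upper) (auto intro: mult_nonpos_nonneg)
    then show ?thesis by simp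
  qed
  have "(\<integral>s. K s / s\<^sup>2 \<partial>radial_measure) \<le> (\<integral>s. exp (4 * spherical s) / s\<^sup>2 \<partial>radial_measure)"
  proof (rule integral_mono_AE[OF K_square_int integrable_radial_spherical])
    show "AE s in radial_measure. K s / s\<^sup>2 \<le> exp (4 * spherical s) / s\<^sup>2"
      using AE_radial_measure_pos
    proof eventually_elim
      case (elim s)
      then have "K s \<le> exp (4 * spherical s)"
        using K_le[of s] le[of s] by (intro order_trans[OF K_le]) auto
      then show ?case by (intro divide_right_mono) auto
    qed
  qed
  then show False using \<open>\<not> b \<le> 1\<close> by (simp add: b_def integral_radial_spherical)
qed

text \<open>As \<open>b \<le> 1\<close>, the quadratic term now has the favourable sign. The
  remaining error is the \<open>q\<close> part of \<open>K\<close>, at most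
  \<open>16 * q * T powr p\<close>, times the kernel bound \<open>T ^ 3 / 4\<close>, the length
  \<open>T\<close> and the factor 3/2.\<close>

lemma lower:
  assumes "0 < T" and t: "t \<in> {0..T}"
  shows "spherical t - v t \<le> 2 * (6 * q * T ^ 4 * T powr p) * exp (48 * T ^ 4)"
proof -
  obtain B where B: "\<And>t. t \<in> {0..T} \<Longrightarrow> - B \<le> v t" using v_lower by blast
  show ?thesis
  proof (rule volterra_comparison[OF _ _ _ _ B \<open>0 < T\<close> _ _ t])
    show "0 \<le> 6 * q * T ^ 4 * T powr p" using q_nonneg \<open>0 < T\<close> by simp
    fix t assume t: "t \<in> {0..T}"
    define c where "c = 16 * q * T powr p"
    have "0 \<le> c" using q_nonneg by (simp add: c_def)
    have i1: "set_integrable lborel {0..t} (\<lambda>s. volterra_kernel t s * exp (4 * v s) - volterra_kernel t s * K s)"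
      using volterra_kernel_K_int volterra_kernel_exp_int by (rule set_integral_diff(1)[rotated])
    have "(LINT s:{0..t}|lborel. volterra_kernel t s * exp (4 * v s) - volterra_kernel t s * K s) \<le> (T ^ 3 / 4 * c) * t"
    proof (rule set_integral_le_const[OF i1])
      fix s assume s: "s \<in> {0..t}"
      have t3: "t ^ 3 \<le> T ^ 3" using t by (intro power_mono) auto
      have "exp (4 * v s) - K s \<le> c" using K_ge[of s T] s t by (simp add: c_def)
      then have "volterra_kernel t s * (exp (4 * v s) - K s) \<le> volterra_kernel t s * c"
        using volterra_kernel_bounds[of s t] s by (intro mult_left_mono) auto
      also have "\<dots> \<le> (T ^ 3 / 4) * c"
        using volterra_kernel_bounds[of s t] s t3 \<open>0 \<le> c\<close> by (intro mult_right_mono) auto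
      finally show "volterra_kernel t s * exp (4 * v s) - volterra_kernel t s * K s \<le> T ^ 3 / 4 * c"
        by (simp add: algebra_simps)
    qed (use t in auto)
    also have "\<dots> \<le> (T ^ 3 / 4 * c) * T"
      using t \<open>0 \<le> c\<close> \<open>0 < T\<close> by (intro mult_left_mono) auto
    finally have "(LINT s:{0..t}|lborel. volterra_kernel t s * exp (4 * v s)) - (LINT s:{0..t}|lborel. volterra_kernel t s * K s) \<le> T ^ 3 / 4 * c * T"
      using set_integral_diff(2)[OF volterra_kernel_exp_int[of t] volterra_kernel_K_int[of t]] by simp
    moreover have "3 / 2 * (T ^ 3 / 4 * c * T) = 6 * q * T ^ 4 * T powr p"
      by (simp add: c_def power3_eq_cube power4_eq_xxxx)
    moreover have "(LINT s:{0..t}|lborel. volterra_kernel t s * (exp (4 * spherical s) - exp (4 * v s))) =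
        (LINT s:{0..t}|lborel. volterra_kernel t s * exp (4 * spherical s)) - (LINT s:{0..t}|lborel. volterra_kernel t s * exp (4 * v s))"
      using volterra_kernel_exp_int[of t] volterra_kernel_spherical_int[of t] by (simp add: right_diff_distrib)
    moreover have "b * t\<^sup>2 \<le> 1 * t\<^sup>2" using b_le_1 by (intro mult_right_mono) auto
    ultimately show "spherical t - v t \<le> 6 * q * T ^ 4 * T powr p + 3 / 2 * (LINT s:{0..t}|lborel. volterra_kernel t s * (exp (4 * spherical s) - exp (4 * v s)))"
      using volterra[of t] spherical_volterra[of t] t by (simp add: algebra_simps)
  qed (use v_le spherical_le in auto)
qed

text \<open>Up to \<open>T\<close>, \<open>lower\<close> bounds \<open>exp (4 * v s)\<close> below
  by \<open>(1 - 4 * \<delta>) * exp (4 * spherical s)\<close>. Beyond \<open>T\<close> only the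
  negative part of \<open>K\<close> matters, and there
  \<open>1 / s\<^sup>2 \<le> 1 / T\<^sup>2\<close>, so it is controlled by the weighted
  mass.\<close>

lemma b_ge:
  assumes "0 < T"
  defines "\<delta> \<equiv> 2 * (6 * q * T ^ 4 * T powr p) * exp (48 * T ^ 4)"
  shows "(1 - 4 * \<delta>) * (1 - (1 / (1 + T\<^sup>2)) ^ 3) - 3 * q * T powr p * T\<^sup>2
      - 3 / (8 * T\<^sup>2) * (q * (\<integral>s. s powr p * exp (4 * v s) \<partial>radial_measure)) \<le> b"
proof -
  let ?g = "\<lambda>s. (1 - 4 * \<delta>) * (indicator {0..T} s * (exp (4 * spherical s) / s\<^sup>2)) - 16 * q * T powr p * (indicator {0..T} s / s\<^sup>2)
      - q / T\<^sup>2 * (s powr p * exp (4 * v s))"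
  have i1: "integrable radial_measure (\<lambda>s. indicator {0..T} s * (exp (4 * spherical s) / s\<^sup>2))"
    using integrable_mult_indicator[OF _ integrable_radial_spherical, of "{0..T}"] by simp
  have i2: "integrable radial_measure (\<lambda>s. indicator {0..T} s / s\<^sup>2)"
    using assms by (intro integrable_radial_inverse_square) simp
  have "(\<integral>s. ?g s \<partial>radial_measure) \<le> (\<integral>s. K s / s\<^sup>2 \<partial>radial_measure)"
  proof (rule integral_mono_AE)
    show "integrable radial_measure ?g"
      by (intro Bochner_Integration.integrable_diff integrable_mult_right i1 i2 powr_exp_int)
    show "AE s in radial_measure. ?g s \<le> K s / s\<^sup>2"
      using AE_radial_measure_pos
    proof eventually_elim
      case (elim s)
      show ?case
      proof (cases "s \<le> T")
        case True
        have "(1 - 4 * \<delta>) * exp (4 * spherical s) \<le> exp (- 4 * \<delta>) * exp (4 * spherical s)"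
          using exp_ge_add_one_self[of "- 4 * \<delta>"] by (intro mult_right_mono) auto
        also have "\<dots> \<le> exp (4 * v s)"
          using lower[OF \<open>0 < T\<close>, of s] True elim by (simp add: \<delta>_def exp_add[symmetric])
        finally have "(1 - 4 * \<delta>) * exp (4 * spherical s) - 16 * q * T powr p \<le> K s"
          using K_ge[of s T] True elim by simp
        then have "((1 - 4 * \<delta>) * exp (4 * spherical s) - 16 * q * T powr p) / s\<^sup>2 \<le> K s / s\<^sup>2"
          by (intro divide_right_mono) auto
        moreover have "0 \<le> q / T\<^sup>2 * (s powr p * exp (4 * v s))" using q_nonneg by simp
        ultimately show ?thesis using True elim by (simp add: diff_divide_distrib)
      next
        case False
        have "- (q * (s powr p * exp (4 * v s))) \<le> K s"
          by (simp add: K_eq algebra_simps)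
        then have "- (q * (s powr p * exp (4 * v s))) / s\<^sup>2 \<le> K s / s\<^sup>2"
          by (intro divide_right_mono) auto
        moreover have "q * (s powr p * exp (4 * v s)) / s\<^sup>2 \<le> q * (s powr p * exp (4 * v s)) / T\<^sup>2"
          using False assms q_nonneg by (intro divide_left_mono power_mono mult_nonneg_nonneg) auto
        ultimately show ?thesis using False by simp
      qed
    qed
  qed (rule K_square_int)
  also have "(\<integral>s. ?g s \<partial>radial_measure) = (1 - 4 * \<delta>) * (8 / 3 * (1 - (1 / (1 + T\<^sup>2)) ^ 3)) - 16 * q * T powr p * (T\<^sup>2 / 2)
      - q / T\<^sup>2 * (\<integral>s. s powr p * exp (4 * v s) \<partial>radial_measure)"
    using \<open>0 < T\<close>
    by (simp only: Bochner_Integration.integral_diff[OF Bochner_Integration.integrable_diff[OF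
            integrable_mult_right[OF i1] integrable_mult_right[OF i2]] integrable_mult_right[OF powr_exp_int]]
          Bochner_Integration.integral_diff[OF integrable_mult_right[OF i1] integrable_mult_right[OF i2]]
          integral_mult_right_zero integral_radial_spherical_atMost[OF less_imp_le] integral_radial_inverse_square[OF less_imp_le])
  finally have "3 / 8 * ((1 - 4 * \<delta>) * (8 / 3 * (1 - (1 / (1 + T\<^sup>2)) ^ 3)) - 16 * q * T powr p * (T\<^sup>2 / 2)
      - q / T\<^sup>2 * (\<integral>s. s powr p * exp (4 * v s) \<partial>radial_measure)) \<le> b"
    unfolding b_def by (rule mult_left_mono) simp
  moreover have "3 / 8 * (m * (8 / 3 * j) - 16 * q * P * (T\<^sup>2 / 2) - q / T\<^sup>2 * e)
      = m * j - 3 * q * P * T\<^sup>2 - 3 / (8 * T\<^sup>2) * (q * e)" for m j P e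
    using \<open>0 < T\<close> by (simp add: field_simps)
  ultimately show ?thesis by (simp only:)
qed

end

text \<open>The lower bound on \<open>v\<close> requires only that \<open>q\<close> be small, and by
  \<open>b_ge\<close> it forces \<open>b\<close> up to 1. Since the upper bound is governed by
  \<open>1 - b\<close>, it then closes as well.\<close>

lemma rescaled_profiles_converge:
  assumes prof: "\<And>k. rescaled_profile p (q k) (v k) (K k)"
    and q: "q \<longlonglongrightarrow> 0"
    and e: "(\<lambda>k. q k * (\<integral>s. s powr p * exp (4 * v k s) \<partial>radial_measure)) \<longlonglongrightarrow> 0"
    and "0 < T" "0 < \<epsilon>"
  shows "\<forall>\<^sub>F k in sequentially. \<forall>t\<in>{0..T}. \<bar>v k t - spherical t\<bar> < \<epsilon>"
proof -
  define b where "b k = rescaled_profile.b (K k)" for k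
  have b_lim: "b \<longlonglongrightarrow> 1"
  proof (rule order_tendstoI)
    fix a :: real assume "1 < a"
    then show "\<forall>\<^sub>F k in sequentially. b k < a"
      unfolding b_def using rescaled_profile.b_le_1[OF prof] by (intro always_eventually allI) (auto intro: le_less_trans)
  next
    fix a :: real assume "a < 1"
    have "((\<lambda>T::real. 1 - (1 / (1 + T\<^sup>2)) ^ 3) \<longlongrightarrow> 1) at_top" by real_asymp
    then have "\<forall>\<^sub>F T in at_top. a < 1 - (1 / (1 + T\<^sup>2)) ^ 3"
      using \<open>a < 1\<close> by (rule order_tendstoD)
    \<comment> \<open>The horizon for \<open>b\<close> is fixed before \<open>k\<close> grows, and
      is independent of the \<open>T\<close> of the claim; the \<open>q\<close>-dependent terms of
      \<open>b_ge\<close> then vanish in the limit.\<close>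
    then obtain S where S: "0 < S" "a < 1 - (1 / (1 + S\<^sup>2)) ^ 3"
      using eventually_conj[OF _ eventually_gt_at_top[of 0]] eventually_happens'[OF trivial_limit_at_top_linorder] by (metis (mono_tags, lifting))
    let ?l = "\<lambda>q e. (1 - 4 * (2 * (6 * q * S ^ 4 * S powr p) * exp (48 * S ^ 4))) * (1 - (1 / (1 + S\<^sup>2)) ^ 3) - 3 * q * S powr p * S\<^sup>2
      - 3 / (8 * S\<^sup>2) * e"
    have "(\<lambda>k. ?l (q k) (q k * (\<integral>s. s powr p * exp (4 * v k s) \<partial>radial_measure))) \<longlonglongrightarrow> ?l 0 0"
      by (intro tendsto_intros q e)
    then have "\<forall>\<^sub>F k in sequentially. a < ?l (q k) (q k * (\<integral>s. s powr p * exp (4 * v k s) \<partial>radial_measure))"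
      by (rule order_tendstoD) (use S in simp)
    then show "\<forall>\<^sub>F k in sequentially. a < b k"
    proof eventually_elim
      case (elim k)
      then show ?case
        using rescaled_profile.b_ge[OF prof[of k] S(1)] unfolding b_def by linarith
    qed
  qed
  have "(\<lambda>k. 2 * (6 * q k * T ^ 4 * T powr p) * exp (48 * T ^ 4)) \<longlonglongrightarrow> 2 * (6 * 0 * T ^ 4 * T powr p) * exp (48 * T ^ 4)"
    by (intro tendsto_intros q)
  then have "\<forall>\<^sub>F k in sequentially. 2 * (6 * q k * T ^ 4 * T powr p) * exp (48 * T ^ 4) < \<epsilon>"
    by (rule order_tendstoD) (use \<open>0 < \<epsilon>\<close> in simp)
  moreover have "(\<lambda>k. 2 * ((1 - b k) * T\<^sup>2) * exp (48 * T ^ 4)) \<longlonglongrightarrow> 2 * ((1 - 1) * T\<^sup>2) * exp (48 * T ^ 4)"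
    by (intro tendsto_intros b_lim)
  then have "\<forall>\<^sub>F k in sequentially. 2 * ((1 - b k) * T\<^sup>2) * exp (48 * T ^ 4) < \<epsilon>"
    by (rule order_tendstoD) (use \<open>0 < \<epsilon>\<close> in simp)
  ultimately show ?thesis
  proof eventually_elim
    case (elim k)
    show ?case
    proof
      fix t assume t: "t \<in> {0..T}"
      have "spherical t - v k t < \<epsilon>"
        using rescaled_profile.lower[OF prof[of k] \<open>0 < T\<close> t] elim(1) by linarith
      moreover have "v k t - spherical t \<le> 2 * ((1 - b k) * T\<^sup>2) * exp (48 * T ^ 4)"
        using rescaled_profile.b_le_1[OF prof[of k]] unfolding b_def
        by (intro rescaled_profile.upper[OF prof[of k] \<open>0 < T\<close> _ _ t]) auto
      ultimately show "\<bar>v k t - spherical t\<bar> < \<epsilon>" using elim(2) by linarith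
    qed
  qed
qed

section \<open>Concentration and convergence\<close>

lemma
  fixes g :: "real \<Rightarrow> real"
  assumes [measurable]: "g \<in> borel_measurable borel" and "0 < R"
  shows integrable_radial_scale: "integrable radial_measure (\<lambda>s. g (R * s)) \<longleftrightarrow> integrable radial_measure g"
    and integral_radial_scale: "(\<integral>s. g (R * s) \<partial>radial_measure) = (\<integral>s. g s \<partial>radial_measure) / R ^ 4"
proof -
  let ?h = "\<lambda>s. indicator {0<..} s * s ^ 3 * g s"
  have h: "?h (0 + R * s) = R ^ 3 * (indicator {0<..} s * s ^ 3 * g (R * s))" for s
    using \<open>0 < R\<close> by (auto simp: power_mult_distrib zero_less_mult_iff split: split_indicator)
  have "integrable lborel (\<lambda>s. ?h (0 + R * s)) \<longleftrightarrow> integrable lborel ?h"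
    by (rule lborel_integrable_real_affine_iff) (use \<open>0 < R\<close> in simp)
  then show "integrable radial_measure (\<lambda>s. g (R * s)) \<longleftrightarrow> integrable radial_measure g"
    using \<open>0 < R\<close> unfolding h by (simp add: integrable_radial_measure_iff)
  have "(\<integral>s. ?h s \<partial>lborel) = \<bar>R\<bar> *\<^sub>R (\<integral>s. ?h (0 + R * s) \<partial>lborel)"
    by (rule lborel_integral_real_affine) (use \<open>0 < R\<close> in simp)
  also have "\<dots> = R ^ 4 * (\<integral>s. indicator {0<..} s * s ^ 3 * g (R * s) \<partial>lborel)"
    using \<open>0 < R\<close> unfolding h by (simp add: power3_eq_cube power4_eq_xxxx)
  finally show "(\<integral>s. g (R * s) \<partial>radial_measure) = (\<integral>s. g s \<partial>radial_measure) / R ^ 4"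
    using \<open>0 < R\<close> by (simp add: integral_radial_measure field_simps)
qed

lemma radial_kernel_scale: "0 < R \<Longrightarrow> 0 < t \<Longrightarrow> radial_kernel (R * t) (R * s) = radial_kernel t s"
  by (simp add: radial_kernel_eq_kernel_shape)

lemma integral_radial_indicator:
  assumes "0 \<le> S"
  shows "(\<integral>s. indicator {0..S} s \<partial>radial_measure) = S ^ 4 / 4"
proof -
  have eq: "indicator {0<..} s * s ^ 3 * indicator {0..S} s = indicator {0..S} s *\<^sub>R s ^ 3" for s :: real
    by (auto split: split_indicator)
  have "(\<integral>s. indicator {0..S} s \<partial>radial_measure) = (\<integral>s. indicator {0..S} s *\<^sub>R s ^ 3 \<partial>lborel)"
    by (subst integral_radial_measure) (simp_all only: eq, measurable)
  also have "\<dots> = S ^ 4 / 4 - 0 ^ 4 / 4"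
    using assms by (intro integral_FTC_atLeastAtMost)
      (auto intro!: derivative_eq_intros continuous_intros simp flip: has_real_derivative_iff_has_vector_derivative)
  finally show ?thesis by simp
qed

context profile
begin

lemma exp_rescaled: "exp (4 * (w (R * s) - w 0 + ln 2)) = 16 * exp (- 4 * w 0) * exp (4 * w (R * s))"
proof -
  have "exp (4 * (w (R * s) - w 0 + ln 2)) = exp (4 * w (R * s)) * exp (- 4 * w 0) * exp (4 * ln 2)"
    by (simp add: exp_add[symmetric] algebra_simps)
  also have "exp (4 * ln 2) = (2 :: real) ^ 4" by (subst exp_of_nat_mult[of 4 "ln 2", simplified]) simp
  finally show ?thesis by simp
qed

lemma powr_exp_rescaled:
  assumes "0 < R"
  shows "AE s in radial_measure. R powr p * (s powr p * exp (4 * (w (R * s) - w 0 + ln 2))) =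
    16 * exp (- 4 * w 0) * ((R * s) powr p * exp (4 * w (R * s)))"
  unfolding exp_rescaled using AE_radial_measure_pos
  by eventually_elim (use assms in \<open>simp add: powr_mult\<close>)

lemma powr_exp_rescaled_int:
  assumes "0 < R"
  shows "integrable radial_measure (\<lambda>s. s powr p * exp (4 * (w (R * s) - w 0 + ln 2)))"
proof -
  have "integrable radial_measure (\<lambda>s. (R * s) powr p * exp (4 * w (R * s)))"
    using integrable_radial_scale[of "\<lambda>s. s powr p * exp (4 * w s)" R] powr_exp_int assms by simp
  then have "integrable radial_measure (\<lambda>s. 16 * exp (- 4 * w 0) * ((R * s) powr p * exp (4 * w (R * s))))"
    by (rule integrable_mult_right)
  then have "integrable radial_measure (\<lambda>s. R powr p * (s powr p * exp (4 * (w (R * s) - w 0 + ln 2))))"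
    by (rule integrable_cong_AE_imp) (use powr_exp_rescaled[OF assms] in \<open>auto elim!: eventually_mono\<close>)
  then show ?thesis using assms by simp
qed

text \<open>Scaling costs \<open>R ^ 4\<close>, so the prefactor is 16/96. The quantity to be
  controlled after rescaling is thus one sixth of the one in Pohozaev's identity.\<close>

lemma integral_powr_exp_rescaled:
  assumes "0 < R" "R ^ 4 = 96 * exp (- 4 * w 0)"
  shows "R powr p * (\<integral>s. s powr p * exp (4 * (w (R * s) - w 0 + ln 2)) \<partial>radial_measure) =
    (\<integral>s. s powr p * exp (4 * w s) \<partial>radial_measure) / 6"
proof -
  have "R powr p * (\<integral>s. s powr p * exp (4 * (w (R * s) - w 0 + ln 2)) \<partial>radial_measure) =
    (\<integral>s. R powr p * (s powr p * exp (4 * (w (R * s) - w 0 + ln 2))) \<partial>radial_measure)"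
    by simp
  also have "\<dots> = (\<integral>s. 16 * exp (- 4 * w 0) * ((R * s) powr p * exp (4 * w (R * s))) \<partial>radial_measure)"
    by (rule Bochner_Integration.integral_cong_AE) (use powr_exp_rescaled[OF assms(1)] in auto)
  also have "\<dots> = 16 * exp (- 4 * w 0) * ((\<integral>s. s powr p * exp (4 * w s) \<partial>radial_measure) / R ^ 4)"
    using integral_radial_scale[of "\<lambda>s. s powr p * exp (4 * w s)" R] assms by simp
  also have "\<dots> = (\<integral>s. s powr p * exp (4 * w s) \<partial>radial_measure) / 6"
    unfolding assms(2) by simp
  finally show ?thesis .
qed

text \<open>The kernel is invariant under common scaling of its arguments, and
  \<open>R ^ 4 * exp (4 * w 0) / 16 = 6\<close> turns the factor 1/4 into 3/2. The bound
  \<open>v t \<le> ln 2\<close> is \<open>w_le\<close>.\<close>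

lemma rescaled_profile:
  assumes R: "0 < R" "R ^ 4 = 96 * exp (- 4 * w 0)"
  defines "v \<equiv> \<lambda>t. w (R * t) - w 0 + ln 2"
  shows "rescaled_profile p (R powr p) v (\<lambda>s. (1 - R powr p * s powr p) * exp (4 * v s))"
proof
  let ?K = "\<lambda>s. (1 - R powr p * s powr p) * exp (4 * v s)"
  show "v \<in> borel_measurable borel" unfolding v_def by measurable
  show "v 0 = ln 2" by (simp add: v_def)
  show "v t \<le> ln 2" if "0 \<le> t" for t
    using w_le[of "R * t"] that R by (simp add: v_def)
  have "integrable radial_measure (\<lambda>s. exp (4 * w (R * s)))"
    using integrable_radial_scale[of "\<lambda>s. exp (4 * w s)" R] exp_int R by simp
  then show "integrable radial_measure (\<lambda>s. exp (4 * v s))"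
    unfolding v_def exp_rescaled by (rule integrable_mult_right)
  show "integrable radial_measure (\<lambda>s. s powr p * exp (4 * v s))"
    unfolding v_def by (rule powr_exp_rescaled_int[OF R(1)])
  fix t :: real assume t: "0 < t"
  have ae: "AE s in radial_measure. 16 * exp (- 4 * w 0) * (radial_kernel (R * t) (R * s) * f (R * s)) = radial_kernel t s * ?K s"
    unfolding v_def exp_rescaled using AE_radial_measure_pos
    by eventually_elim (use R t in \<open>simp add: f_eq radial_kernel_scale powr_mult\<close>)
  have "integrable radial_measure (\<lambda>s. radial_kernel (R * t) (R * s) * f (R * s))"
    using integrable_radial_scale[of "\<lambda>s. radial_kernel (R * t) s * f s" R] Gf_int[of "R * t"] R t by simp
  then have int: "integrable radial_measure (\<lambda>s. 16 * exp (- 4 * w 0) * (radial_kernel (R * t) (R * s) * f (R * s)))"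
    by (rule integrable_mult_right)
  have [measurable]: "v \<in> borel_measurable borel" unfolding v_def by measurable
  show "integrable radial_measure (\<lambda>s. radial_kernel t s * ?K s)"
    by (rule integrable_cong_AE_imp[OF int _ ae]) measurable
  have "(\<integral>s. radial_kernel t s * ?K s \<partial>radial_measure) = (\<integral>s. 16 * exp (- 4 * w 0) * (radial_kernel (R * t) (R * s) * f (R * s)) \<partial>radial_measure)"
    by (rule Bochner_Integration.integral_cong_AE) (use ae in auto)
  also have "\<dots> = 16 * exp (- 4 * w 0) * ((\<integral>s. radial_kernel (R * t) s * f s \<partial>radial_measure) / R ^ 4)"
    using integral_radial_scale[of "\<lambda>s. radial_kernel (R * t) s * f s" R] R by simp
  also have "\<dots> = (\<integral>s. radial_kernel (R * t) s * f s \<partial>radial_measure) / 6"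
    unfolding R(2) by simp
  finally show "v t = ln 2 + 3 / 2 * (\<integral>s. radial_kernel t s * ?K s \<partial>radial_measure)"
    using w_eq[of "R * t"] R t by (simp add: v_def)
qed (use p_pos in auto)

text \<open>Inside radius \<open>d\<close> use \<open>w_le\<close>, outside use
  \<open>1 \<le> (s / d) powr p\<close>. When the weighted mass is small but the total is not,
  \<open>exp (4 * w 0) * d ^ 4\<close> must be large; this forces blow-up at the origin.\<close>

lemma total_le:
  assumes "0 < d"
  shows "(\<integral>s. exp (4 * w s) \<partial>radial_measure) \<le>
    exp (4 * w 0) * d ^ 4 / 4 + d powr - p * (\<integral>s. s powr p * exp (4 * w s) \<partial>radial_measure)"
proof -
  let ?g = "\<lambda>s. exp (4 * w 0) * indicator {0..d} s + d powr - p * (s powr p * exp (4 * w s))"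
  have "(\<integral>s. exp (4 * w s) \<partial>radial_measure) \<le> (\<integral>s. ?g s \<partial>radial_measure)"
  proof (rule integral_mono_AE[OF exp_int])
    show "integrable radial_measure ?g"
      by (intro Bochner_Integration.integrable_add integrable_mult_right integrable_radial_measure_indicator powr_exp_int)
    show "AE s in radial_measure. exp (4 * w s) \<le> ?g s"
      using AE_radial_measure_pos
    proof eventually_elim
      case (elim s)
      show ?case
      proof (cases "s \<le> d")
        case True
        then show ?thesis using w_le[of s] elim by (simp add: add_increasing2)
      next
        case False
        have "d powr p \<le> s powr p" using False assms p_pos by (intro powr_mono2) auto
        then have "1 \<le> d powr - p * s powr p"
          using assms by (simp add: powr_minus field_simps)
        then have "1 * exp (4 * w s) \<le> (d powr - p * s powr p) * exp (4 * w s)"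
          by (intro mult_right_mono) auto
        then show ?thesis using False by (simp add: mult.assoc)
      qed
    qed
  qed
  also have "\<dots> = exp (4 * w 0) * (d ^ 4 / 4) + d powr - p * (\<integral>s. s powr p * exp (4 * w s) \<partial>radial_measure)"
    using integrable_radial_measure_indicator[of d] powr_exp_int assms
    by (simp only: Bochner_Integration.integral_add[OF integrable_mult_right integrable_mult_right]
        integral_mult_right_zero integral_radial_indicator[OF less_imp_le])
  finally show ?thesis by simp
qed

text \<open>Near 0 the oscillation of \<open>\<phi>\<close> is at most \<open>\<delta>\<close>; at
  distance beyond \<open>d\<close> even \<open>\<bar>f\<bar>\<close> is at most a constant times the
  density of the weighted mass. The bound on \<open>\<bar>f\<bar>\<close> ensures that positive and
  negative parts both disappear away from 0.\<close>

lemma concentration: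
  fixes \<phi> :: "real^4 \<Rightarrow> real"
  assumes [measurable]: "\<phi> \<in> borel_measurable borel"
    and B: "\<And>x. \<bar>\<phi> x\<bar> \<le> B" and near: "\<And>x. norm x \<le> d \<Longrightarrow> \<bar>\<phi> x - \<phi> 0\<bar> \<le> \<delta>" and "0 < d"
  shows "\<bar>(\<integral>x. \<phi> x * f (norm x) \<partial>lborel) - \<phi> 0 * (2 * pi\<^sup>2 * integral\<^sup>L radial_measure f)\<bar> \<le>
    2 * pi\<^sup>2 * (\<delta> * ((\<integral>s. exp (4 * w s) \<partial>radial_measure) + (\<integral>s. s powr p * exp (4 * w s) \<partial>radial_measure))
      + 2 * B * (d powr - p + 1) * (\<integral>s. s powr p * exp (4 * w s) \<partial>radial_measure))"
proof -
  let ?E = "\<lambda>s. s powr p * exp (4 * w s)"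
  let ?g = "\<lambda>s. \<delta> * (exp (4 * w s) + ?E s) + 2 * B * (d powr - p + 1) * ?E s"
  have "0 \<le> \<delta>" using near[of 0] \<open>0 < d\<close> by simp
  have "0 \<le> B" using B[of 0] by linarith
  have g: "integrable radial_measure ?g"
    by (intro Bochner_Integration.integrable_add integrable_mult_right exp_int powr_exp_int)
  have fx: "integrable lborel (\<lambda>x :: real^4. f (norm x))"
    using f_int by (simp add: integrable_norm_iff)
  have \<phi>f: "integrable lborel (\<lambda>x. \<phi> x * f (norm x))"
  proof (rule Bochner_Integration.integrable_bound[OF integrable_mult_right[OF fx, of B]])
    show "AE x in lborel. norm (\<phi> x * f (norm x)) \<le> norm (B * f (norm x))"
      using B \<open>0 \<le> B\<close> by (intro AE_I2) (auto simp: abs_mult intro!: mult_right_mono)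
  qed measurable
  have abs_f: "\<bar>f s\<bar> \<le> exp (4 * w s) + ?E s" for s
  proof -
    have "\<bar>1 - s powr p\<bar> * exp (4 * w s) \<le> (1 + s powr p) * exp (4 * w s)"
      using powr_ge_zero[of s p] by (intro mult_right_mono abs_leI) simp_all
    then show ?thesis by (simp add: f_eq abs_mult distrib_right)
  qed
  have bound: "\<bar>(\<phi> x - \<phi> 0) * f (norm x)\<bar> \<le> ?g (norm x)" for x
  proof (cases "norm x \<le> d")
    case True
    have "\<bar>(\<phi> x - \<phi> 0) * f (norm x)\<bar> \<le> \<delta> * (exp (4 * w (norm x)) + ?E (norm x))"
      unfolding abs_mult using near[OF True] abs_f[of "norm x"] by (intro mult_mono) auto
    moreover have "0 \<le> 2 * B * (d powr - p + 1) * ?E (norm x)"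
      using \<open>0 \<le> B\<close> by simp
    ultimately show ?thesis by linarith
  next
    case False
    have "d powr p \<le> norm x powr p" using False \<open>0 < d\<close> p_pos by (intro powr_mono2) auto
    then have "1 \<le> d powr - p * norm x powr p"
      using \<open>0 < d\<close> by (simp add: powr_minus field_simps)
    then have "1 * exp (4 * w (norm x)) \<le> (d powr - p * norm x powr p) * exp (4 * w (norm x))"
      by (intro mult_right_mono) auto
    moreover have "(d powr - p + 1) * ?E (norm x) = (d powr - p * norm x powr p) * exp (4 * w (norm x)) + ?E (norm x)"
      by (simp add: algebra_simps)
    ultimately have "\<bar>f (norm x)\<bar> \<le> (d powr - p + 1) * ?E (norm x)"
      using abs_f[of "norm x"] by linarith
    moreover have "\<bar>\<phi> x - \<phi> 0\<bar> \<le> 2 * B" using B[of x] B[of 0] by linarith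
    ultimately have "\<bar>(\<phi> x - \<phi> 0) * f (norm x)\<bar> \<le> 2 * B * ((d powr - p + 1) * ?E (norm x))"
      unfolding abs_mult using \<open>0 \<le> B\<close> by (intro mult_mono) auto
    moreover have "0 \<le> \<delta> * (exp (4 * w (norm x)) + ?E (norm x))"
      using \<open>0 \<le> \<delta>\<close> by simp
    ultimately show ?thesis by (simp only: mult.assoc)
  qed
  have "(\<integral>x. \<phi> x * f (norm x) \<partial>lborel) - \<phi> 0 * (2 * pi\<^sup>2 * integral\<^sup>L radial_measure f) =
      (\<integral>x. \<phi> x * f (norm x) \<partial>lborel) - \<phi> 0 * (\<integral>x. f (norm x) \<partial>(lborel :: (real^4) measure))"
    by (simp add: integral_norm)
  also have "\<dots> = (\<integral>x. (\<phi> x - \<phi> 0) * f (norm x) \<partial>lborel)"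
    using \<phi>f fx by (simp add: left_diff_distrib)
  finally have "\<bar>(\<integral>x. \<phi> x * f (norm x) \<partial>lborel) - \<phi> 0 * (2 * pi\<^sup>2 * integral\<^sup>L radial_measure f)\<bar> =
      \<bar>\<integral>x. (\<phi> x - \<phi> 0) * f (norm x) \<partial>lborel\<bar>" by simp
  also have "\<dots> \<le> (\<integral>x. \<bar>(\<phi> x - \<phi> 0) * f (norm x)\<bar> \<partial>lborel)"
    by (rule integral_abs_bound)
  also have "\<dots> \<le> (\<integral>x. ?g (norm x) \<partial>(lborel :: (real^4) measure))"
  proof (rule integral_mono[OF _ _ bound])
    show "integrable lborel (\<lambda>x. \<bar>(\<phi> x - \<phi> 0) * f (norm x)\<bar>)"
      using \<phi>f fx by (intro integrable_abs) (simp add: left_diff_distrib)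
    show "integrable (lborel :: (real^4) measure) (\<lambda>x. ?g (norm x))"
      by (subst integrable_norm_iff[of ?g]) (use g in auto)
  qed
  also have "\<dots> = 2 * pi\<^sup>2 * (\<integral>s. ?g s \<partial>radial_measure)"
    by (rule integral_norm) measurable
  also have "(\<integral>s. ?g s \<partial>radial_measure) = \<delta> * ((\<integral>s. exp (4 * w s) \<partial>radial_measure) + (\<integral>s. ?E s \<partial>radial_measure))
      + 2 * B * (d powr - p + 1) * (\<integral>s. ?E s \<partial>radial_measure)"
    by (simp only: Bochner_Integration.integral_add[OF integrable_mult_right[OF Bochner_Integration.integrable_add[OF exp_int powr_exp_int]]
            integrable_mult_right[OF powr_exp_int]] Bochner_Integration.integral_add[OF exp_int powr_exp_int] integral_mult_right_zero)
  finally show ?thesis .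
qed

end

lemma integral_scaled_dirac:
  fixes \<phi> :: "real^4 \<Rightarrow> real"
  assumes [measurable]: "\<phi> \<in> borel_measurable borel" and "0 \<le> c"
  shows "(\<integral>x. \<phi> x \<partial>scale_measure (ennreal c) (return borel a)) = c * \<phi> a"
proof -
  have eq: "scale_measure (ennreal c) (return borel a) = density (return borel a) (\<lambda>_. ennreal c)"
    by (intro measure_eqI) (auto simp: emeasure_density nn_integral_cmult)
  show ?thesis
    unfolding eq using \<open>0 \<le> c\<close> by (subst integral_real_density) (auto simp: integral_return)
qed

theorem theorem1p4:
  fixes p :: real
    and u :: "nat \<Rightarrow> real^4 \<Rightarrow> real"
    and \<Lambda> :: "nat \<Rightarrow> real"
    and r :: "nat \<Rightarrow> real"
    and \<eta> :: "nat \<Rightarrow> real^4 \<Rightarrow> real"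
  assumes p: "0 < p" "p < 4"
    and radial: "\<And>k. radial (u k)"
    and normal: "\<And>k. normal_solution (\<lambda>x. 1 - norm x powr p) (u k)"
    and \<Lambda>: "\<And>k. \<Lambda> k = (LINT x|lebesgue. (1 - norm x powr p) * exp (4 * u k x))"
    and \<Lambda>_increasing: "incseq \<Lambda>"
    and \<Lambda>_lim: "\<Lambda> \<longlonglongrightarrow> Lambda_sph"
    and r: "\<And>k. r k = 96 powr (1/4) * exp (- u k 0)"
    and \<eta>: "\<And>k x. \<eta> k x = u k (r k *\<^sub>R x) - u k 0 + ln 2"
  shows "densities_converge_weakly (\<lambda>k x. (1 - norm x powr p) * exp (4 * u k x))
           (scale_measure (ennreal Lambda_sph) (dirac 0))
       \<and> locally_uniform_limit \<eta> (\<lambda>x. ln (2 / (1 + (norm x)\<^sup>2)))"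
proof -
  define w where "w k s = u k (s *\<^sub>R axis 1 1)" for k s
  define f where "f k s = (1 - s powr p) * exp (4 * w k s)" for k s
  note prof = normal_solution_profile[OF normal radial]
  have uw: "u k x = w k (norm x)" for k x
    unfolding w_def by (rule prof(2))
  have u0: "u k 0 = w k 0" for k by (simp add: w_def)
  have w_borel [measurable]: "w k \<in> borel_measurable borel" for k
    unfolding w_def[abs_def] by (rule prof(1))
  have f_borel [measurable]: "f k \<in> borel_measurable borel" for k
    unfolding f_def[abs_def] by measurable
  have ff: "(1 - norm x powr p) * exp (4 * u k x) = f k (norm x)" for k x
    by (simp add: f_def uw)
  define m where "m k = integral\<^sup>L radial_measure (f k)" for k
  have \<Lambda>_eq: "\<Lambda> k = 2 * pi\<^sup>2 * m k" for k
  proof -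
    have "\<Lambda> k = (\<integral>x. f k (norm x) \<partial>(lborel :: (real^4) measure))"
      unfolding \<Lambda> ff by (rule integral_completion) measurable
    then show ?thesis by (simp add: integral_norm m_def)
  qed
  have "(\<lambda>k. \<Lambda> k / (2 * pi\<^sup>2)) \<longlonglongrightarrow> Lambda_sph / (2 * pi\<^sup>2)"
    by (intro tendsto_intros \<Lambda>_lim) simp
  then have m_lim: "m \<longlonglongrightarrow> 8"
    by (simp add: \<Lambda>_eq Lambda_sph_def)
  have "\<forall>\<^sub>F k in sequentially. 0 < m k"
    using m_lim by (rule order_tendstoD) simp
  \<comment> \<open>The locale \<open>profile\<close> asks for nonnegative mass, which the limit 8
    provides only from some index on. All arguments run along the shifted sequence, and the limits
    are shifted back at the end.\<close>
  then obtain n where "\<forall>k\<ge>n. 0 < m k"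
    unfolding eventually_sequentially by blast
  then have n: "0 < m (k + n)" for k by simp
  have P: "profile p (w (k + n)) (f (k + n))" for k
  proof
    show "0 \<le> integral\<^sup>L radial_measure (f (k + n))" using n[of k] by (simp add: m_def)
    show "integrable radial_measure (f (k + n))"
      unfolding f_def[abs_def] w_def[abs_def] by (rule prof(3))
    fix r :: real assume "0 < r"
    then show "integrable radial_measure (\<lambda>s. radial_kernel r s * f (k + n) s)"
      unfolding f_def w_def by (rule prof(4))
    show "w (k + n) r = w (k + n) 0 + 1 / 4 * (\<integral>s. radial_kernel r s * f (k + n) s \<partial>radial_measure)"
      unfolding f_def w_def using \<open>0 < r\<close> by (rule prof(5))
  qed (use p in \<open>auto simp: f_def\<close>)
  define E where "E k = (\<integral>s. s powr p * exp (4 * w k s) \<partial>radial_measure)" for k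
  define M where "M k = (\<integral>s. exp (4 * w k s) \<partial>radial_measure)" for k
  have m_lim': "(\<lambda>k. m (k + n)) \<longlonglongrightarrow> 8" by (rule LIMSEQ_ignore_initial_segment[OF m_lim])
  have E_eq: "E (k + n) = 4 / p * (m (k + n) - (m (k + n))\<^sup>2 / 8)" for k
    using profile.pohozaev[OF P[of k]] p by (simp add: E_def m_def field_simps)
  \<comment> \<open>The value \<open>8 - 8\<^sup>2 / 8 = 0\<close> is where the hypothesis on the
    limit of \<open>\<Lambda>\<close> takes effect.\<close>
  have "(\<lambda>k. 4 / p * (m (k + n) - (m (k + n))\<^sup>2 / 8)) \<longlonglongrightarrow> 4 / p * (8 - 8\<^sup>2 / 8)"
    by (intro tendsto_intros m_lim') auto
  then have E_lim: "(\<lambda>k. E (k + n)) \<longlonglongrightarrow> 0" by (simp add: E_eq)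
  have M_eq: "M (k + n) = m (k + n) + E (k + n)" for k
  proof -
    have "(\<lambda>s. exp (4 * w (k + n) s)) = (\<lambda>s. f (k + n) s + s powr p * exp (4 * w (k + n) s))"
      by (simp add: f_def fun_eq_iff algebra_simps)
    then have "M (k + n) = (\<integral>s. f (k + n) s + s powr p * exp (4 * w (k + n) s) \<partial>radial_measure)"
      by (simp only: M_def)
    also have "\<dots> = m (k + n) + E (k + n)"
      unfolding m_def E_def
      by (rule Bochner_Integration.integral_add[OF profile.f_int[OF P] profile.powr_exp_int[OF P]])
    finally show ?thesis .
  qed
  have M_lim: "(\<lambda>k. M (k + n)) \<longlonglongrightarrow> 8"
    using tendsto_add[OF m_lim' E_lim] by (simp add: M_eq)
  have r_pos: "0 < r k" for k by (simp add: r)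
  have r4: "r k ^ 4 = 96 * exp (- 4 * w k 0)" for k
  proof -
    have "((96 :: real) powr (1 / 4)) ^ 4 = 96"
      by (simp add: powr_powr flip: powr_realpow)
    moreover have "exp (- u k 0) ^ 4 = exp (- 4 * w k 0)"
      using exp_of_nat_mult[of 4 "- u k 0"] by (simp add: u0)
    ultimately show ?thesis by (simp add: r power_mult_distrib)
  qed
  have r_lim: "(\<lambda>k. r (k + n)) \<longlonglongrightarrow> 0"
  proof (rule order_tendstoI)
    fix a :: real assume "a < 0"
    then show "\<forall>\<^sub>F k in sequentially. a < r (k + n)"
      using r_pos by (intro always_eventually allI) (auto intro: less_trans)
  next
    fix a :: real assume "0 < a"
    \<comment> \<open>From total mass above 7 and outer mass below 1, \<open>total_le\<close> yields
      \<open>24 * exp (- 4 * w (k + n) 0) < d ^ 4\<close>, hence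
      \<open>r (k + n) ^ 4 < 4 * d ^ 4\<close>, which is \<open>a ^ 4 / 4\<close>.\<close>
    define d where "d = a / 2"
    have "(\<lambda>k. d powr - p * E (k + n)) \<longlonglongrightarrow> d powr - p * 0"
      by (intro tendsto_intros E_lim)
    then have "\<forall>\<^sub>F k in sequentially. d powr - p * E (k + n) < 1"
      by (rule order_tendstoD) simp
    moreover have "\<forall>\<^sub>F k in sequentially. 7 < M (k + n)"
      using M_lim by (rule order_tendstoD) simp
    ultimately show "\<forall>\<^sub>F k in sequentially. r (k + n) < a"
    proof eventually_elim
      case (elim k)
      have "0 < d" using \<open>0 < a\<close> by (simp add: d_def)
      have "6 < exp (4 * w (k + n) 0) * d ^ 4 / 4"
        using profile.total_le[OF P[of k] \<open>0 < d\<close>] elim unfolding E_def M_def by linarith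
      then have "24 * exp (- 4 * w (k + n) 0) < d ^ 4"
        by (simp add: exp_minus field_simps)
      then have "r (k + n) ^ 4 < 4 * d ^ 4" by (simp add: r4)
      also have "\<dots> \<le> a ^ 4" using \<open>0 < a\<close> by (simp add: d_def power_divide)
      finally show ?case using \<open>0 < a\<close> power_less_imp_less_base by (meson less_imp_le)
    qed
  qed
  define v where "v k t = w k (r k * t) - w k 0 + ln 2" for k t
  have "locally_uniform_limit \<eta> (\<lambda>x. ln (2 / (1 + (norm x)\<^sup>2)))"
    unfolding locally_uniform_limit_def uniform_limit_iff
  proof (intro allI impI)
    fix S :: "(real^4) set" and \<epsilon> :: real
    assume "compact S" "0 < \<epsilon>"
    then obtain T where T: "0 < T" "\<And>x. x \<in> S \<Longrightarrow> norm x \<le> T"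
      using compact_imp_bounded[OF \<open>compact S\<close>] unfolding bounded_pos by blast
    have "\<forall>\<^sub>F k in sequentially. \<forall>t\<in>{0..T}. \<bar>v (k + n) t - spherical t\<bar> < \<epsilon>"
    proof (rule rescaled_profiles_converge[where p=p and q="\<lambda>k. r (k + n) powr p"])
      show "rescaled_profile p (r (k + n) powr p) (v (k + n)) (\<lambda>s. (1 - r (k + n) powr p * s powr p) * exp (4 * v (k + n) s))" for k
        unfolding v_def[abs_def] by (rule profile.rescaled_profile[OF P r_pos r4])
      have "(\<lambda>k. r (k + n) powr p) \<longlonglongrightarrow> 0 powr p"
        by (rule tendsto_powr'[OF r_lim tendsto_const]) (use p r_pos in \<open>auto intro!: always_eventually less_imp_le\<close>)
      then show "(\<lambda>k. r (k + n) powr p) \<longlonglongrightarrow> 0" by simp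
      have "(\<lambda>k. E (k + n) / 6) \<longlonglongrightarrow> 0 / 6"
        by (intro tendsto_intros E_lim) simp
      then show "(\<lambda>k. r (k + n) powr p * (\<integral>s. s powr p * exp (4 * v (k + n) s) \<partial>radial_measure)) \<longlonglongrightarrow> 0"
        unfolding v_def E_def by (simp only: profile.integral_powr_exp_rescaled[OF P r_pos r4] div_0)
    qed fact+
    \<comment> \<open>Convergence along the shifted indices is convergence of the whole
      sequence.\<close>
    then have "\<forall>\<^sub>F k in sequentially. \<forall>t\<in>{0..T}. \<bar>v k t - spherical t\<bar> < \<epsilon>"
      by (rule eventually_sequentially_seg[THEN iffD1])
    then show "\<forall>\<^sub>F k in sequentially. \<forall>x\<in>S. dist (\<eta> k x) (ln (2 / (1 + (norm x)\<^sup>2))) < \<epsilon>"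
    proof eventually_elim
      case (elim k)
      show ?case
      proof
        fix x assume "x \<in> S"
        have "\<eta> k x = v k (norm x)"
          using r_pos[of k] by (simp add: \<eta> uw v_def)
        then show "dist (\<eta> k x) (ln (2 / (1 + (norm x)\<^sup>2))) < \<epsilon>"
          using elim T(2)[OF \<open>x \<in> S\<close>] by (simp add: dist_real_def spherical_def)
      qed
    qed
  qed
  moreover have "densities_converge_weakly (\<lambda>k x. (1 - norm x powr p) * exp (4 * u k x))
           (scale_measure (ennreal Lambda_sph) (dirac 0))"
    unfolding densities_converge_weakly_def ff
  proof (intro allI impI)
    fix \<phi> :: "real^4 \<Rightarrow> real" assume cont: "continuous_on UNIV \<phi>" and bdd: "bounded (range \<phi>)"
    have [measurable]: "\<phi> \<in> borel_measurable borel"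
      by (rule borel_measurable_continuous_onI[OF cont])
    obtain B where B: "\<And>x. \<bar>\<phi> x\<bar> \<le> B"
      using bdd by (auto simp: bounded_iff)
    define X where "X k = (\<integral>x. \<phi> x * f k (norm x) \<partial>lborel)" for k
    have X_eq: "(LINT x|lebesgue. \<phi> x * f k (norm x)) = X k" for k
      unfolding X_def by (rule integral_completion) measurable
    have "(\<lambda>k. X (k + n) - \<phi> 0 * (2 * pi\<^sup>2 * m (k + n))) \<longlonglongrightarrow> 0"
    proof (rule LIMSEQ_I)
      fix \<epsilon> :: real assume "0 < \<epsilon>"
      \<comment> \<open>In the limit the bound of \<open>concentration\<close> is
        \<open>2 * pi\<^sup>2 * \<delta> * 8\<close>, which this choice makes
        \<open>\<epsilon> / 2\<close>.\<close>
      define \<delta> where "\<delta> = \<epsilon> / (32 * pi\<^sup>2)"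
      have "0 < \<delta>" using \<open>0 < \<epsilon>\<close> by (simp add: \<delta>_def)
      have "isCont \<phi> 0" using cont by (simp add: continuous_on_eq_continuous_at)
      then obtain d' where d': "0 < d'" "\<And>x. dist x 0 < d' \<Longrightarrow> dist (\<phi> x) (\<phi> 0) < \<delta>"
        using \<open>0 < \<delta>\<close> unfolding continuous_at_eps_delta by blast
      define d where "d = d' / 2"
      have d: "0 < d" using d'(1) by (simp add: d_def)
      have near: "\<bar>\<phi> x - \<phi> 0\<bar> \<le> \<delta>" if "norm x \<le> d" for x
        using d'(1) d'(2)[of x] that by (simp add: d_def dist_real_def)
      let ?b = "\<lambda>M E. 2 * pi\<^sup>2 * (\<delta> * (M + E) + 2 * B * (d powr - p + 1) * E)"
      have "(\<lambda>k. ?b (M (k + n)) (E (k + n))) \<longlonglongrightarrow> ?b 8 0"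
        by (intro tendsto_intros M_lim E_lim)
      moreover have "?b 8 0 < \<epsilon>" using \<open>0 < \<epsilon>\<close> by (simp add: \<delta>_def)
      ultimately have "\<forall>\<^sub>F k in sequentially. ?b (M (k + n)) (E (k + n)) < \<epsilon>"
        by (rule order_tendstoD)
      then have "\<forall>\<^sub>F k in sequentially. norm (X (k + n) - \<phi> 0 * (2 * pi\<^sup>2 * m (k + n)) - 0) < \<epsilon>"
      proof eventually_elim
        case (elim k)
        then show ?case
          using profile.concentration[OF P[of k], where \<phi>=\<phi> and d=d and \<delta>=\<delta>, OF _ B near d] unfolding X_def m_def M_def E_def by simp
      qed
      then show "\<exists>no. \<forall>k\<ge>no. norm (X (k + n) - \<phi> 0 * (2 * pi\<^sup>2 * m (k + n)) - 0) < \<epsilon>"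
        by (simp only: eventually_sequentially)
    qed
    moreover have "(\<lambda>k. \<phi> 0 * (2 * pi\<^sup>2 * m (k + n))) \<longlonglongrightarrow> \<phi> 0 * (2 * pi\<^sup>2 * 8)"
      by (intro tendsto_intros m_lim')
    ultimately have "(\<lambda>k. (X (k + n) - \<phi> 0 * (2 * pi\<^sup>2 * m (k + n))) + \<phi> 0 * (2 * pi\<^sup>2 * m (k + n))) \<longlonglongrightarrow> 0 + \<phi> 0 * (2 * pi\<^sup>2 * 8)"
      by (rule tendsto_add)
    then have "(\<lambda>k. X (k + n)) \<longlonglongrightarrow> Lambda_sph * \<phi> 0"
      by (simp add: Lambda_sph_def mult_ac)
    then have "X \<longlonglongrightarrow> Lambda_sph * \<phi> 0"
      by (rule LIMSEQ_offset)
    moreover have "(\<integral>x. \<phi> x \<partial>scale_measure (ennreal Lambda_sph) (dirac 0)) = Lambda_sph * \<phi> 0"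
      by (rule integral_scaled_dirac) (auto simp: Lambda_sph_def)
    ultimately show "(\<lambda>k. LINT x|lebesgue. \<phi> x * f k (norm x)) \<longlonglongrightarrow> (\<integral>x. \<phi> x \<partial>scale_measure (ennreal Lambda_sph) (dirac 0))"
      by (simp add: X_eq)
  qed
  ultimately show ?thesis by blast
qed

end
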